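(* Let $\eta^4(\tau)\eta^4(5\tau)=\sum_{n\ge 1}a(n)q^n$ be the Fourier expansion of $\eta^4(\tau)\eta^4(5\tau)$, where $q=e^{2\pi i\tau}$. For any integer $n\ge 0$, $$A_{5,2}(n)=\frac{1}{13}\bigl(\sigma_{3,5}^{\#}(n+2)-a(n+2)\bigr).$$
   Context: A partition is called $t$-core if none of its hook numbers (hook lengths) is a multiple of $t$ (the empty partition is $t$-core). A partition $k$-tuple of $n$ is an ordered $k$-tuple $(\lambda_1,\ldots,\lambda_k)$ of (possibly empty) partitions such that the sum of all the parts of all the $\lambda_i$ equals $n$. $A_{t,k}(n)$ denotes the number of partition $k$-tuples of $n$ in which each $\lambda_i$ is $t$-core. The Dedekind eta function is $\eta(\tau)=q^{1/24}\prod_{m\ge 1}(1-q^m)$ with $q=e^{2\pi i\tau}$, $\tau$ in the complex upper half plane, and $\eta^r(m\tau)$ means $(\eta(m\tau))^r$. $\nu_5(n)$ denotes the largest integer $e$ such that $5^e\mid n$. For $n\ge 1$, $$\sigma_{3,5}^{\#}(n)=5^{3\nu_5(n)}\sum_{d\mid n,\ d\not\equiv 0\ (\mathrm{mod}\ 5)}d^3,$$ the sum being over positive divisors $d$ of $n$ not divisible by $5$. *)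

theory Defs
  imports "HOL-Analysis.Analysis" "HOL-Computational_Algebra.Computational_Algebra"
begin

text \<open>A partition is the weakly decreasing list of its (positive) parts.\<close>

definition is_partition :: "nat list \<Rightarrow> bool" where
  "is_partition p \<longleftrightarrow> sorted_wrt (\<ge>) p \<and> (\<forall>x\<in>set p. 0 < x)"

text \<open>
  Cells of the Young diagram are pairs (row, column), both counted from 0.
  The hook number of a cell is its arm plus its leg plus 1.
\<close>

definition cells :: "nat list \<Rightarrow> (nat \<times> nat) set" where
  "cells p = {(i, j). i < length p \<and> j < p ! i}"

definition arm :: "nat list \<Rightarrow> nat \<times> nat \<Rightarrow> nat" where
  "arm p = (\<lambda>(i, j). card {j'. j < j' \<and> (i, j') \<in> cells p})"

definition leg :: "nat list \<Rightarrow> nat \<times> nat \<Rightarrow> nat" where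
  "leg p = (\<lambda>(i, j). card {i'. i < i' \<and> (i', j) \<in> cells p})"

definition hook_number :: "nat list \<Rightarrow> nat \<times> nat \<Rightarrow> nat" where
  "hook_number p c = arm p c + leg p c + 1"

definition is_core :: "nat \<Rightarrow> nat list \<Rightarrow> bool" where
  "is_core t p \<longleftrightarrow> (\<forall>c\<in>cells p. \<not> t dvd hook_number p c)"

definition is_partition_tuple :: "nat \<Rightarrow> nat \<Rightarrow> nat list list \<Rightarrow> bool" where
  "is_partition_tuple k n ps \<longleftrightarrow>
     length ps = k \<and> (\<forall>p\<in>set ps. is_partition p) \<and> (\<Sum>p\<leftarrow>ps. sum_list p) = n"

definition core_tuple_count :: "nat \<Rightarrow> nat \<Rightarrow> nat \<Rightarrow> nat" where
  "core_tuple_count t k n = card {ps. is_partition_tuple k n ps \<and> (\<forall>p\<in>set ps. is_core t p)}"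

definition nome :: "complex \<Rightarrow> complex" where
  "nome \<tau> = exp (2 * of_real pi * \<i> * \<tau>)"

text \<open>The factor $q^{1/24}$ means $e^{2\pi i\tau/24}$, not a branch of the root of $q$.\<close>

definition dedekind_eta :: "complex \<Rightarrow> complex" where
  "dedekind_eta \<tau> = exp (2 * of_real pi * \<i> * \<tau> / 24) * (\<Prod>m. 1 - nome \<tau> ^ Suc m)"

definition sigma_sharp_3_5 :: "nat \<Rightarrow> nat" where
  "sigma_sharp_3_5 n = 5 ^ (3 * multiplicity 5 n) * (\<Sum>d | d dvd n \<and> \<not> 5 dvd d. d ^ 3)"

end

theory Submission
  imports Defs "HOL-Complex_Analysis.Complex_Analysis"
begin

text \<open>
  With \<open>K(x) = qpoch x x\<close> and \<open>p = q\<^sup>5\<close>, three facts are combined.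

  Sliding beads on the \<open>t\<close>-abacus identifies \<open>t\<close>-cores with integer vectors of sum 0, and the
  resulting lattice sum is the constant term of a product of \<open>t\<close> theta series. By the Jacobi triple
  product it equals \<open>K(q^t)^t / K(q)\<close>.

  The Lambert series of \<open>sigma_sharp_3_5\<close> is the sum of the second derivatives of the
  Weierstrass function with period \<open>w = 5 v\<close>, \<open>exp v = q\<close>, at the torsion points \<open>v\<close> and \<open>2 v\<close>.
  The sigma function satisfies a rank two addition formula, from which the duplication and
  triplication formulas follow by differentiation. At the torsion points these become linear
  equations for the zeta function, and so the Lambert series equals \<open>B\<^sup>2 (1/k + 2 - k)\<close>, where
  \<open>B = q K(p)^5 / K(q)\<close> and \<open>k\<close> is the fifth power of the Rogers-Ramanujan continued fraction.

  Dissecting the theta series at a primitive fifth root of unity and multiplying over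
  the substitutions \<open>Q \<mapsto> z^j Q\<close>, \<open>Q^5 = q\<close>, gives \<open>1/k - 11 - k = K(q)^6 / (q K(p)^6)\<close>.
\<close>

text \<open>The factor 13 is 2 + 11: as \<open>1/k + 2 - k = (1/k - 11 - k) + 13\<close>, the
  Lambert series is \<open>13 B^2\<close> plus
  \<open>B^2 K(q)^6 / (q K(p)^6) = q K(q)^4 K(p)^4\<close>, which is the eta product. Since
  \<open>B\<close> is \<open>q\<close> times the series of 5-cores, \<open>B^2\<close> counts pairs
  of 5-cores with the exponent raised by 2; hence the argument \<open>n + 2\<close>. The 11 is
  \<open>a^5 + b^5\<close> for the two roots of \<open>x^2 = x + 1\<close>. Two torsion points
  suffice because tripling permutes them up to sign: \<open>3 v\<close> is \<open>- 2 v\<close> and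
  \<open>3 (2 v)\<close> is \<open>v\<close> modulo \<open>5 v\<close>. So the triplication formula
  at \<open>v\<close> and at \<open>2 v\<close> involves only two unknown zeta values, and the two
  second derivatives need just the combinations that these equations determine.\<close>

section \<open>Triangular numbers and convergence of theta series\<close>

definition tri :: "int \<Rightarrow> int" where
  "tri n = n * (n - 1) div 2"

lemma two_tri: "2 * tri n = n * (n - 1)"
proof -
  have "even (n * (n - 1))" by (cases "even n") auto
  then show ?thesis unfolding tri_def by (simp only: dvd_mult_div_cancel)
qed

lemma tri_eqI: "2 * m = n * (n - 1) \<Longrightarrow> tri n = m"
  using two_tri[of n] by simp

lemma tri_add1: "tri (n + 1) = tri n + n"
  by (rule tri_eqI) (use two_tri[of n] in \<open>simp add: algebra_simps\<close>)

lemma tri_minus: "tri (- n) = tri n + n"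
  by (rule tri_eqI) (use two_tri[of n] in \<open>simp add: algebra_simps\<close>)

text \<open>The exponent \<open>n (n - 1) / 2\<close> avoids a square root of the nome and puts a
  zero of the series at \<open>z = 1\<close>.\<close>

definition theta_term :: "complex \<Rightarrow> complex \<Rightarrow> int \<Rightarrow> complex" where
  "theta_term p z n = (-1) powi n * p powi tri n * z powi n"

text \<open>The infinite q-Pochhammer symbol, with the base as second argument.\<close>

definition qpoch :: "complex \<Rightarrow> complex \<Rightarrow> complex" where
  "qpoch z p = (\<Prod>n. 1 - z * p ^ n)"

text \<open>The ratio of consecutive terms is \<open>r^n * C\<close>, which tends to 0 however large
  \<open>C\<close> is.\<close>

lemma summable_quadratic_power_nat:
  fixes r C :: real
  assumes r: "0 < r" "r < 1" and C: "0 < C"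
  shows "summable (\<lambda>n. r powi tri (int n) * C ^ n)"
proof -
  have "(\<lambda>n. r ^ n * C) \<longlonglongrightarrow> 0 * C"
    by (intro tendsto_intros LIMSEQ_realpow_zero) (use r in auto)
  then have "eventually (\<lambda>n. r ^ n * C < 1/2) sequentially"
    by (intro order_tendstoD) auto
  then obtain N where N: "\<And>n. n \<ge> N \<Longrightarrow> r ^ n * C < 1/2"
    by (auto simp: eventually_at_top_linorder)
  show ?thesis
  proof (rule summable_ratio_test[of "1/2" N])
    fix n assume n: "n \<ge> N"
    have "tri (int (Suc n)) = tri (int n) + int n"
      using tri_add1[of "int n"] by (simp add: add.commute)
    then have "r powi tri (int (Suc n)) * C ^ Suc n = (r ^ n * C) * (r powi tri (int n) * C ^ n)"
      using r by (simp add: power_int_add)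
    also have "\<dots> \<le> 1/2 * (r powi tri (int n) * C ^ n)"
      by (rule mult_right_mono) (use N[OF n] r C in auto)
    finally show "norm (r powi tri (int (Suc n)) * C ^ Suc n) \<le> 1/2 * norm (r powi tri (int n) * C ^ n)"
      using r C by simp
  qed auto
qed

lemma summable_on_intI:
  fixes f :: "int \<Rightarrow> real"
  assumes "(\<lambda>n. f (int n)) summable_on UNIV" "(\<lambda>n. f (- int n)) summable_on UNIV"
  shows "f summable_on UNIV"
proof -
  have 1: "f summable_on range int"
    using assms(1) summable_on_reindex[of int UNIV f] by (simp add: o_def)
  have 2: "f summable_on range (\<lambda>n. - int n)"
    using assms(2) summable_on_reindex[of "\<lambda>n. - int n" UNIV f] by (simp add: o_def inj_on_def)
  have "n \<in> range int \<union> range (\<lambda>n. - int n)" for n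
    by (cases n rule: int_cases2) auto
  then have "range int \<union> range (\<lambda>n. - int n) = (UNIV :: int set)" by auto
  with summable_on_union[OF 1 2] show ?thesis by simp
qed

lemma summable_quadratic_power:
  fixes r C :: real
  assumes r: "0 < r" "r < 1" and C: "0 < C"
  shows "(\<lambda>n. r powi tri n * C powi n) summable_on UNIV"
proof (rule summable_on_intI)
  show "(\<lambda>n. r powi tri (int n) * C powi int n) summable_on UNIV"
    using summable_quadratic_power_nat[OF r C] r C
    by (subst summable_on_UNIV_nonneg_real_iff) auto
  \<comment> \<open>Reflection turns the negative half into a series of the same kind with
    \<open>r / C\<close> in place of \<open>C\<close>.\<close>
  have "r powi tri (- int n) * C powi - int n = r powi tri (int n) * (r / C) ^ n" for n
    using r C by (simp add: tri_minus power_int_add power_int_minus power_divide divide_simps)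
  then show "(\<lambda>n. r powi tri (- int n) * C powi - int n) summable_on UNIV"
    using summable_quadratic_power_nat[OF r, of "r / C"] r C
    by (subst summable_on_UNIV_nonneg_real_iff) auto
qed

lemma norm_theta_term: "norm (theta_term p z n) = norm p powi tri n * norm z powi n"
  by (simp add: theta_term_def norm_mult norm_power_int)

lemma abs_summable_theta_term:
  assumes "p \<noteq> 0" "norm p < 1" "z \<noteq> 0"
  shows "(\<lambda>n. norm (theta_term p z n)) summable_on UNIV"
  unfolding norm_theta_term by (rule summable_quadratic_power) (use assms in auto)

lemma theta_term_Suc:
  assumes "p \<noteq> 0" "z \<noteq> 0"
  shows "theta_term p z (n + 1) = - (z * p powi n * theta_term p z n)"
  using assms by (simp add: theta_term_def tri_add1 power_int_add)

subsection \<open>The Jacobi triple product\<close>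

definition qfac :: "complex \<Rightarrow> nat \<Rightarrow> complex" where
  "qfac p n = (\<Prod>k<n. 1 - p ^ Suc k)"

text \<open>The value 0 at negative \<open>k\<close> makes \<open>inv_qfac_pred\<close> hold at
  every integer and lets \<open>jacobi_coeff p n k\<close> vanish by itself for \<open>k\<close>
  outside \<open>-n..n\<close>.\<close>

definition inv_qfac :: "complex \<Rightarrow> int \<Rightarrow> complex" where
  "inv_qfac p k = (if k < 0 then 0 else inverse (qfac p (nat k)))"

lemma one_minus_power_nonzero:
  assumes "norm (p :: complex) < 1"
  shows "1 - p ^ Suc k \<noteq> 0"
proof
  assume "1 - p ^ Suc k = 0"
  then have "norm (p ^ Suc k) = 1" by simp
  then show False using assms power_less_one_iff[of "norm p" "Suc k"]
    by (simp add: norm_power del: power_Suc)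
qed

lemma qfac_nonzero: "norm p < 1 \<Longrightarrow> qfac p n \<noteq> 0"
  unfolding qfac_def using one_minus_power_nonzero by simp

lemma inv_qfac_pred:
  assumes "norm p < 1"
  shows "inv_qfac p (k - 1) = (1 - p powi k) * inv_qfac p k"
proof (cases "k \<ge> 1")
  case True
  then obtain n where k: "k = int (Suc n)"
    using zero_less_imp_eq_int[of k] by (auto simp: gr0_conv_Suc)
  have "1 - p ^ Suc n \<noteq> 0" using one_minus_power_nonzero[OF assms] .
  moreover have "nat (int (Suc n) - 1) = n" "p powi int (Suc n) = p ^ Suc n"
    by (simp_all only: power_int_of_nat)
  ultimately have "inv_qfac p (int (Suc n) - 1) = (1 - p powi int (Suc n)) * inv_qfac p (int (Suc n))"
    using qfac_nonzero[OF assms, of n]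
    by (simp add: inv_qfac_def qfac_def nat_add_distrib field_simps del: power_Suc)
  then show ?thesis unfolding k .
next
  case False
  then show ?thesis by (cases "k = 0") (auto simp: inv_qfac_def)
qed

text \<open>The Gaussian binomial coefficient with top \<open>2 n\<close> and bottom
  \<open>n + k\<close>.\<close>

definition jacobi_coeff :: "complex \<Rightarrow> nat \<Rightarrow> int \<Rightarrow> complex" where
  "jacobi_coeff p n k = qfac p (2 * n) * inv_qfac p (int n + k) * inv_qfac p (int n - k)"

text \<open>This is the effect on the coefficients of multiplying the finite product by
  \<open>(1 - z p^n) (1 - p^(n+1) / z)\<close>: two q-Pascal steps at once. Writing everything over
  \<open>r1\<close> and \<open>r2\<close> leaves a rational identity in \<open>A\<close>,
  \<open>t\<close> and \<open>p\<close>.\<close>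

lemma jacobi_coeff_Suc:
  assumes p: "p \<noteq> 0" "norm p < 1"
  shows "jacobi_coeff p (Suc n) k =
    (1 + p ^ (2 * n + 1)) * jacobi_coeff p n k
    + p ^ n * p powi (1 - k) * jacobi_coeff p n (k - 1)
    + p ^ Suc n * p powi k * jacobi_coeff p n (k + 1)"
proof -
  define A where "A = p ^ Suc n"
  define t where "t = p powi k"
  define c where "c = qfac p (2 * n)"
  define r1 r2 where "r1 = inv_qfac p (int n + 1 + k)" and "r2 = inv_qfac p (int n + 1 - k)"
  have t: "t \<noteq> 0" using p by (simp add: t_def)
  have c': "qfac p (2 * Suc n) = c * (1 - A ^ 2 / p) * (1 - A ^ 2)"
    using p by (simp add: qfac_def c_def A_def power2_eq_square power_mult field_simps)
  have e1: "inv_qfac p (int n + k) = (1 - A * t) * r1"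
    using inv_qfac_pred[OF p(2), of "int n + 1 + k"] p
    by (simp add: r1_def A_def t_def power_int_add algebra_simps)
  have e2: "inv_qfac p (int n - k) = (1 - A / t) * r2"
    using inv_qfac_pred[OF p(2), of "int n + 1 - k"] p
    by (simp add: r2_def A_def t_def power_int_add power_int_diff field_simps)
  have e3: "inv_qfac p (int n + k - 1) = (1 - A * t / p) * ((1 - A * t) * r1)"
    using inv_qfac_pred[OF p(2), of "int n + k"] p
    unfolding e1[symmetric] by (simp add: A_def t_def power_int_add)
  have e4: "inv_qfac p (int n - k - 1) = (1 - A / (t * p)) * ((1 - A / t) * r2)"
    using inv_qfac_pred[OF p(2), of "int n - k"] p
    unfolding e2[symmetric] by (simp add: A_def t_def power_int_diff)
  have f1: "jacobi_coeff p (Suc n) k = c * (1 - A ^ 2 / p) * (1 - A ^ 2) * r1 * r2"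
    unfolding jacobi_coeff_def c' r1_def r2_def by (simp add: add_ac)
  have f2: "jacobi_coeff p n k = c * (1 - A * t) * r1 * ((1 - A / t) * r2)"
    unfolding jacobi_coeff_def e1 e2 c_def by simp
  have f3: "jacobi_coeff p n (k - 1) = c * ((1 - A * t / p) * ((1 - A * t) * r1)) * r2"
  proof -
    have i: "int n + (k - 1) = int n + k - 1" "int n - (k - 1) = int n + 1 - k" by simp_all
    show ?thesis unfolding jacobi_coeff_def i e3 c_def r2_def by (simp only: mult.assoc)
  qed
  have f4: "jacobi_coeff p n (k + 1) = c * r1 * ((1 - A / (t * p)) * ((1 - A / t) * r2))"
  proof -
    have i: "int n + (k + 1) = int n + 1 + k" "int n - (k + 1) = int n - k - 1" by simp_all
    show ?thesis unfolding jacobi_coeff_def i e4 c_def r1_def by (simp only: mult.assoc)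
  qed
  have g1: "p ^ (2 * n + 1) = A ^ 2 / p" "p ^ n * p powi (1 - k) = A / t" "p ^ Suc n * p powi k = A * t"
    using p by (simp_all add: A_def t_def power_int_diff power_add power2_eq_square mult_2)
  have "c * (1 - A ^ 2 / p) * (1 - A ^ 2) * r1 * r2 =
    (1 + A ^ 2 / p) * (c * (1 - A * t) * r1 * ((1 - A / t) * r2))
    + A / t * (c * ((1 - A * t / p) * ((1 - A * t) * r1)) * r2)
    + A * t * (c * r1 * ((1 - A / (t * p)) * ((1 - A / t) * r2)))"
  proof -
    have "(1 - A ^ 2 / p) * (1 - A ^ 2) =
      (1 + A ^ 2 / p) * ((1 - A * t) * (1 - A / t)) + A / t * ((1 - A * t / p) * (1 - A * t))
      + A * t * ((1 - A / (t * p)) * (1 - A / t))"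
    proof -
      \<comment> \<open>\<open>algebra\<close> works with polynomials, so the inverses become
        variables tied by \<open>t * j = 1\<close>.\<close>
      define i j where "i = 1 / p" and "j = 1 / t"
      have tj: "t * j = 1" using t by (simp add: j_def)
      have "(1 - A ^ 2 * i) * (1 - A ^ 2) =
        (1 + A ^ 2 * i) * ((1 - A * t) * (1 - A * j)) + A * j * ((1 - A * t * i) * (1 - A * t))
        + A * t * ((1 - A * (j * i)) * (1 - A * j))"
        using tj by algebra
      then show ?thesis by (simp add: i_def j_def)
    qed
    then have "c * r1 * r2 * ((1 - A ^ 2 / p) * (1 - A ^ 2)) = c * r1 * r2 *
      ((1 + A ^ 2 / p) * ((1 - A * t) * (1 - A / t)) + A / t * ((1 - A * t / p) * (1 - A * t))
      + A * t * ((1 - A / (t * p)) * (1 - A / t)))" by (simp only:)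
    then show ?thesis by algebra
  qed
  then show ?thesis unfolding f1 f2 f3 f4 g1 .
qed

lemma has_sum_int_shift:
  fixes f :: "int \<Rightarrow> 'a :: {comm_monoid_add, topological_space}"
  shows "((\<lambda>k. f (k + m)) has_sum S) UNIV \<longleftrightarrow> (f has_sum S) UNIV"
  by (rule has_sum_reindex_bij_witness[of UNIV "\<lambda>k. k - m" "\<lambda>k. k + m"]) auto

text \<open>The finite form of the triple product. Summing over all integers avoids boundary terms:
  the neighbouring coefficients in the recursion become shifts of the whole series.\<close>

lemma finite_jacobi_triple_product:
  assumes p: "p \<noteq> 0" "norm p < 1" and z: "z \<noteq> 0"
  shows "((\<lambda>k. jacobi_coeff p n k * theta_term p z k) has_sum
           (\<Prod>j<n. (1 - z * p ^ j) * (1 - p / z * p ^ j))) UNIV"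
proof (induction n)
  case 0
  have "jacobi_coeff p 0 k * theta_term p z k = (if k = 0 then 1 else 0)" for k
    by (auto simp: jacobi_coeff_def inv_qfac_def qfac_def theta_term_def tri_def)
  then show ?case
    using has_sum_finite_neutralI[of "{0}" UNIV "\<lambda>k::int. if k = 0 then 1 else 0 :: complex" 1]
    by simp
next
  case (Suc n)
  define f where "f = (\<lambda>k. jacobi_coeff p n k * theta_term p z k)"
  define F where "F = (\<Prod>j<n. (1 - z * p ^ j) * (1 - p / z * p ^ j))"
  have F: "(f has_sum F) UNIV" using Suc by (simp add: f_def F_def)
  have F1: "((\<lambda>k. f (k - 1)) has_sum F) UNIV"
    using has_sum_int_shift[of f "-1" F] F by simp
  have F2: "((\<lambda>k. f (k + 1)) has_sum F) UNIV"
    using has_sum_int_shift[of f 1 F] F by simp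
  have sum: "((\<lambda>k. (1 + p ^ (2 * n + 1)) * f k + (- (z * p ^ n)) * f (k - 1) + (- (p ^ Suc n / z)) * f (k + 1))
      has_sum ((1 + p ^ (2 * n + 1)) * F + (- (z * p ^ n)) * F + (- (p ^ Suc n / z)) * F)) UNIV"
    by (intro has_sum_add has_sum_cmult_right F F1 F2)
  have "(1 + p ^ (2 * n + 1)) * f k + (- (z * p ^ n)) * f (k - 1) + (- (p ^ Suc n / z)) * f (k + 1)
      = jacobi_coeff p (Suc n) k * theta_term p z k" for k
  proof -
    have t1: "theta_term p z (k - 1) * z = - (p powi (1 - k) * theta_term p z k)"
      using theta_term_Suc[OF p(1) z, of "k - 1"] p z by (simp add: power_int_diff)
    have t2: "theta_term p z (k + 1) = - (z * p powi k * theta_term p z k)"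
      using theta_term_Suc[OF p(1) z] .
    have "(- (z * p ^ n)) * f (k - 1) = - (p ^ n * jacobi_coeff p n (k - 1)) * (theta_term p z (k - 1) * z)"
      by (simp add: f_def)
    moreover have "(- (p ^ Suc n / z)) * f (k + 1) = p ^ Suc n * p powi k * jacobi_coeff p n (k + 1) * theta_term p z k"
      using z by (simp add: f_def t2)
    ultimately show ?thesis
      unfolding t1 jacobi_coeff_Suc[OF p] by (simp add: f_def algebra_simps)
  qed
  moreover have "(1 + p ^ (2 * n + 1)) * F + (- (z * p ^ n)) * F + (- (p ^ Suc n / z)) * F
      = (\<Prod>j<Suc n. (1 - z * p ^ j) * (1 - p / z * p ^ j))"
  proof -
    have "(\<Prod>j<Suc n. (1 - z * p ^ j) * (1 - p / z * p ^ j)) = F * ((1 - z * p ^ n) * (1 - p / z * p ^ n))"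
      by (simp add: F_def)
    also have "\<dots> = (1 + p ^ (2 * n + 1)) * F + (- (z * p ^ n)) * F + (- (p ^ Suc n / z)) * F"
    proof -
      define a j where "a = p ^ n" and "j = 1 / z"
      have zj: "z * j = 1" using z by (simp add: j_def)
      have 1: "p ^ (2 * n + 1) = p * a * a" by (simp add: a_def power_add mult_2)
      have "F * ((1 - z * a) * (1 - p * j * a)) =
        (1 + p * a * a) * F + (- (z * a)) * F + (- (p * a * j)) * F"
        using zj by algebra
      then show ?thesis unfolding 1 by (simp add: a_def j_def)
    qed
    finally show ?thesis by (rule sym)
  qed
  ultimately show ?case using sum by simp
qed

lemma abs_convergent_qpoch:
  fixes p z :: complex
  assumes "norm p < 1"
  shows "abs_convergent_prod (\<lambda>n. 1 - z * p ^ n)"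
proof -
  have "summable (\<lambda>n. norm z * norm p ^ n)"
    using assms by (intro summable_mult summable_geometric) auto
  then show ?thesis
    unfolding abs_convergent_prod_conv_summable
    by (simp add: norm_mult norm_power del: summable_cmult_iff)
qed

lemma has_prod_qpoch: "norm p < 1 \<Longrightarrow> (\<lambda>n. 1 - z * p ^ n) has_prod qpoch z p"
  unfolding qpoch_def
  by (intro convergent_prod_has_prod abs_convergent_prod_imp_convergent_prod abs_convergent_qpoch)

lemma qpoch_LIMSEQ: "norm p < 1 \<Longrightarrow> (\<lambda>n. \<Prod>k<n. 1 - z * p ^ k) \<longlonglongrightarrow> qpoch z p"
  using has_prod_imp_tendsto'[OF has_prod_qpoch] .

lemma qpoch_eq_0_iff:
  assumes "norm p < 1"
  shows "qpoch z p = 0 \<longleftrightarrow> (\<exists>n. z * p ^ n = 1)"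
proof -
  have "qpoch z p = 0 \<longleftrightarrow> (\<exists>n. 1 - z * p ^ n = 0)"
    using has_prod_eq_0_iff[OF has_prod_qpoch[OF assms]] by (auto simp: image_iff)
  also have "\<dots> \<longleftrightarrow> (\<exists>n. z * p ^ n = 1)"
    by (simp only: right_minus_eq eq_commute[of 1])
  finally show ?thesis .
qed

lemma qpoch_self_nonzero: "norm p < 1 \<Longrightarrow> qpoch p p \<noteq> 0"
  using one_minus_power_nonzero[of p] unfolding qpoch_eq_0_iff power_Suc[symmetric] right_minus_eq
  by metis

lemma qfac_LIMSEQ: "norm p < 1 \<Longrightarrow> qfac p \<longlonglongrightarrow> qpoch p p"
  using qpoch_LIMSEQ[of p p] by (simp add: qfac_def[abs_def])

text \<open>Let \<open>n\<close> grow in the finite form. Each coefficient tends to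
  \<open>1 / qpoch p p\<close> and is bounded by \<open>K * L * L\<close> uniformly in
  \<open>n\<close> and \<open>k\<close>, so the theta terms dominate and Tannery's theorem
  applies.\<close>

theorem jacobi_triple_product:
  assumes p: "p \<noteq> 0" "norm p < 1" and z: "z \<noteq> 0"
  shows "(theta_term p z has_sum qpoch p p * qpoch z p * qpoch (p / z) p) UNIV"
proof -
  have lim_inv: "(\<lambda>n. inverse (qfac p n)) \<longlonglongrightarrow> inverse (qpoch p p)"
    by (intro tendsto_inverse qfac_LIMSEQ qpoch_self_nonzero p)
  obtain K where K: "\<And>n. norm (qfac p n) \<le> K"
    using convergent_imp_Bseq[OF convergentI[OF qfac_LIMSEQ[OF p(2)]]] by (auto simp: Bseq_def)
  obtain L where L: "L > 0" "\<And>n. norm (inverse (qfac p n)) \<le> L"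
    using convergent_imp_Bseq[OF convergentI[OF lim_inv]] by (auto simp: Bseq_def)
  have L': "norm (inv_qfac p k) \<le> L" for k
    using L by (auto simp: inv_qfac_def)
  have K0: "K \<ge> 0" using K[of 0] norm_ge_zero order_trans by blast
  \<comment> \<open>Tannery's theorem concerns series over the naturals, so the integers are
    enumerated by \<open>int_decode\<close>.\<close>
  define M where "M = (\<lambda>k::nat. K * L * L * norm (theta_term p z (int_decode k)))"
  define a where "a = (\<lambda>k n. jacobi_coeff p n (int_decode k) * theta_term p z (int_decode k))"
  define b where "b = (\<lambda>k. inverse (qpoch p p) * theta_term p z (int_decode k))"
  have lim_shift: "(\<lambda>n. inv_qfac p (int n + k)) \<longlonglongrightarrow> inverse (qpoch p p)" for k
  proof -
    have "eventually (\<lambda>n. inverse (qfac p (nat (int n + k))) = inv_qfac p (int n + k)) sequentially"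
      using eventually_ge_at_top[of "nat \<bar>k\<bar>"] by eventually_elim (auto simp: inv_qfac_def)
    moreover have "filterlim (\<lambda>n. nat (int n + k)) at_top sequentially"
      unfolding filterlim_at_top
    proof
      fix Z :: nat
      show "eventually (\<lambda>n. Z \<le> nat (int n + k)) sequentially"
        using eventually_ge_at_top[of "Z + nat \<bar>k\<bar>"] by eventually_elim auto
    qed
    ultimately show ?thesis
      using filterlim_compose[OF lim_inv] by (auto intro: Lim_transform_eventually)
  qed
  have "(\<lambda>n. qfac p (2 * n)) \<longlonglongrightarrow> qpoch p p"
    using LIMSEQ_subseq_LIMSEQ[OF qfac_LIMSEQ[OF p(2)], of "\<lambda>n. 2 * n"]
    by (simp add: o_def strict_mono_def)
  then have lim_a: "a k \<longlonglongrightarrow> b k" for k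
  proof -
    assume 1: "(\<lambda>n. qfac p (2 * n)) \<longlonglongrightarrow> qpoch p p"
    have "a k \<longlonglongrightarrow> qpoch p p * inverse (qpoch p p) * inverse (qpoch p p) * theta_term p z (int_decode k)"
      unfolding a_def jacobi_coeff_def
      using lim_shift[of "int_decode k"] lim_shift[of "- int_decode k"] 1
      by (intro tendsto_intros) auto
    then show ?thesis using qpoch_self_nonzero[OF p(2)] by (simp add: b_def)
  qed
  have bd: "norm (a k n) \<le> M k" for k n
  proof -
    have "norm (jacobi_coeff p n (int_decode k)) \<le> K * L * L"
      unfolding jacobi_coeff_def norm_mult
      by (intro mult_mono K L') (use K0 L in auto)
    then show ?thesis unfolding a_def M_def norm_mult by (rule mult_right_mono) auto
  qed
  have dec: "bij_betw int_decode UNIV UNIV" by (rule bij_int_decode)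
  have "(\<lambda>k. norm (theta_term p z (int_decode k))) summable_on UNIV"
    using abs_summable_theta_term[OF p z]
      summable_on_reindex_bij_betw[OF dec, of "\<lambda>k. norm (theta_term p z k)"] by simp
  then have sM: "summable M"
    unfolding M_def by (intro summable_mult summable_on_imp_summable)
  have "(\<lambda>n. \<Sum>k. a k n) \<longlonglongrightarrow> (\<Sum>k. b k)"
    using tannerys_theorem[of a b sequentially M] lim_a bd sM by (simp add: always_eventually)
  moreover have "(\<Sum>k. a k n) = (\<Prod>j<n. 1 - z * p ^ j) * (\<Prod>j<n. 1 - p / z * p ^ j)" for n
  proof -
    have "((\<lambda>k. a k n) has_sum (\<Prod>j<n. (1 - z * p ^ j) * (1 - p / z * p ^ j))) UNIV"
      unfolding a_def has_sum_reindex_bij_betw[OF dec, of "\<lambda>k. jacobi_coeff p n k * theta_term p z k"]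
      by (rule finite_jacobi_triple_product[OF p z])
    then show ?thesis using has_sum_imp_sums sums_unique by (fastforce simp: prod.distrib)
  qed
  moreover have "(\<lambda>n. (\<Prod>j<n. 1 - z * p ^ j) * (\<Prod>j<n. 1 - p / z * p ^ j)) \<longlonglongrightarrow> qpoch z p * qpoch (p / z) p"
    by (intro tendsto_mult qpoch_LIMSEQ p)
  ultimately have eq: "(\<Sum>k. b k) = qpoch z p * qpoch (p / z) p"
    using LIMSEQ_unique by auto
  obtain S where S: "(theta_term p z has_sum S) UNIV"
    using abs_summable_summable[OF abs_summable_theta_term[OF p z]] by (auto simp: summable_on_def)
  have "(b has_sum inverse (qpoch p p) * S) UNIV"
    unfolding b_def
    by (intro has_sum_cmult_right) (use S has_sum_reindex_bij_betw[OF dec, of "theta_term p z"] in auto)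
  then have "inverse (qpoch p p) * S = qpoch z p * qpoch (p / z) p"
    using eq has_sum_imp_sums sums_unique by metis
  then have "S = qpoch p p * qpoch z p * qpoch (p / z) p"
    using qpoch_self_nonzero[OF p(2)] by (simp add: field_simps)
  with S show ?thesis by simp
qed

subsection \<open>Odd theta function in additive notation\<close>

text \<open>For complex families summability is absolute summability, and this carries over to the
  product family.\<close>

lemma has_sum_product_complex:
  fixes f :: "'a \<Rightarrow> complex" and g :: "'b \<Rightarrow> complex"
  assumes f: "(f has_sum a) A" and g: "(g has_sum b) B"
  shows "((\<lambda>(x, y). f x * g y) has_sum a * b) (A \<times> B)"
proof (rule has_sum_SigmaI)
  show "((\<lambda>y. case (x, y) of (x, y) \<Rightarrow> f x * g y) has_sum f x * b) B" for x
    using g by (simp add: has_sum_cmult_right)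
  show "((\<lambda>x. f x * b) has_sum a * b) A"
    using f by (rule has_sum_cmult_left)
  have f': "(\<lambda>x. norm (f x)) summable_on A" and g': "(\<lambda>x. norm (g x)) summable_on B"
    using f g has_sum_imp_summable summable_on_iff_abs_summable_on_complex by blast+
  have "(\<lambda>z. norm (case z of (x, y) \<Rightarrow> f x * g y)) summable_on (A \<times> B)"
    unfolding Infinite_Sum.abs_summable_on_Sigma_iff
  proof (intro conjI ballI)
    show "(\<lambda>y. norm (case (x, y) of (x, y) \<Rightarrow> f x * g y)) summable_on B" for x
      using g' by (simp add: norm_mult summable_on_cmult_right)
    have "(\<Sum>\<^sub>\<infinity>y\<in>B. norm (case (x, y) of (x, y) \<Rightarrow> f x * g y)) = norm (f x) * (\<Sum>\<^sub>\<infinity>y\<in>B. norm (g y))" for x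
      using g' by (simp add: norm_mult infsum_cmult_right)
    then show "(\<lambda>x. norm (\<Sum>\<^sub>\<infinity>y\<in>B. norm (case (x, y) of (x, y) \<Rightarrow> f x * g y))) summable_on A"
      using f' by (simp add: summable_on_cmult_left abs_mult infsum_nonneg)
  qed
  then show "(\<lambda>(x, y). f x * g y) summable_on A \<times> B"
    by (rule abs_summable_summable)
qed

text \<open>The exponential of \<open>R * |n|\<close> is at most \<open>E^n + E^(-n)\<close> with
  \<open>E = exp |R|\<close>, and each summand merely rescales \<open>s\<close>; the quadratic
  exponent of \<open>r\<close> wins.\<close>

lemma summable_gaussian:
  fixes r s R b :: real
  assumes r: "0 < r" "r < 1" and s: "0 < s"
  shows "(\<lambda>n. r powi tri n * s powi n * exp (R * \<bar>of_int n\<bar> + b)) summable_on UNIV"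
proof (rule summable_on_comparison_test)
  define E where "E = exp \<bar>R\<bar>"
  have E: "E > 0" by (simp add: E_def)
  show "(\<lambda>n. exp b * (r powi tri n * (s * E) powi n + r powi tri n * (s / E) powi n)) summable_on UNIV"
    by (intro summable_on_cmult_right summable_on_add summable_quadratic_power) (use r s E in auto)
  show "r powi tri n * s powi n * exp (R * \<bar>of_int n\<bar> + b)
      \<le> exp b * (r powi tri n * (s * E) powi n + r powi tri n * (s / E) powi n)" for n
  proof -
    have "exp (R * \<bar>of_int n\<bar>) \<le> exp (\<bar>R\<bar> * \<bar>of_int n :: real\<bar>)"
      by (auto intro: mult_right_mono)
    also have "\<dots> \<le> E powi n + E powi (- n)"
    proof -
      have "exp (\<bar>R\<bar> * of_int n) = E powi n" "exp (- (\<bar>R\<bar> * of_int n)) = E powi (- n)"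
        by (simp_all add: E_def exp_power_int mult.commute power_int_minus exp_minus)
      then show ?thesis using E by (cases "n \<ge> 0") (auto simp: )
    qed
    finally have "(r powi tri n * s powi n * exp b) * exp (R * \<bar>of_int n\<bar>)
        \<le> (r powi tri n * s powi n * exp b) * (E powi n + E powi (- n))"
      by (rule mult_left_mono) (use r s in auto)
    then show ?thesis
      using E by (simp add: exp_add power_int_mult_distrib power_int_divide_distrib power_int_minus
          field_simps)
  qed
qed (use r s in auto)

text \<open>The M-test on each disc of radius \<open>R\<close>: frequencies of linear growth cost a
  factor \<open>exp (R * (a * |n| + b))\<close>, which \<open>summable_gaussian\<close> allows. The
  generality covers \<open>sig\<close>, \<open>odd_theta\<close> and \<open>even_theta\<close>
  together.\<close>

lemma entire_exp_sum:
  fixes c l :: "int \<Rightarrow> complex"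
  assumes "0 < r" "r < 1" "0 < s"
    and c: "\<And>n. norm (c n) = r powi tri n * s powi n"
    and l: "\<And>n. norm (l n) \<le> a * \<bar>of_int n\<bar> + b"
  shows "(\<lambda>u. \<Sum>\<^sub>\<infinity>n. c n * exp (l n * u)) holomorphic_on UNIV"
    and "((\<lambda>n. c n * exp (l n * u)) has_sum (\<Sum>\<^sub>\<infinity>n. c n * exp (l n * u))) UNIV"
proof -
  define M where "M = (\<lambda>R n. r powi tri n * s powi n * exp (R * a * \<bar>real_of_int n\<bar> + R * b))"
  have M: "M R summable_on UNIV" for R
    unfolding M_def by (rule summable_gaussian) fact+
  have bd: "norm (c n * exp (l n * x)) \<le> M R n" if "norm x \<le> R" for x R n
  proof -
    have "Re (l n * x) \<le> norm (l n * x)" by (rule complex_Re_le_cmod)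
    also have "\<dots> \<le> (a * \<bar>of_int n\<bar> + b) * R"
      unfolding norm_mult using that l[of n] norm_ge_zero order_trans
      by (intro mult_mono) (auto intro: order_trans[OF norm_ge_zero l])
    finally have "exp (Re (l n * x)) \<le> exp (R * a * \<bar>real_of_int n\<bar> + R * b)"
      by (simp add: algebra_simps)
    then show ?thesis
      unfolding M_def norm_mult c norm_exp_eq_Re using assms(1-3) by (intro mult_left_mono) auto
  qed
  have ul: "uniform_limit (cball 0 R) (\<lambda>X u. \<Sum>n\<in>X. c n * exp (l n * u)) (\<lambda>u. \<Sum>\<^sub>\<infinity>n. c n * exp (l n * u))
      (finite_subsets_at_top UNIV)" for R
    by (rule Weierstrass_m_test_general[OF _ M]) (use bd in auto)
  have "(\<lambda>u. \<Sum>\<^sub>\<infinity>n. c n * exp (l n * u)) holomorphic_on ball 0 R" for R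
  proof (rule holomorphic_uniform_limit[OF _ ul])
    show "\<forall>\<^sub>F X in finite_subsets_at_top UNIV. continuous_on (cball 0 R) (\<lambda>u. \<Sum>n\<in>X. c n * exp (l n * u)) \<and>
      (\<lambda>u. \<Sum>n\<in>X. c n * exp (l n * u)) holomorphic_on ball 0 R"
      by (intro always_eventually allI conjI continuous_intros holomorphic_intros)
  qed auto
  then have "(\<lambda>u. \<Sum>\<^sub>\<infinity>n. c n * exp (l n * u)) field_differentiable (at x)" for x
    by (rule holomorphic_on_imp_differentiable_at[of _ "ball 0 (norm x + 1)"]) auto
  then show "(\<lambda>u. \<Sum>\<^sub>\<infinity>n. c n * exp (l n * u)) holomorphic_on UNIV"
    by (auto simp: holomorphic_on_def)
  have "(\<lambda>n. c n * exp (l n * u)) summable_on UNIV"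
    by (rule abs_summable_summable, rule Infinite_Sum.abs_summable_on_comparison_test'[OF M[of "norm u"]]) (use bd in auto)
  then show "((\<lambda>n. c n * exp (l n * u)) has_sum (\<Sum>\<^sub>\<infinity>n. c n * exp (l n * u))) UNIV"
    by (rule has_sum_infsum)
qed

text \<open>\<open>sig w u\<close> is \<open>exp (- u / 2)\<close> times the theta series with nome \<open>exp w\<close> at \<open>exp u\<close>: an odd function of \<open>u\<close>
  in the role of the Weierstrass sigma function.\<close>

definition sig_term :: "complex \<Rightarrow> complex \<Rightarrow> int \<Rightarrow> complex" where
  "sig_term w u n = (-1) powi n * exp (of_int (tri n) * w) * exp ((of_int n - 1/2) * u)"

definition sig :: "complex \<Rightarrow> complex \<Rightarrow> complex" where
  "sig w u = (\<Sum>\<^sub>\<infinity>n. sig_term w u n)"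

text \<open>The series \<open>exp (m^2 w / 4 + m u)\<close> is separated into even and odd
  \<open>m\<close>, the odd part divided by \<open>exp (w / 4)\<close>. The two sums span the
  second-order theta functions, to which \<open>sig w (u + v) * sig w (u - v)\<close> belongs for
  every \<open>v\<close>.\<close>

definition odd_term :: "complex \<Rightarrow> complex \<Rightarrow> int \<Rightarrow> complex" where
  "odd_term w u k = exp (of_int (k * k + k) * w) * exp (of_int (2 * k + 1) * u)"

definition even_term :: "complex \<Rightarrow> complex \<Rightarrow> int \<Rightarrow> complex" where
  "even_term w u k = exp (of_int (k * k) * w) * exp (of_int (2 * k) * u)"

definition odd_theta :: "complex \<Rightarrow> complex \<Rightarrow> complex" where
  "odd_theta w u = (\<Sum>\<^sub>\<infinity>k. odd_term w u k)"

definition even_theta :: "complex \<Rightarrow> complex \<Rightarrow> complex" where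
  "even_theta w u = (\<Sum>\<^sub>\<infinity>k. even_term w u k)"

lemma norm_exp_int: "norm (exp (of_int k * w)) = exp (Re w) powi k"
  by (simp add: exp_power_int mult.commute)

lemma
  assumes w: "Re w < 0"
  shows holomorphic_sig: "sig w holomorphic_on UNIV"
    and has_sum_sig: "(sig_term w u has_sum sig w u) UNIV"
proof -
  have c: "norm ((-1) powi n * exp (of_int (tri n) * w)) = exp (Re w) powi tri n * 1 powi n" for n
    by (simp add: norm_mult norm_exp_int norm_power_int del: norm_exp_eq_Re)
  have l: "norm (of_int n - 1/2 :: complex) \<le> 1 * \<bar>of_int n\<bar> + 1/2" for n
    using norm_triangle_ineq4[of "of_int n :: complex" "1/2"] by simp
  note * = entire_exp_sum[OF _ _ _ c l]
  show "sig w holomorphic_on UNIV"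
    using *(1) w unfolding sig_def[abs_def] sig_term_def by simp
  show "(sig_term w u has_sum sig w u) UNIV"
    using *(2) w unfolding sig_def[abs_def] sig_term_def[abs_def] by simp
qed

lemma
  assumes w: "Re w < 0"
  shows holomorphic_odd_theta: "odd_theta w holomorphic_on UNIV"
    and has_sum_odd_theta: "(odd_term w u has_sum odd_theta w u) UNIV"
proof -
  have c: "norm (exp (of_int (k * k + k) * w)) = exp (2 * Re w) powi tri k * exp (2 * Re w) powi k" for k
  proof -
    have "k * k + k = 2 * tri k + 2 * k" using two_tri[of k] by (simp add: algebra_simps)
    then show ?thesis
      by (simp add: exp_power_int exp_add[symmetric] algebra_simps)
  qed
  have l: "norm (of_int (2 * k + 1) :: complex) \<le> 2 * \<bar>of_int k\<bar> + 1" for k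
    using norm_triangle_ineq[of "of_int (2 * k) :: complex" 1] by (simp add: norm_mult)
  note * = entire_exp_sum[OF _ _ _ c l]
  show "odd_theta w holomorphic_on UNIV"
    using *(1) w unfolding odd_theta_def[abs_def] odd_term_def by simp
  show "(odd_term w u has_sum odd_theta w u) UNIV"
    using *(2) w unfolding odd_theta_def[abs_def] odd_term_def[abs_def] by simp
qed

lemma
  assumes w: "Re w < 0"
  shows holomorphic_even_theta: "even_theta w holomorphic_on UNIV"
    and has_sum_even_theta: "(even_term w u has_sum even_theta w u) UNIV"
proof -
  have c: "norm (exp (of_int (k * k) * w)) = exp (2 * Re w) powi tri k * exp (Re w) powi k" for k
  proof -
    have "k * k = 2 * tri k + k" using two_tri[of k] by (simp add: algebra_simps)
    then show ?thesis
      by (simp add: exp_power_int exp_add[symmetric] algebra_simps)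
  qed
  have l: "norm (of_int (2 * k) :: complex) \<le> 2 * \<bar>of_int k\<bar> + 0" for k
    by (simp add: norm_mult)
  note * = entire_exp_sum[OF _ _ _ c l]
  show "even_theta w holomorphic_on UNIV"
    using *(1) w unfolding even_theta_def[abs_def] even_term_def by simp
  show "(even_term w u has_sum even_theta w u) UNIV"
    using *(2) w unfolding even_theta_def[abs_def] even_term_def[abs_def] by simp
qed

text \<open>The substitution \<open>n\<close> to \<open>1 - n\<close> fixes \<open>tri n\<close> and
  reverses both the sign \<open>(-1)^n\<close> and the frequency \<open>n - 1/2\<close>.\<close>

lemma sig_minus: "sig w (- u) = - sig w u"
proof -
  have *: "sig_term w (- u) (1 - n) = - sig_term w u n" for n
  proof -
    have "tri (1 - n) = tri n" by (rule tri_eqI) (use two_tri[of n] in \<open>simp add: algebra_simps\<close>)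
    moreover have "(-1 :: complex) powi (1 - n) = - ((-1) powi n)"
      by (cases "even n") (simp_all add: power_int_minus_left)
    ultimately show ?thesis by (simp add: sig_term_def algebra_simps)
  qed
  have "(\<Sum>\<^sub>\<infinity>n. sig_term w (- u) n) = (\<Sum>\<^sub>\<infinity>n. - sig_term w u n)"
    by (rule infsum_reindex_bij_witness[of UNIV "\<lambda>n. 1 - n" "\<lambda>n. 1 - n"]) (simp_all flip: *)
  then show ?thesis by (simp add: sig_def infsum_uminus)
qed

lemma sig_0: "sig w 0 = 0"
  using sig_minus[of w 0] by simp

lemma sig_add_period:
  shows "sig w (u + w) = - (exp (- (w / 2) - u) * sig w u)"
proof -
  have "sig_term w (u + w) n = - (exp (- (w / 2) - u) * sig_term w u (n + 1))" for n
  proof -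
    have "(-1 :: complex) powi (n + 1) = - ((-1) powi n)"
      by (simp add: power_int_add)
    moreover have "exp (of_int (tri n) * w) * exp ((of_int n - 1/2) * (u + w)) =
      exp (- (w / 2) - u) * (exp (of_int (tri (n + 1)) * w) * exp ((of_int (n + 1) - 1/2) * u))"
      unfolding exp_add[symmetric] tri_add1 by (rule arg_cong[of _ _ exp]) (simp add: field_simps)
    ultimately show ?thesis by (simp add: sig_term_def mult.assoc)
  qed
  then have "sig w (u + w) = (\<Sum>\<^sub>\<infinity>n. - (exp (- (w / 2) - u) * sig_term w u (n + 1)))"
    by (simp add: sig_def)
  also have "\<dots> = - (exp (- (w / 2) - u) * (\<Sum>\<^sub>\<infinity>n. sig_term w u (n + 1)))"
    by (simp add: infsum_uminus infsum_cmult_right')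
  also have "(\<Sum>\<^sub>\<infinity>n. sig_term w u (n + 1)) = (\<Sum>\<^sub>\<infinity>n. sig_term w u n)"
    by (rule infsum_reindex_bij_witness[of UNIV "\<lambda>n. n - 1" "\<lambda>n. n + 1"]) auto
  finally show ?thesis by (simp add: sig_def)
qed

text \<open>Splitting the double series for the left-hand side by the parity of the index sum.\<close>

lemma sig_add_mult_sig_diff:
  assumes w: "Re w < 0"
  shows "sig w (u + v) * sig w (u - v) = odd_theta w u * even_theta w v - even_theta w u * odd_theta w v"
proof -
  define f where "f = (\<lambda>(m, n). sig_term w (u + v) m * sig_term w (u - v) n)"
  define E D :: "(int \<times> int) set" where "E = {(m, n). even (m + n)}" and "D = {(m, n). odd (m + n)}"
  have all: "(f has_sum sig w (u + v) * sig w (u - v)) UNIV"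
    using has_sum_product_complex[OF has_sum_sig[OF w] has_sum_sig[OF w]] by (simp add: f_def)
  have "((\<lambda>(k, l). odd_term w u k * even_term w v l) has_sum odd_theta w u * even_theta w v) (UNIV \<times> UNIV)"
    by (intro has_sum_product_complex has_sum_odd_theta has_sum_even_theta w)
  also have "?this \<longleftrightarrow> (f has_sum odd_theta w u * even_theta w v) E"
  \<comment> \<open>The term at \<open>(m, n)\<close> has frequency \<open>m + n - 1\<close> in
    \<open>u\<close> and \<open>m - n\<close> in \<open>v\<close>. For even \<open>m + n\<close>
    these are \<open>2 k + 1\<close> and \<open>2 l\<close>; for odd \<open>m + n\<close>, treated
    below, they are \<open>2 k\<close> and \<open>2 l + 1\<close>, and the sign is negative.\<close>
  proof (rule has_sum_reindex_bij_witness[of _ "\<lambda>(m, n). ((m + n) div 2 - 1, (m - n) div 2)"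
        "\<lambda>(k, l). (k + l + 1, k - l + 1)"])
    fix a :: "int \<times> int"
    obtain k l where a: "a = (k, l)" by (cases a)
    have t: "tri (k + l + 1) + tri (k - l + 1) = (k * k + k) + l * l"
      using two_tri[of "k + l + 1"] two_tri[of "k - l + 1"] by (simp add: algebra_simps)
    have s: "(-1 :: complex) powi (k + l + 1) * (-1) powi (k - l + 1) = 1"
      by (simp add: power_int_add[symmetric])
    have e: "of_int (tri (k + l + 1)) * w + of_int (tri (k - l + 1)) * w = of_int (k * k + k) * w + of_int (l * l) * w"
      unfolding ring_distribs(2)[symmetric] of_int_add[symmetric] t ..
    have "f (k + l + 1, k - l + 1) =
      ((-1) powi (k + l + 1) * (-1) powi (k - l + 1)) *
      exp ((of_int (tri (k + l + 1)) * w + of_int (tri (k - l + 1)) * w) + ((of_int (k + l + 1) - 1/2) * (u + v) +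
        (of_int (k - l + 1) - 1/2) * (u - v)))"
      by (simp add: f_def sig_term_def exp_add mult_ac)
    also have "(of_int (k + l + 1) - 1/2) * (u + v) + (of_int (k - l + 1) - 1/2) * (u - v) =
        of_int (2 * k + 1) * u + of_int (2 * l) * v"
      by (simp add: field_simps)
    finally have "f (k + l + 1, k - l + 1) = odd_term w u k * even_term w v l"
      unfolding s e by (simp add: odd_term_def even_term_def exp_add mult_ac)
    then show "f (case a of (k, l) \<Rightarrow> (k + l + 1, k - l + 1)) = (case a of (k, l) \<Rightarrow> odd_term w u k * even_term w v l)"
      by (simp add: a)
  qed (clarsimp simp: E_def; presburger)+
  finally have even: "(f has_sum odd_theta w u * even_theta w v) E" .
  have "((\<lambda>(k, l). even_term w u k * odd_term w v l) has_sum even_theta w u * odd_theta w v) (UNIV \<times> UNIV)"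
    by (intro has_sum_product_complex has_sum_odd_theta has_sum_even_theta w)
  then have "((\<lambda>kl. - (case kl of (k, l) \<Rightarrow> even_term w u k * odd_term w v l)) has_sum
      - (even_theta w u * odd_theta w v)) (UNIV \<times> UNIV)"
    by (rule has_sum_uminusI)
  also have "?this \<longleftrightarrow> (f has_sum - (even_theta w u * odd_theta w v)) D"
  proof (rule has_sum_reindex_bij_witness[of _ "\<lambda>(m, n). ((m + n) div 2, (m - n) div 2)"
        "\<lambda>(k, l). (k + l + 1, k - l)"])
    fix a :: "int \<times> int"
    obtain k l where a: "a = (k, l)" by (cases a)
    have t: "tri (k + l + 1) + tri (k - l) = k * k + (l * l + l)"
      using two_tri[of "k + l + 1"] two_tri[of "k - l"] by (simp add: algebra_simps)
    have s: "(-1 :: complex) powi (k + l + 1) * (-1) powi (k - l) = - 1"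
      by (simp add: power_int_add[symmetric])
    have e: "of_int (tri (k + l + 1)) * w + of_int (tri (k - l)) * w = of_int (k * k) * w + of_int (l * l + l) * w"
      unfolding ring_distribs(2)[symmetric] of_int_add[symmetric] t ..
    have "f (k + l + 1, k - l) =
      ((-1) powi (k + l + 1) * (-1) powi (k - l)) *
      exp ((of_int (tri (k + l + 1)) * w + of_int (tri (k - l)) * w) + ((of_int (k + l + 1) - 1/2) * (u + v) +
        (of_int (k - l) - 1/2) * (u - v)))"
      by (simp add: f_def sig_term_def exp_add mult_ac)
    also have "(of_int (k + l + 1) - 1/2) * (u + v) + (of_int (k - l) - 1/2) * (u - v) =
        of_int (2 * k) * u + of_int (2 * l + 1) * v"
      by (simp add: field_simps)
    finally have "f (k + l + 1, k - l) = - (even_term w u k * odd_term w v l)"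
      unfolding s e by (simp add: odd_term_def even_term_def exp_add mult_ac)
    then show "f (case a of (k, l) \<Rightarrow> (k + l + 1, k - l)) = - (case a of (k, l) \<Rightarrow> even_term w u k * odd_term w v l)"
      by (simp add: a)
  qed (clarsimp simp: D_def; presburger)+
  finally have odd: "(f has_sum - (even_theta w u * odd_theta w v)) D" .
  have "E \<inter> D = {}" "E \<union> D = UNIV" by (auto simp: E_def D_def)
  with has_sum_Un_disjoint[OF even odd]
  have "(f has_sum odd_theta w u * even_theta w v - even_theta w u * odd_theta w v) UNIV" by simp
  with all show ?thesis by (rule has_sum_unique)
qed

lemma sig_eq_qpoch:
  assumes w: "Re w < 0"
  shows "sig w u = exp (- (u / 2)) * (qpoch (exp w) (exp w) * qpoch (exp u) (exp w) * qpoch (exp (w - u)) (exp w))"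
proof -
  have "(theta_term (exp w) (exp u) has_sum qpoch (exp w) (exp w) * qpoch (exp u) (exp w) * qpoch (exp w / exp u) (exp w)) UNIV"
    by (rule jacobi_triple_product) (use w in auto)
  then have "((\<lambda>n. exp (- (u / 2)) * theta_term (exp w) (exp u) n) has_sum
     exp (- (u / 2)) * (qpoch (exp w) (exp w) * qpoch (exp u) (exp w) * qpoch (exp (w - u)) (exp w))) UNIV"
    by (intro has_sum_cmult_right) (simp add: exp_diff)
  moreover have "exp (- (u / 2)) * theta_term (exp w) (exp u) n = sig_term w u n" for n
  proof -
    have "exp (- (u / 2)) * exp (of_int n * u) = exp ((of_int n - 1/2) * u)"
      unfolding exp_add[symmetric] by (rule arg_cong[of _ _ exp]) (simp add: field_simps)
    then show ?thesis by (simp add: sig_term_def theta_term_def exp_power_int mult.left_commute)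
  qed
  ultimately have "(sig_term w u has_sum
     exp (- (u / 2)) * (qpoch (exp w) (exp w) * qpoch (exp u) (exp w) * qpoch (exp (w - u)) (exp w))) UNIV" by simp
  with has_sum_sig[OF w] show ?thesis by (rule has_sum_unique)
qed

subsection \<open>Logarithmic derivatives and Lambert series\<close>

lemma uniform_limit_qpoch:
  assumes p: "norm p < 1"
  shows "uniform_limit (cball 0 R) (\<lambda>n x. \<Prod>k<n. 1 - x * p ^ k) (\<lambda>x. qpoch x p) sequentially"
proof -
  have "uniformly_convergent_on (cball 0 R) (\<lambda>N x. \<Prod>n<N. 1 - x * p ^ n)"
  proof (rule uniformly_convergent_on_prod')
    show "uniformly_convergent_on (cball 0 R) (\<lambda>N x. \<Sum>n<N. norm (1 - x * p ^ n - 1))"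
    proof (rule Weierstrass_m_test')
      show "norm (norm (1 - x * p ^ n - 1)) \<le> \<bar>R\<bar> * norm p ^ n" if "x \<in> cball 0 R" for n x
        using that by (auto simp: norm_mult norm_power intro!: mult_right_mono)
      show "summable (\<lambda>n. \<bar>R\<bar> * norm p ^ n)"
        using p by (intro summable_mult summable_geometric) auto
    qed
  qed (auto intro!: continuous_intros)
  then obtain l where l: "uniform_limit (cball 0 R) (\<lambda>n x. \<Prod>k<n. 1 - x * p ^ k) l sequentially"
    by (auto simp: uniformly_convergent_on_def)
  have "l x = qpoch x p" if "x \<in> cball 0 R" for x
    using tendsto_uniform_limitI[OF l that] qpoch_LIMSEQ[OF p] by (rule LIMSEQ_unique)
  then have "uniform_limit (cball 0 R) (\<lambda>n x. \<Prod>k<n. 1 - x * p ^ k) l sequentially \<longleftrightarrow>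
      uniform_limit (cball 0 R) (\<lambda>n x. \<Prod>k<n. 1 - x * p ^ k) (\<lambda>x. qpoch x p) sequentially"
    by (intro uniform_limit_cong') auto
  with l show ?thesis by simp
qed

lemma qpoch_holomorphic:
  assumes p: "norm p < 1"
  shows "(\<lambda>x. qpoch x p) holomorphic_on UNIV"
proof (rule holomorphic_uniform_sequence[where f = "\<lambda>n x. \<Prod>k<n. 1 - x * p ^ k"])
  show "\<exists>d>0. cball x d \<subseteq> UNIV \<and>
      uniform_limit (cball x d) (\<lambda>n x. \<Prod>k<n. 1 - x * p ^ k) (\<lambda>x. qpoch x p) sequentially" for x
  proof (intro exI[of _ 1] conjI)
    have "cball x 1 \<subseteq> cball 0 (norm x + 1)"
    proof
      fix y assume "y \<in> cball x 1"
      then show "y \<in> cball 0 (norm x + 1)"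
        using norm_triangle_ineq2[of y x] by (simp add: dist_norm norm_minus_commute)
    qed
    then show "uniform_limit (cball x 1) (\<lambda>n x. \<Prod>k<n. 1 - x * p ^ k) (\<lambda>x. qpoch x p) sequentially"
      using uniform_limit_qpoch[OF p] uniform_limit_on_subset by blast
  qed auto
qed (auto intro!: holomorphic_intros)

lemma qpoch_Suc:
  assumes p: "norm p < 1"
  shows "qpoch x p = (1 - x) * qpoch (x * p) p"
proof -
  have "(\<lambda>n. (1 - x) * (\<Prod>k<n. 1 - x * p * p ^ k)) \<longlonglongrightarrow> (1 - x) * qpoch (x * p) p"
    by (intro tendsto_intros qpoch_LIMSEQ p)
  moreover have "(1 - x) * (\<Prod>k<n. 1 - x * p * p ^ k) = (\<Prod>k<Suc n. 1 - x * p ^ k)" for n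
    by (simp only: prod.lessThan_Suc_shift) (simp add: mult.assoc)
  moreover have "(\<lambda>n. \<Prod>k<Suc n. 1 - x * p ^ k) \<longlonglongrightarrow> qpoch x p"
    using qpoch_LIMSEQ[OF p] by (rule LIMSEQ_Suc)
  ultimately show ?thesis by (simp only:) (rule LIMSEQ_unique)
qed

text \<open>\<open>lambert p k x\<close> is \<open>(x d/dx)^(k+1)\<close> applied to \<open>- ln (qpoch x p)\<close>.\<close>

definition lambert_coeff :: "complex \<Rightarrow> nat \<Rightarrow> nat \<Rightarrow> complex" where
  "lambert_coeff p k m = of_nat m ^ k * (if m = 0 then 0 else 1 / (1 - p ^ m))"

definition lambert :: "complex \<Rightarrow> nat \<Rightarrow> complex \<Rightarrow> complex" where
  "lambert p k x = (\<Sum>m. lambert_coeff p k m * x ^ m)"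

lemma lambert_coeff_Suc: "lambert_coeff p (Suc k) m = of_nat m * lambert_coeff p k m"
  by (simp add: lambert_coeff_def)

lemma norm_one_minus_power_ge:
  assumes "norm (p :: complex) < 1" "m > 0"
  shows "1 - norm p \<le> norm (1 - p ^ m)"
proof -
  have "norm p ^ m \<le> norm p ^ 1" using assms by (intro power_decreasing) auto
  moreover have "1 - norm (p ^ m) \<le> norm (1 - p ^ m)"
    using norm_triangle_ineq2[of 1 "p ^ m"] by simp
  ultimately show ?thesis by (simp add: norm_power)
qed

text \<open>For \<open>k = 0\<close> the denominators stay away from 0, so a geometric series
  dominates. Raising \<open>k\<close> amounts to termwise differentiation, which preserves
  convergence in the unit disc.\<close>

lemma summable_lambert:
  assumes p: "norm p < 1"
  shows "norm x < 1 \<Longrightarrow> summable (\<lambda>m. lambert_coeff p k m * x ^ m)"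
proof (induction k arbitrary: x)
  case 0
  show ?case
  proof (rule summable_comparison_test')
    show "summable (\<lambda>m. 1 / (1 - norm p) * norm x ^ m)"
      using 0 by (intro summable_mult summable_geometric) auto
    show "norm (lambert_coeff p 0 m * x ^ m) \<le> 1 / (1 - norm p) * norm x ^ m" if "m \<ge> 0" for m
    proof (cases "m = 0")
      case False
      then have "1 / norm (1 - p ^ m) \<le> 1 / (1 - norm p)"
        using norm_one_minus_power_ge[OF p, of m] p by (intro divide_left_mono mult_pos_pos) linarith+
      then show ?thesis
        using False unfolding lambert_coeff_def norm_mult norm_power
        by (intro mult_right_mono) (auto simp: norm_divide)
    qed (use p in \<open>auto simp: lambert_coeff_def\<close>)
  qed
next
  case (Suc k)
  have "summable (\<lambda>n. diffs (lambert_coeff p k) n * x ^ n)"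
    by (rule termdiff_converges[of x 1]) (use Suc in auto)
  then have "summable (\<lambda>n. x * (diffs (lambert_coeff p k) n * x ^ n))"
    by (rule summable_mult)
  then have "summable (\<lambda>n. lambert_coeff p (Suc k) (Suc n) * x ^ Suc n)"
    by (simp add: diffs_def lambert_coeff_Suc mult_ac)
  then show ?case by (simp only: summable_Suc_iff[of "\<lambda>m. lambert_coeff p (Suc k) m * x ^ m"])
qed

lemma DERIV_lambert:
  assumes p: "norm p < 1" and x: "norm x < 1" "x \<noteq> 0"
  shows "(lambert p k has_field_derivative lambert p (Suc k) x / x) (at x)"
proof -
  have "((\<lambda>x. \<Sum>m. lambert_coeff p k m * x ^ m) has_field_derivative (\<Sum>n. diffs (lambert_coeff p k) n * x ^ n)) (at x)"
    by (rule termdiffs_strong'[of 1]) (use summable_lambert[OF p] x in auto)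
  moreover have "lambert p (Suc k) x = x * (\<Sum>n. diffs (lambert_coeff p k) n * x ^ n)"
  proof -
    have "lambert p (Suc k) x = (\<Sum>n. lambert_coeff p (Suc k) (Suc n) * x ^ Suc n)"
      using suminf_split_head[OF summable_lambert[OF p x(1), of "Suc k"]]
      by (simp add: lambert_def lambert_coeff_def)
    also have "\<dots> = (\<Sum>n. x * (diffs (lambert_coeff p k) n * x ^ n))"
      by (simp add: diffs_def lambert_coeff_Suc mult_ac)
    also have "\<dots> = x * (\<Sum>n. diffs (lambert_coeff p k) n * x ^ n)"
    proof (rule suminf_mult)
      show "summable (\<lambda>n. diffs (lambert_coeff p k) n * x ^ n)"
        by (rule termdiff_converges[of x 1]) (use x summable_lambert[OF p] in auto)
    qed
    finally show ?thesis .
  qed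
  ultimately show ?thesis using x by (simp add: lambert_def[abs_def])
qed

text \<open>Both sides are iterated sums of the double family \<open>(x p^k)^(m+1)\<close>; most of
  the proof is its absolute summability.\<close>

lemma geometric_double_sum:
  assumes p: "norm (p :: complex) < 1" and x: "norm x < 1"
  shows "(\<lambda>k. x * p ^ k / (1 - x * p ^ k)) sums (\<Sum>m. x ^ Suc m / (1 - p ^ Suc m))"
proof -
  define f where "f = (\<lambda>(k, m). (x * p ^ k) ^ Suc m)"
  have xp: "norm (x * p ^ k) < 1" for k
  proof -
    have "norm x * norm p ^ k \<le> norm x * 1" using p by (intro mult_left_mono power_le_one) auto
    with x show ?thesis by (simp add: norm_mult norm_power)
  qed
  have has_sum_geo: "((\<lambda>m. y ^ Suc m) has_sum y / (1 - y)) UNIV" if "norm y < 1" for y :: complex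
  proof (rule norm_summable_imp_has_sum)
    show "summable (\<lambda>m. norm (y ^ Suc m))"
      using that by (simp add: norm_power norm_mult summable_geometric)
    show "(\<lambda>m. y ^ Suc m) sums (y / (1 - y))"
      using sums_mult[OF geometric_sums[OF that], of y] by simp
  qed
  have has_sum_geo0: "((\<lambda>m. y ^ m) has_sum 1 / (1 - y)) UNIV" if "norm y < 1" for y :: complex
  proof (rule norm_summable_imp_has_sum)
    show "summable (\<lambda>m. norm (y ^ m))"
      using that by (simp add: norm_power summable_geometric)
    show "(\<lambda>m. y ^ m) sums (1 / (1 - y))" by (rule geometric_sums[OF that])
  qed
  have "(\<lambda>z. norm (f z)) summable_on UNIV \<times> UNIV"
    unfolding Infinite_Sum.abs_summable_on_Sigma_iff
  proof (intro conjI ballI)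
    show "(\<lambda>m. norm (f (k, m))) summable_on UNIV" for k
      using has_sum_imp_summable[OF has_sum_geo[OF xp[of k]]]
      unfolding summable_on_iff_abs_summable_on_complex by (simp only: f_def prod.case)
    have "(\<lambda>k. norm (\<Sum>\<^sub>\<infinity>m. norm (f (k, m)))) = (\<lambda>k. norm (x * p ^ k) / (1 - norm (x * p ^ k)))"
    proof
      fix k
      have "((\<lambda>m. norm (x * p ^ k) ^ Suc m) has_sum norm (x * p ^ k) / (1 - norm (x * p ^ k))) UNIV"
      proof (rule norm_summable_imp_has_sum)
        show "summable (\<lambda>m. norm (norm (x * p ^ k) ^ Suc m))"
          using xp[of k] by (simp add: norm_power summable_geometric summable_mult)
        show "(\<lambda>m. norm (x * p ^ k) ^ Suc m) sums (norm (x * p ^ k) / (1 - norm (x * p ^ k)))"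
          using sums_mult[OF geometric_sums[of "norm (x * p ^ k)"], of "norm (x * p ^ k)"] xp[of k] by simp
      qed
      then have "(\<Sum>\<^sub>\<infinity>m. norm (f (k, m))) = norm (x * p ^ k) / (1 - norm (x * p ^ k))"
        by (simp only: f_def prod.case norm_power infsumI)
      then show "norm (\<Sum>\<^sub>\<infinity>m. norm (f (k, m))) = norm (x * p ^ k) / (1 - norm (x * p ^ k))"
        using xp[of k] by (simp del: norm_mult add: abs_of_nonneg)
    qed
    moreover have "(\<lambda>k. norm (x * p ^ k) / (1 - norm (x * p ^ k))) summable_on UNIV"
    proof (rule summable_on_comparison_test)
      show "(\<lambda>k. norm x / (1 - norm x) * norm p ^ k) summable_on UNIV"
        using p x by (subst summable_on_UNIV_nonneg_real_iff) (auto intro!: summable_mult)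
      show "norm (x * p ^ k) / (1 - norm (x * p ^ k)) \<le> norm x / (1 - norm x) * norm p ^ k" for k
      proof -
        have "norm x * norm p ^ k \<le> norm x * 1" using p by (intro mult_left_mono power_le_one) auto
        then have "norm (x * p ^ k) / (1 - norm (x * p ^ k)) \<le> norm (x * p ^ k) / (1 - norm x)"
          using x xp[of k] by (intro divide_left_mono) (auto simp: norm_mult norm_power)
        then show ?thesis by (simp add: norm_mult norm_power)
      qed
    qed (use xp in \<open>auto simp del: norm_mult simp: less_imp_le\<close>)
    ultimately show "(\<lambda>k. norm (\<Sum>\<^sub>\<infinity>m. norm (f (k, m)))) summable_on UNIV" by simp
  qed
  then have sf: "f summable_on UNIV \<times> UNIV" by (rule abs_summable_summable)
  then obtain S where S: "(f has_sum S) (UNIV \<times> UNIV)" by (auto simp: summable_on_def)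
  have 1: "((\<lambda>k. x * p ^ k / (1 - x * p ^ k)) has_sum S) UNIV"
    by (rule has_sum_SigmaD[OF S]) (use has_sum_geo[OF xp] in \<open>simp add: f_def\<close>)
  have S': "((\<lambda>(m, k). f (k, m)) has_sum S) (UNIV \<times> UNIV)"
    using S by (subst (asm) has_sum_swap)
  have 2: "((\<lambda>m. x ^ Suc m / (1 - p ^ Suc m)) has_sum S) UNIV"
  proof (rule has_sum_SigmaD[OF S'])
    fix m
    have pm: "norm (p ^ Suc m) < 1" using p power_less_one_iff[of "norm p" "Suc m"] by (simp add: norm_power del: power_Suc)
    have "f (k, m) = x ^ Suc m * (p ^ Suc m) ^ k" for k
      by (simp add: f_def power_mult_distrib power_mult[symmetric] mult.commute del: power_Suc)
    then show "((\<lambda>k. case (m, k) of (m, k) \<Rightarrow> f (k, m)) has_sum x ^ Suc m / (1 - p ^ Suc m)) UNIV"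
      using has_sum_cmult_right[OF has_sum_geo0[OF pm], of "x ^ Suc m"] by (simp del: power_Suc)
  qed
  show ?thesis
    using has_sum_imp_sums[OF 1] unfolding sums_unique[OF has_sum_imp_sums[OF 2], symmetric] .
qed

text \<open>The logarithmic derivative, taken factor by factor, is the series on the left of
  \<open>geometric_double_sum\<close>. No factor vanishes in the unit disc.\<close>

lemma DERIV_qpoch:
  assumes p: "norm p < 1" and x: "norm x < 1" "x \<noteq> 0"
  shows "((\<lambda>x. qpoch x p) has_field_derivative - (lambert p 0 x / x) * qpoch x p) (at x)"
proof -
  have nz: "qpoch x p \<noteq> 0"
  proof
    assume "qpoch x p = 0"
    then obtain n where "x * p ^ n = 1" using qpoch_eq_0_iff[OF p] by auto
    then have "norm x * norm p ^ n = 1" by (simp only: norm_mult[symmetric] norm_power[symmetric] norm_one)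
    moreover have "norm x * norm p ^ n \<le> norm x * 1" using p by (intro mult_left_mono power_le_one) auto
    ultimately show False using x by simp
  qed
  have "(\<lambda>k. deriv (\<lambda>x. 1 - x * p ^ k) x / (1 - x * p ^ k)) sums (deriv (\<lambda>x. qpoch x p) x / qpoch x p)"
  proof (rule logderiv_prodinf_complex_uniform_limit[where A = "ball 0 1"])
    show "uniform_limit (ball 0 1) (\<lambda>n x. \<Prod>k<n. 1 - x * p ^ k) (\<lambda>x. qpoch x p) sequentially"
      using uniform_limit_qpoch[OF p, of 1] by (rule uniform_limit_on_subset) auto
  qed (use x nz in \<open>auto intro!: holomorphic_intros\<close>)
  moreover have "deriv (\<lambda>x. 1 - x * p ^ k) x = - (p ^ k)" for k
    by (rule DERIV_imp_deriv) (auto intro!: derivative_eq_intros)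
  ultimately have "(\<lambda>k. (- x) * (- (p ^ k) / (1 - x * p ^ k))) sums ((- x) * (deriv (\<lambda>x. qpoch x p) x / qpoch x p))"
    by (intro sums_mult) simp
  then have "(\<lambda>k. x * p ^ k / (1 - x * p ^ k)) sums ((- x) * (deriv (\<lambda>x. qpoch x p) x / qpoch x p))"
    by simp
  then have "(- x) * (deriv (\<lambda>x. qpoch x p) x / qpoch x p) = (\<Sum>m. x ^ Suc m / (1 - p ^ Suc m))"
    using geometric_double_sum[OF p x(1)] sums_unique2 by blast
  also have "\<dots> = lambert p 0 x"
    using suminf_split_head[OF summable_lambert[OF p x(1), of 0]]
    by (simp add: lambert_def lambert_coeff_def)
  finally have "deriv (\<lambda>x. qpoch x p) x = - (lambert p 0 x / x) * qpoch x p"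
  proof -
    define D L where "D = deriv (\<lambda>x. qpoch x p) x" and "L = lambert p 0 x"
    assume "(- x) * (deriv (\<lambda>x. qpoch x p) x / qpoch x p) = lambert p 0 x"
    then have "L = - (x * D / qpoch x p)" by (simp add: D_def L_def)
    then show ?thesis unfolding D_def[symmetric] L_def[symmetric] using x nz by simp
  qed
  with holomorphic_derivI[OF qpoch_holomorphic[OF p], of x] show ?thesis by simp
qed

subsection \<open>Weierstrass functions\<close>

lemma DERIV_sig: "Re w < 0 \<Longrightarrow> (sig w has_field_derivative deriv (sig w) u) (at u)"
  by (rule holomorphic_derivI[OF holomorphic_sig]) auto

lemma DERIV_deriv_sig: "Re w < 0 \<Longrightarrow> (deriv (sig w) has_field_derivative deriv (deriv (sig w)) u) (at u)"
  by (rule holomorphic_derivI[OF holomorphic_deriv[OF holomorphic_sig]]) auto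

lemma DERIV_sig_compose:
  assumes "Re w < 0" "(g has_field_derivative g') (at x)" "deriv (sig w) (g x) * g' = D"
  shows "((\<lambda>x. sig w (g x)) has_field_derivative D) (at x)"
  using DERIV_chain2[OF DERIV_sig[OF assms(1)] assms(2)] assms(3) by simp

lemma DERIV_deriv_sig_compose:
  assumes "Re w < 0" "(g has_field_derivative g') (at x)" "deriv (deriv (sig w)) (g x) * g' = D"
  shows "((\<lambda>x. deriv (sig w) (g x)) has_field_derivative D) (at x)"
  using DERIV_chain2[OF DERIV_deriv_sig[OF assms(1)] assms(2)] assms(3) by simp

text \<open>This is \<open>- (ln sig)''\<close> times \<open>sig^2\<close>. Being entire, it
  satisfies identities that hold also at the zeros of \<open>sig\<close>.\<close>

definition wp_num :: "complex \<Rightarrow> complex \<Rightarrow> complex" where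
  "wp_num w u = (deriv (sig w) u)\<^sup>2 - sig w u * deriv (deriv (sig w)) u"

text \<open>Second derivative of \<open>sig_add_mult_sig_diff\<close> in \<open>v\<close> at \<open>v = 0\<close>.\<close>

lemma wp_num_eq:
  assumes w: "Re w < 0"
  obtains A B where "\<And>u. wp_num w u = A * odd_theta w u + B * even_theta w u"
proof
  define ev od where "ev = even_theta w" and "od = odd_theta w"
  note D0 = DERIV_sig_compose[OF w] and D1 = DERIV_deriv_sig_compose[OF w]
  have E0: "(ev has_field_derivative deriv ev v) (at v)" for v
    unfolding ev_def by (rule holomorphic_derivI[OF holomorphic_even_theta[OF w]]) auto
  have E1: "(deriv ev has_field_derivative deriv (deriv ev) v) (at v)" for v
    unfolding ev_def by (rule holomorphic_derivI[OF holomorphic_deriv[OF holomorphic_even_theta[OF w]]]) auto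
  have O0: "(od has_field_derivative deriv od v) (at v)" for v
    unfolding od_def by (rule holomorphic_derivI[OF holomorphic_odd_theta[OF w]]) auto
  have O1: "(deriv od has_field_derivative deriv (deriv od) v) (at v)" for v
    unfolding od_def by (rule holomorphic_derivI[OF holomorphic_deriv[OF holomorphic_odd_theta[OF w]]]) auto
  fix u
  have eq0: "(\<lambda>v. sig w (u + v) * sig w (u - v)) = (\<lambda>v. od u * ev v - ev u * od v)"
    using sig_add_mult_sig_diff[OF w] by (simp add: ev_def od_def fun_eq_iff)
  have d: "((\<lambda>v. sig w (u + v) * sig w (u - v)) has_field_derivative
      deriv (sig w) (u + v) * sig w (u - v) - sig w (u + v) * deriv (sig w) (u - v)) (at v)" for v
    by (rule derivative_eq_intros D0 refl | simp)+
  have "((\<lambda>v. od u * ev v - ev u * od v) has_field_derivative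
      od u * deriv ev v - ev u * deriv od v) (at v)" for v
    by (rule derivative_eq_intros E0 O0 refl | simp)+
  with d have eq1: "(\<lambda>v. deriv (sig w) (u + v) * sig w (u - v) - sig w (u + v) * deriv (sig w) (u - v)) =
      (\<lambda>v. od u * deriv ev v - ev u * deriv od v)"
    unfolding eq0 using DERIV_unique by blast
  have d: "((\<lambda>v. deriv (sig w) (u + v) * sig w (u - v) - sig w (u + v) * deriv (sig w) (u - v)) has_field_derivative
      deriv (deriv (sig w)) (u + 0) * sig w (u - 0) - 2 * (deriv (sig w) (u + 0) * deriv (sig w) (u - 0))
      + sig w (u + 0) * deriv (deriv (sig w)) (u - 0)) (at 0)"
    by (rule derivative_eq_intros D0 D1 refl | simp)+
  have "((\<lambda>v. od u * deriv ev v - ev u * deriv od v) has_field_derivative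
      od u * deriv (deriv ev) 0 - ev u * deriv (deriv od) 0) (at 0)"
    by (rule derivative_eq_intros E1 O1 refl | simp)+
  with d have "deriv (deriv (sig w)) u * sig w u - 2 * (deriv (sig w) u * deriv (sig w) u)
      + sig w u * deriv (deriv (sig w)) u = od u * deriv (deriv ev) 0 - ev u * deriv (deriv od) 0"
    unfolding eq1 using DERIV_unique by fastforce
  then have "2 * wp_num w u = - deriv (deriv ev) 0 * od u + deriv (deriv od) 0 * ev u"
    by (simp add: wp_num_def power2_eq_square algebra_simps)
  then show "wp_num w u = (- deriv (deriv ev) 0 / 2) * odd_theta w u + (deriv (deriv od) 0 / 2) * even_theta w u"
    by (simp add: ev_def od_def field_simps)
qed

lemma sig_eq_qpoch':
  assumes w: "Re w < 0"
  shows "sig w u = (1 - exp u) * (exp (- (u / 2)) * (qpoch (exp w) (exp w) * qpoch (exp u * exp w) (exp w) * qpoch (exp (w - u)) (exp w)))"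
  using w by (simp add: sig_eq_qpoch qpoch_Suc[of "exp w" "exp u"] mult_ac)

text \<open>In this strip \<open>exp w\<close>, \<open>exp u\<close> and \<open>exp (w - u)\<close>
  all lie in the unit disc, where \<open>qpoch\<close> has no zero.\<close>

lemma sig_nonzero:
  assumes w: "Re w < 0" and u: "Re w < Re u" "Re u < 0"
  shows "sig w u \<noteq> 0"
proof -
  have nz: "qpoch x (exp w) \<noteq> 0" if "norm x < 1" for x
  proof
    assume "qpoch x (exp w) = 0"
    then obtain n where "x * exp w ^ n = 1" using qpoch_eq_0_iff[of "exp w"] w by auto
    then have "norm x * norm (exp w) ^ n = 1" by (simp only: norm_mult[symmetric] norm_power[symmetric] norm_one)
    moreover have "norm x * norm (exp w) ^ n \<le> norm x * 1" using w by (intro mult_left_mono power_le_one) auto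
    ultimately show False using that by simp
  qed
  show ?thesis unfolding sig_eq_qpoch[OF w]
    using nz[of "exp w"] nz[of "exp u"] nz[of "exp (w - u)"] w u by simp
qed

text \<open>Removing the vanishing factor \<open>1 - exp u\<close> leaves three \<open>qpoch\<close>
  factors that coincide at \<open>u = 0\<close>.\<close>

lemma deriv_sig_0:
  assumes w: "Re w < 0"
  shows "deriv (sig w) 0 = - (qpoch (exp w) (exp w) ^ 3)"
proof -
  define g where "g = (\<lambda>u. exp (- (u / 2)) * (qpoch (exp w) (exp w) * qpoch (exp u * exp w) (exp w) * qpoch (exp (w - u)) (exp w)))"
  have q: "((\<lambda>x. qpoch x (exp w)) has_field_derivative deriv (\<lambda>x. qpoch x (exp w)) x) (at x)" for x
    by (rule holomorphic_derivI[OF qpoch_holomorphic]) (use w in auto)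
  have gh: "g holomorphic_on UNIV"
    unfolding g_def
    using holomorphic_on_compose[OF _ holomorphic_on_subset[OF qpoch_holomorphic[of "exp w"]], of "\<lambda>u. exp u * exp w" UNIV]
      holomorphic_on_compose[OF _ holomorphic_on_subset[OF qpoch_holomorphic[of "exp w"]], of "\<lambda>u. exp (w - u)" UNIV] w
    by (intro holomorphic_intros) (simp_all add: o_def holomorphic_intros)
  have g: "(g has_field_derivative deriv g u) (at u)" for u
    by (rule holomorphic_derivI[OF gh]) auto
  have "sig w = (\<lambda>u. (1 - exp u) * g u)"
    using sig_eq_qpoch'[OF w] by (simp add: g_def fun_eq_iff)
  moreover have "((\<lambda>u. (1 - exp u) * g u) has_field_derivative - g 0) (at 0)"
    by (rule derivative_eq_intros g refl | simp)+
  ultimately have "deriv (sig w) 0 = - g 0" by (simp add: DERIV_imp_deriv)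
  then show ?thesis by (simp add: g_def power3_eq_cube)
qed

text \<open>Both \<open>wp_num w\<close> and the square of \<open>sig w\<close> are combinations of
  \<open>odd_theta\<close> and \<open>even_theta\<close>, so the left-hand side is a multiple of
  their determinant at \<open>u\<close> and \<open>v\<close>, which is
  \<open>sig w (u + v) * sig w (u - v)\<close>. The multiple is \<open>wp_num w 0\<close>.\<close>

lemma wp_num_diff:
  assumes w: "Re w < 0"
  shows "wp_num w v * (sig w u)\<^sup>2 - wp_num w u * (sig w v)\<^sup>2
    = (deriv (sig w) 0)\<^sup>2 * (sig w (u + v) * sig w (u - v))"
proof -
  obtain A B where AB: "\<And>u. wp_num w u = A * odd_theta w u + B * even_theta w u"
    by (rule wp_num_eq[OF w]) blast
  define K where "K = A * odd_theta w 0 + B * even_theta w 0"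
  have sq: "(sig w u)\<^sup>2 = odd_theta w u * even_theta w 0 - even_theta w u * odd_theta w 0" for u
    using sig_add_mult_sig_diff[OF w, of u 0] by (simp add: power2_eq_square)
  have "K = (deriv (sig w) 0)\<^sup>2"
    using AB[of 0] by (simp add: K_def wp_num_def sig_0)
  moreover have "wp_num w v * (sig w u)\<^sup>2 - wp_num w u * (sig w v)\<^sup>2 = K * (sig w (u + v) * sig w (u - v))"
    unfolding AB sq sig_add_mult_sig_diff[OF w] K_def by (simp add: algebra_simps)
  ultimately show ?thesis by simp
qed

text \<open>The Weierstrass function up to an additive constant, which drops out of differences and
  derivatives.\<close>

definition wp :: "complex \<Rightarrow> complex \<Rightarrow> complex" where
  "wp w u = wp_num w u / (sig w u)\<^sup>2"

definition sig_zeta :: "complex \<Rightarrow> complex \<Rightarrow> complex" where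
  "sig_zeta w u = deriv (sig w) u / sig w u"

lemma DERIV_sig_zeta:
  assumes w: "Re w < 0" and u: "sig w u \<noteq> 0"
  shows "(sig_zeta w has_field_derivative - wp w u) (at u)"
  unfolding sig_zeta_def[abs_def]
  by (rule derivative_eq_intros DERIV_sig[OF w] DERIV_deriv_sig[OF w] refl u)+
     (use u in \<open>simp add: wp_def wp_num_def field_simps power2_eq_square\<close>)

lemma wp_diff:
  assumes w: "Re w < 0" and u: "sig w u \<noteq> 0" and v: "sig w v \<noteq> 0"
  shows "wp w v - wp w u = (deriv (sig w) 0)\<^sup>2 * (sig w (u + v) * sig w (u - v)) / ((sig w u)\<^sup>2 * (sig w v)\<^sup>2)"
  unfolding wp_num_diff[OF w, symmetric] using u v by (simp add: wp_def field_simps)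

text \<open>The duplication formula; \<open>DERIV_wp\<close> shows that this is the derivative of \<open>wp\<close>.\<close>

definition wp' :: "complex \<Rightarrow> complex \<Rightarrow> complex" where
  "wp' w u = - (deriv (sig w) 0 ^ 3) * sig w (2 * u) / sig w u ^ 4"

lemma eventually_sig_nonzero:
  assumes w: "Re w < 0" and u: "sig w u \<noteq> 0"
  shows "eventually (\<lambda>v. sig w v \<noteq> 0) (nhds u)"
proof -
  have "isCont (sig w) u" using DERIV_sig[OF w] DERIV_isCont by blast
  then have "(sig w \<longlongrightarrow> sig w u) (nhds u)" by (simp add: tendsto_nhds_iff isCont_def)
  then show ?thesis using u by (rule tendsto_imp_eventually_ne)
qed

text \<open>The addition formula \<open>wp_diff\<close> is differentiated in \<open>v\<close> with
  the base point \<open>u\<close> fixed. The freedom in \<open>u\<close> is the point: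
  \<open>u = v\<close> gives duplication and \<open>u = 2 v\<close> triplication.\<close>

lemma DERIV_wp_aux:
  assumes w: "Re w < 0" and u: "sig w u \<noteq> 0" and v: "sig w v \<noteq> 0"
  shows "(wp w has_field_derivative
     (deriv (sig w) 0)\<^sup>2 * ((deriv (sig w) (u + v) * sig w (u - v) - sig w (u + v) * deriv (sig w) (u - v)) * sig w v
       - 2 * (sig w (u + v) * sig w (u - v)) * deriv (sig w) v) / ((sig w u)\<^sup>2 * sig w v ^ 3)) (at v)"
proof -
  note D0 = DERIV_sig_compose[OF w]
  have "((\<lambda>v. wp w u + (deriv (sig w) 0)\<^sup>2 * (sig w (u + v) * sig w (u - v)) / ((sig w u)\<^sup>2 * (sig w v)\<^sup>2))
     has_field_derivative
     (deriv (sig w) 0)\<^sup>2 * ((deriv (sig w) (u + v) * sig w (u - v) - sig w (u + v) * deriv (sig w) (u - v)) * sig w v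
       - 2 * (sig w (u + v) * sig w (u - v)) * deriv (sig w) v) / ((sig w u)\<^sup>2 * sig w v ^ 3)) (at v)"
  proof -
    define s c where "s = sig w" and "c = (deriv (sig w) 0)\<^sup>2"
    show ?thesis
      unfolding s_def[symmetric] c_def[symmetric]
      apply (rule DERIV_cong)
       apply (rule derivative_eq_intros D0[folded s_def] refl | (simp add: u[folded s_def] v[folded s_def]; fail))+
      using u v unfolding s_def[symmetric]
      by (simp add: divide_simps power2_eq_square power3_eq_cube) (simp add: algebra_simps)
  qed
  moreover have "eventually (\<lambda>x. wp w u + (deriv (sig w) 0)\<^sup>2 * (sig w (u + x) * sig w (u - x)) / ((sig w u)\<^sup>2 * (sig w x)\<^sup>2) = wp w x) (nhds v)"
    using eventually_sig_nonzero[OF w v] by eventually_elim (use wp_diff[OF w u] in \<open>simp add: algebra_simps\<close>)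
  ultimately show ?thesis by (subst (asm) DERIV_cong_ev) auto
qed

text \<open>When both points agree, \<open>sig_0\<close> leaves only the term with
  \<open>sig w (2 * u) * deriv (sig w) 0\<close>.\<close>

lemma DERIV_wp:
  assumes w: "Re w < 0" and u: "sig w u \<noteq> 0"
  shows "(wp w has_field_derivative wp' w u) (at u)"
proof -
  have "u + u = 2 * u" by simp
  then show ?thesis
    using DERIV_wp_aux[OF w u u] u
    by (simp add: wp'_def sig_0 power2_eq_square power3_eq_cube power4_eq_xxxx mult_ac)
qed

text \<open>Two values of the derivative of \<open>wp w\<close> at \<open>v\<close> are equated: the
  duplication formula and \<open>DERIV_wp_aux\<close> with base point \<open>2 v\<close>. In the
  latter the derivatives of \<open>sig w\<close> occur at \<open>3 v\<close> and \<open>v\<close>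
  only, as \<open>sig_zeta w (3 * v) - 3 * sig_zeta w v\<close>.\<close>

lemma sig_zeta_triple:
  assumes w: "Re w < 0" and v: "sig w v \<noteq> 0" "sig w (2 * v) \<noteq> 0" "sig w (3 * v) \<noteq> 0"
  shows "sig_zeta w (3 * v) - 3 * sig_zeta w v
    = - deriv (sig w) 0 * sig w (2 * v) ^ 3 / (sig w v ^ 3 * sig w (3 * v))"
proof -
  define s1 a b c where "s1 = deriv (sig w) 0" and "a = sig w v" and "b = sig w (2 * v)" and "c = sig w (3 * v)"
  have s1: "s1 \<noteq> 0" unfolding s1_def deriv_sig_0[OF w] using qpoch_self_nonzero[of "exp w"] w by simp
  have "2 * v + v = 3 * v" "2 * v - v = v" by simp_all
  with DERIV_wp_aux[OF w v(2) v(1)]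
  have "(wp w has_field_derivative s1\<^sup>2 * ((deriv (sig w) (3 * v) * a - c * deriv (sig w) v) * a
       - 2 * (c * a) * deriv (sig w) v) / (b\<^sup>2 * a ^ 3)) (at v)"
    by (simp add: s1_def a_def b_def c_def)
  with DERIV_wp[OF w v(1)] have "wp' w v = s1\<^sup>2 * ((deriv (sig w) (3 * v) * a - c * deriv (sig w) v) * a
       - 2 * (c * a) * deriv (sig w) v) / (b\<^sup>2 * a ^ 3)"
    by (rule DERIV_unique)
  moreover define X z1 z3 where "X = sig_zeta w (3 * v) - 3 * sig_zeta w v"
    and "z1 = sig_zeta w v" and "z3 = sig_zeta w (3 * v)"
  moreover have "deriv (sig w) (3 * v) = z3 * c" "deriv (sig w) v = z1 * a"
    using v by (simp_all add: sig_zeta_def a_def c_def z1_def z3_def)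
  moreover have "(z3 * c * a - c * (z1 * a)) * a - 2 * (c * a) * (z1 * a) = c * (z3 - 3 * z1) * a\<^sup>2"
    by (simp add: power2_eq_square algebra_simps)
  ultimately have "- (s1 ^ 3) * b / a ^ 4 = s1\<^sup>2 * (c * X) * a\<^sup>2 / (b\<^sup>2 * a ^ 3)"
    by (simp only: wp'_def s1_def[symmetric] a_def[symmetric] b_def[symmetric] mult.assoc)
  moreover have nz: "a \<noteq> 0" "b \<noteq> 0" "c \<noteq> 0" using v by (simp_all add: a_def b_def c_def)
  ultimately have "s1\<^sup>2 * (- (s1 * b ^ 3)) = s1\<^sup>2 * (c * X * a ^ 3)"
    by (simp add: divide_simps power2_eq_square power3_eq_cube power4_eq_xxxx mult.assoc)
  then have "- (s1 * b ^ 3) = c * X * a ^ 3"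
    using s1 by (simp only: mult_cancel_left) simp
  then have "X = - s1 * b ^ 3 / (a ^ 3 * c)"
    using nz by (simp add: field_simps)
  then show ?thesis by (simp add: X_def s1_def a_def b_def c_def)
qed

text \<open>The last factor is the logarithmic derivative of
  \<open>sig w (2 * u) / sig w u ^ 4\<close>. It reduces second derivatives of \<open>wp\<close> to
  zeta values.\<close>

lemma DERIV_wp':
  assumes w: "Re w < 0" and u: "sig w u \<noteq> 0" "sig w (2 * u) \<noteq> 0"
  shows "(wp' w has_field_derivative wp' w u * (2 * sig_zeta w (2 * u) - 4 * sig_zeta w u)) (at u)"
proof -
  note D0 = DERIV_sig_compose[OF w]
  define s c where "s = sig w" and "c = deriv (sig w) 0"
  show ?thesis
    unfolding wp'_def[abs_def] sig_zeta_def s_def[symmetric] c_def[symmetric]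
    apply (rule DERIV_cong)
     apply (rule derivative_eq_intros D0[folded s_def] refl | (simp add: u[folded s_def]; fail))+
    using u unfolding s_def[symmetric]
    by (simp add: divide_simps power4_eq_xxxx power3_eq_cube) (simp add: algebra_simps)
qed

lemma sig_zeta_add_period:
  assumes w: "Re w < 0" and u: "sig w u \<noteq> 0"
  shows "sig_zeta w (u + w) = sig_zeta w u - 1"
proof -
  note D0 = DERIV_sig_compose[OF w]
  have "((\<lambda>u. sig w (u + w)) has_field_derivative deriv (sig w) (u + w)) (at u)"
    by (rule derivative_eq_intros D0 refl | simp)+
  moreover have "((\<lambda>u. - (exp (- (w / 2) - u) * sig w u)) has_field_derivative
      exp (- (w / 2) - u) * sig w u - exp (- (w / 2) - u) * deriv (sig w) u) (at u)"
    by (rule derivative_eq_intros D0 refl | simp)+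
  ultimately have "deriv (sig w) (u + w) = exp (- (w / 2) - u) * sig w u - exp (- (w / 2) - u) * deriv (sig w) u"
    unfolding sig_add_period by (rule DERIV_unique)
  then show ?thesis using u by (simp add: sig_zeta_def sig_add_period field_simps)
qed

lemma sig_zeta_minus:
  assumes w: "Re w < 0"
  shows "sig_zeta w (- u) = - sig_zeta w u"
proof -
  note D0 = DERIV_sig_compose[OF w]
  have "((\<lambda>u. - sig w u) has_field_derivative - deriv (sig w) u) (at u)"
    by (rule derivative_eq_intros D0 refl | simp)+
  moreover have "((\<lambda>u. sig w (- u)) has_field_derivative - deriv (sig w) (- u)) (at u)"
    by (rule derivative_eq_intros D0 refl | simp)+
  ultimately have "deriv (sig w) (- u) = deriv (sig w) u"
    unfolding sig_minus using DERIV_unique by fastforce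
  then show ?thesis by (simp add: sig_zeta_def sig_minus)
qed

section \<open>Lambert expansions in the strip and values at torsion points\<close>

lemma sig_zeta_lambert:
  assumes w: "Re w < 0" and u: "Re w < Re u" "Re u < 0"
  shows "sig_zeta w u = - 1/2 - lambert (exp w) 0 (exp u) + lambert (exp w) 0 (exp (w - u))"
proof -
  define p where "p = exp w"
  have p: "norm p < 1" using w by (simp add: p_def)
  have d: "((\<lambda>u. qpoch (f u) p) has_field_derivative D) (at u)"
    if "(f has_field_derivative f') (at u)" "norm (f u) < 1" "f u \<noteq> 0"
      "- (lambert p 0 (f u) / f u) * qpoch (f u) p * f' = D" for f f' D
    using DERIV_chain2[OF DERIV_qpoch[OF p that(2,3)] that(1)] that(4) by simp
  define a b c L M where "a = exp (- (u / 2))" and "b = qpoch (exp u) p" and "c = qpoch (exp (w - u)) p"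
    and "L = lambert p 0 (exp u)" and "M = lambert p 0 (exp (w - u))"
  have n: "norm (exp u) < 1" "norm (exp (w - u)) < 1" using u by auto
  have "((\<lambda>u. exp (- (u / 2)) * (qpoch p p * qpoch (exp u) p * qpoch (exp (w - u)) p)) has_field_derivative
     (a * (qpoch p p * b * c)) * (- 1/2 - L + M)) (at u)"
    apply (rule DERIV_cong)
     apply (rule derivative_eq_intros d refl n | (simp; fail))+
    by (simp add: a_def[symmetric] b_def[symmetric] c_def[symmetric] L_def[symmetric] M_def[symmetric] algebra_simps)
  moreover have "sig w = (\<lambda>u. exp (- (u / 2)) * (qpoch p p * qpoch (exp u) p * qpoch (exp (w - u)) p))"
    using sig_eq_qpoch[OF w] by (simp add: p_def fun_eq_iff)
  ultimately have "deriv (sig w) u = sig w u * (- 1/2 - L + M)"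
    by (simp add: DERIV_imp_deriv a_def b_def c_def)
  then show ?thesis
    using sig_nonzero[OF w u] by (simp add: sig_zeta_def p_def L_def M_def)
qed

lemma DERIV_lambert_exp:
  assumes w: "Re w < 0" and u: "Re w < Re u" "Re u < 0"
  shows "((\<lambda>u. lambert (exp w) k (exp u)) has_field_derivative lambert (exp w) (Suc k) (exp u)) (at u)"
    and "((\<lambda>u. lambert (exp w) k (exp (w - u))) has_field_derivative - lambert (exp w) (Suc k) (exp (w - u))) (at u)"
proof -
  have p: "norm (exp w) < 1" "norm (exp u) < 1" "norm (exp (w - u)) < 1" using w u by auto
  have d1: "(exp has_field_derivative exp u) (at u)" by (rule DERIV_exp)
  have d2: "((\<lambda>u. exp (w - u)) has_field_derivative - exp (w - u)) (at u)"
    by (rule derivative_eq_intros refl | simp)+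
  show "((\<lambda>u. lambert (exp w) k (exp u)) has_field_derivative lambert (exp w) (Suc k) (exp u)) (at u)"
    using DERIV_chain2[OF DERIV_lambert[OF p(1,2)] d1] by simp
  show "((\<lambda>u. lambert (exp w) k (exp (w - u))) has_field_derivative - lambert (exp w) (Suc k) (exp (w - u))) (at u)"
    using DERIV_chain2[OF DERIV_lambert[OF p(1,3)] d2] by simp
qed

text \<open>Starting from \<open>sig_zeta_lambert\<close>, each derivative raises the Lambert index
  and reverses the sign of the \<open>w - u\<close> term. The intermediate identities are
  established on the whole open strip, so that they can be differentiated again.\<close>

lemma DERIV_wp'_lambert:
  assumes w: "Re w < 0" and u: "Re w < Re u" "Re u < 0"
  shows "(wp' w has_field_derivative lambert (exp w) 3 (exp u) + lambert (exp w) 3 (exp (w - u))) (at u)"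
proof -
  define D where "D = {u. Re w < Re u \<and> Re u < 0}"
  have D: "open D" unfolding D_def
    by (intro open_Collect_conj open_halfspace_Re_gt open_halfspace_Re_lt)
  have transfer: "(g has_field_derivative g') (at u)"
    if "(f has_field_derivative g') (at u)" "\<And>u. u \<in> D \<Longrightarrow> f u = g u" "u \<in> D" for f g :: "complex \<Rightarrow> complex" and g' u
    using has_field_derivative_transform_within_open[OF that(1) D that(3)] that(2) by blast
  have P: "wp w u = lambert (exp w) 1 (exp u) + lambert (exp w) 1 (exp (w - u))" if "u \<in> D" for u
  proof -
    have u: "Re w < Re u" "Re u < 0" using that by (auto simp: D_def)
    have "(sig_zeta w has_field_derivative - lambert (exp w) (Suc 0) (exp u) - lambert (exp w) (Suc 0) (exp (w - u))) (at u)"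
    proof (rule transfer[OF _ _ that])
      show "((\<lambda>u. - 1/2 - lambert (exp w) 0 (exp u) + lambert (exp w) 0 (exp (w - u))) has_field_derivative
          - lambert (exp w) (Suc 0) (exp u) - lambert (exp w) (Suc 0) (exp (w - u))) (at u)"
        by (rule derivative_eq_intros DERIV_lambert_exp[OF w u] refl | simp)+
    qed (use sig_zeta_lambert[OF w] in \<open>auto simp: D_def\<close>)
    with DERIV_sig_zeta[OF w sig_nonzero[OF w u]]
    have "- wp w u = - lambert (exp w) (Suc 0) (exp u) - lambert (exp w) (Suc 0) (exp (w - u))"
      by (rule DERIV_unique)
    then have "- (- wp w u) = - (- lambert (exp w) (Suc 0) (exp u) - lambert (exp w) (Suc 0) (exp (w - u)))" by (simp only:)
    then show ?thesis by simp
  qed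
  have P': "wp' w u = lambert (exp w) 2 (exp u) - lambert (exp w) 2 (exp (w - u))" if "u \<in> D" for u
  proof -
    have u: "Re w < Re u" "Re u < 0" using that by (auto simp: D_def)
    have "(wp w has_field_derivative lambert (exp w) (Suc 1) (exp u) - lambert (exp w) (Suc 1) (exp (w - u))) (at u)"
    proof (rule transfer[OF _ _ that])
      show "((\<lambda>u. lambert (exp w) 1 (exp u) + lambert (exp w) 1 (exp (w - u))) has_field_derivative
          lambert (exp w) (Suc 1) (exp u) - lambert (exp w) (Suc 1) (exp (w - u))) (at u)"
        by (rule derivative_eq_intros DERIV_lambert_exp[OF w u] refl | simp)+
    qed (use P in auto)
    with DERIV_wp[OF w sig_nonzero[OF w u]]
    have "wp' w u = lambert (exp w) (Suc 1) (exp u) - lambert (exp w) (Suc 1) (exp (w - u))"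
      by (rule DERIV_unique)
    then show ?thesis by (simp add: numeral_2_eq_2)
  qed
  have uD: "u \<in> D" using u by (simp add: D_def)
  have "(wp' w has_field_derivative lambert (exp w) (Suc 2) (exp u) + lambert (exp w) (Suc 2) (exp (w - u))) (at u)"
  proof (rule transfer[OF _ _ uD])
    show "((\<lambda>u. lambert (exp w) 2 (exp u) - lambert (exp w) 2 (exp (w - u))) has_field_derivative
        lambert (exp w) (Suc 2) (exp u) + lambert (exp w) (Suc 2) (exp (w - u))) (at u)"
      by (rule derivative_eq_intros DERIV_lambert_exp[OF w u] refl | simp)+
  qed (use P' in auto)
  then show "(wp' w has_field_derivative lambert (exp w) 3 (exp u) + lambert (exp w) 3 (exp (w - u))) (at u)"
    by (simp add: numeral_3_eq_3 numeral_2_eq_2)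
qed

lemma lambert_three_eq:
  assumes w: "Re w < 0" and u: "Re w < Re u" "Re u < 0" "sig w (2 * u) \<noteq> 0"
  shows "lambert (exp w) 3 (exp u) + lambert (exp w) 3 (exp (w - u)) =
    wp' w u * (2 * sig_zeta w (2 * u) - 4 * sig_zeta w u)"
  using DERIV_unique[OF DERIV_wp'_lambert[OF w u(1,2)] DERIV_wp'[OF w sig_nonzero[OF w u(1,2)] u(3)]] .

text \<open>The left-hand side is the sum of the second derivatives of \<open>wp\<close> at the torsion points \<open>v\<close> and \<open>2v\<close>
  of the period \<open>5v\<close>.\<close>

lemma lambert_three_torsion:
  fixes v :: complex
  assumes v: "Re v < 0"
  defines "q \<equiv> exp v"
  defines "p \<equiv> q ^ 5"
  defines "G \<equiv> qpoch p p * qpoch q p * qpoch (q ^ 4) p"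
    and "H \<equiv> qpoch p p * qpoch (q ^ 2) p * qpoch (q ^ 3) p"
  shows "lambert p 3 q + lambert p 3 (q ^ 4) + lambert p 3 (q ^ 2) + lambert p 3 (q ^ 3) =
    q\<^sup>2 * qpoch p p ^ 12 / (G * H)\<^sup>2 * (H ^ 5 / (q * G ^ 5) + 2 - q * G ^ 5 / H ^ 5)"
    and "G \<noteq> 0" "H \<noteq> 0"
proof -
  define w where "w = 5 * v"
  have w: "Re w < 0" using v by (simp add: w_def)
  have p: "p = exp w" by (simp add: p_def q_def w_def exp_of_nat_mult[symmetric])
  have e: "exp (w - v) = q ^ 4" "exp (2 * v) = q ^ 2" "exp (w - 2 * v) = q ^ 3"
    by (simp_all add: q_def w_def exp_of_nat_mult[symmetric])
  \<comment> \<open>A square root of \<open>1 / q\<close>: the half-integral powers of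
    \<open>q\<close> from the prefactor of \<open>sig\<close> become powers of
    \<open>s\<close>.\<close>
  define s where "s = exp (- (v / 2))"
  have s: "s \<noteq> 0" by (simp add: s_def)
  have sq: "q * s ^ 2 = 1"
    by (simp add: s_def q_def exp_of_nat_mult[symmetric] exp_add[symmetric])
  have sk: "exp (- (of_nat k * v / 2)) = s ^ k" for k
    by (simp add: s_def exp_of_nat_mult[symmetric])
  define S where "S = sig w"
  have Sv: "S v = s * G"
    using sig_eq_qpoch[OF w, of v] unfolding S_def s_def G_def p e q_def by simp
  have S2: "S (2 * v) = s ^ 2 * H"
    using sig_eq_qpoch[OF w, of "2 * v"] sk[of 2] unfolding S_def H_def p e by simp
  have nz: "S v \<noteq> 0" "S (2 * v) \<noteq> 0"
    unfolding S_def by (rule sig_nonzero[OF w]; use v in \<open>simp add: w_def\<close>)+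
  then show G: "G \<noteq> 0" and H: "H \<noteq> 0" using Sv S2 by auto
  \<comment> \<open>Modulo the period \<open>w = 5 v\<close>, the points \<open>3 v\<close>,
    \<open>4 v\<close>, \<open>6 v\<close> are \<open>- 2 v\<close>, \<open>- v\<close> and
    \<open>v\<close>, so every value reduces to \<open>S v\<close> and
    \<open>S (2 * v)\<close>.\<close>
  have S3: "S (3 * v) = s * S (2 * v)"
  proof -
    have "S (3 * v) = S (- (2 * v) + w)" by (simp add: w_def)
    also have "\<dots> = exp (- (w / 2) - (- (2 * v))) * S (2 * v)"
      unfolding S_def sig_add_period sig_minus by simp
    also have "exp (- (w / 2) - (- (2 * v))) = s"
      unfolding s_def w_def by (rule arg_cong[of _ _ exp]) (simp add: field_simps)
    finally show ?thesis .
  qed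
  have S4: "S (4 * v) = s ^ 3 * S v"
  proof -
    have "S (4 * v) = S (- v + w)" by (simp add: w_def)
    also have "\<dots> = exp (- (w / 2) - (- v)) * S v"
      unfolding S_def sig_add_period sig_minus by simp
    also have "exp (- (w / 2) - (- v)) = s ^ 3"
      unfolding sk[symmetric] w_def by (rule arg_cong[of _ _ exp]) (simp add: field_simps)
    finally show ?thesis .
  qed
  have S6: "S (6 * v) = - (s ^ 7 * S v)"
  proof -
    have "S (6 * v) = S (v + w)" by (simp add: w_def)
    also have "\<dots> = - (exp (- (w / 2) - v) * S v)"
      unfolding S_def sig_add_period by simp
    also have "exp (- (w / 2) - v) = s ^ 7"
      unfolding sk[symmetric] w_def by (rule arg_cong[of _ _ exp]) (simp add: field_simps)
    finally show ?thesis .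
  qed
  define x y where "x = sig_zeta w v" and "y = sig_zeta w (2 * v)"
  have Z3: "sig_zeta w (3 * v) = - y - 1"
    using sig_zeta_add_period[OF w, of "- (2 * v)"] nz sig_zeta_minus[OF w, of "2 * v"]
    by (simp add: w_def y_def S_def sig_minus)
  have Z4: "sig_zeta w (4 * v) = - x - 1"
    using sig_zeta_add_period[OF w, of "- v"] nz sig_zeta_minus[OF w, of v]
    by (simp add: w_def x_def S_def sig_minus)
  have Z6: "sig_zeta w (6 * v) = x - 1"
    using sig_zeta_add_period[OF w, of v] nz by (simp add: w_def x_def S_def)
  define c where "c = deriv (sig w) 0"
  have nz3: "S (3 * v) \<noteq> 0" "S (4 * v) \<noteq> 0" "S (6 * v) \<noteq> 0" using S3 S4 S6 nz s by auto
  have "(- y - 1) - 3 * x = - c * S (2 * v) ^ 3 / (S v ^ 3 * S (3 * v))"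
    using sig_zeta_triple[OF w, of v] nz nz3 unfolding Z3 by (simp add: S_def c_def x_def)
  then have X: "3 * x + y + 1 = c * S (2 * v) ^ 2 / (s * S v ^ 3)"
    unfolding S3 using nz s by (simp add: field_simps power3_eq_cube power2_eq_square)
  have "(x - 1) - 3 * y = - c * S (4 * v) ^ 3 / (S (2 * v) ^ 3 * S (6 * v))"
    using sig_zeta_triple[OF w, of "2 * v"] nz nz3 Z6 by (simp add: S_def c_def x_def y_def)
  then have Y: "x - 3 * y - 1 = c * s ^ 2 * S v ^ 2 / S (2 * v) ^ 3"
    unfolding S4 S6 using nz s by (simp add: field_simps eval_nat_numeral)
  define X Y where "X = c * S (2 * v) ^ 2 / (s * S v ^ 3)" and "Y = c * s ^ 2 * S v ^ 2 / S (2 * v) ^ 3"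
  \<comment> \<open>The factors \<open>2 * sig_zeta w (2 * u) - 4 * sig_zeta w u\<close> of
    \<open>DERIV_wp'\<close> at \<open>u = v\<close> and \<open>u = 2 v\<close> are combinations of
    the two triplication equations, so \<open>x\<close> and \<open>y\<close> need not be found
    separately.\<close>
  have xy1: "2 * y - 4 * x = - X - Y" and xy2: "2 * (- x - 1) - 4 * y = Y - X"
    unfolding X[folded X_def, symmetric] Y[folded Y_def, symmetric] by simp_all
  have "lambert p 3 q + lambert p 3 (q ^ 4) = wp' w v * (2 * y - 4 * x)"
    using lambert_three_eq[OF w, of v] v nz unfolding p[symmetric] e q_def[symmetric]
    by (simp add: w_def S_def x_def y_def)
  also have "wp' w v = - (c ^ 3) * S (2 * v) / S v ^ 4"
    by (simp add: wp'_def c_def S_def)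
  finally have 1: "lambert p 3 q + lambert p 3 (q ^ 4) = - (c ^ 3) * S (2 * v) / S v ^ 4 * (- X - Y)"
    unfolding xy1 .
  have "lambert p 3 (q ^ 2) + lambert p 3 (q ^ 3) = wp' w (2 * v) * (2 * (- x - 1) - 4 * y)"
    using lambert_three_eq[OF w, of "2 * v"] v nz3 Z4 unfolding p[symmetric] e q_def[symmetric]
    by (simp add: w_def S_def x_def y_def)
  also have "wp' w (2 * v) = - (c ^ 3) * (s ^ 3 * S v) / S (2 * v) ^ 4"
    using S4 by (simp add: wp'_def c_def S_def)
  finally have 2: "lambert p 3 (q ^ 2) + lambert p 3 (q ^ 3) = - (c ^ 3) * (s ^ 3 * S v) / S (2 * v) ^ 4 * (Y - X)"
    unfolding xy2 .
  have "lambert p 3 q + lambert p 3 (q ^ 4) + (lambert p 3 (q ^ 2) + lambert p 3 (q ^ 3)) =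
    c ^ 4 * s ^ 2 / (S v * S (2 * v)) ^ 2 * (S (2 * v) ^ 5 / (s ^ 3 * S v ^ 5) + 2 - s ^ 3 * S v ^ 5 / S (2 * v) ^ 5)"
    unfolding 1 2 X_def Y_def using nz s by (simp add: divide_simps) (simp add: algebra_simps eval_nat_numeral)
  also have "S (2 * v) ^ 5 / (s ^ 3 * S v ^ 5) = H ^ 5 / (q * G ^ 5)"
  proof -
    have "H ^ 5 / (q * G ^ 5) = (s ^ 2 * H ^ 5) / ((q * s ^ 2) * G ^ 5)" using s by simp
    then show ?thesis using s unfolding sq Sv S2 by (simp add: field_simps eval_nat_numeral)
  qed
  also have "s ^ 3 * S v ^ 5 / S (2 * v) ^ 5 = q * G ^ 5 / H ^ 5"
  proof -
    have "q * G ^ 5 / H ^ 5 = ((q * s ^ 2) * G ^ 5) / (s ^ 2 * H ^ 5)" using s by simp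
    then show ?thesis using s unfolding sq Sv S2 by (simp add: field_simps eval_nat_numeral)
  qed
  also have "c ^ 4 * s ^ 2 / (S v * S (2 * v)) ^ 2 = q\<^sup>2 * qpoch p p ^ 12 / (G * H)\<^sup>2"
  proof -
    have "c ^ 4 = qpoch p p ^ 12" unfolding c_def deriv_sig_0[OF w] p by simp
    moreover have "q\<^sup>2 * qpoch p p ^ 12 / (G * H)\<^sup>2 = (q * s ^ 2) ^ 2 * qpoch p p ^ 12 / (s ^ 4 * (G * H)\<^sup>2)"
      using s by (simp add: power_mult_distrib)
    ultimately show ?thesis using s G H unfolding sq Sv S2 by (simp add: field_simps eval_nat_numeral)
  qed
  finally show "lambert p 3 q + lambert p 3 (q ^ 4) + lambert p 3 (q ^ 2) + lambert p 3 (q ^ 3) =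
    q\<^sup>2 * qpoch p p ^ 12 / (G * H)\<^sup>2 * (H ^ 5 / (q * G ^ 5) + 2 - q * G ^ 5 / H ^ 5)"
    by (simp only: add.assoc)
qed

subsection \<open>Theta series at fifth roots of unity\<close>

lemma norm_power_less_one:
  fixes q :: complex
  assumes "norm q < 1" "n > 0"
  shows "norm (q ^ n) < 1"
  using assms power_less_one_iff[of "norm q" n] by (simp add: norm_power)

lemma qpoch_multisection:
  assumes q: "norm q < 1" and n: "n > 0"
  shows "qpoch x q = (\<Prod>i<n. qpoch (x * q ^ i) (q ^ n))"
proof -
  have "(\<lambda>N. \<Prod>i<n. \<Prod>k<N. 1 - x * q ^ i * (q ^ n) ^ k) \<longlonglongrightarrow> (\<Prod>i<n. qpoch (x * q ^ i) (q ^ n))"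
    by (intro tendsto_prod qpoch_LIMSEQ norm_power_less_one q n)
  moreover have "(\<Prod>i<n. \<Prod>k<N. 1 - x * q ^ i * (q ^ n) ^ k) = (\<Prod>k<N * n. 1 - x * q ^ k)" for N
  proof -
    have "(\<Prod>k<N * n. 1 - x * q ^ k) = (\<Prod>k<N. \<Prod>j\<in>{k * n..<k * n + n}. 1 - x * q ^ j)"
      by (simp add: prod.nat_group)
    also have "\<dots> = (\<Prod>k<N. \<Prod>i<n. 1 - x * q ^ i * (q ^ n) ^ k)"
    proof (rule prod.cong[OF refl])
      fix k
      have "(\<Prod>j\<in>{k * n..<k * n + n}. 1 - x * q ^ j) = (\<Prod>i\<in>{0..<n}. 1 - x * q ^ (i + k * n))"
        using prod.shift_bounds_nat_ivl[of "\<lambda>j. 1 - x * q ^ j" 0 "k * n" n] by (simp add: add.commute)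
      also have "\<dots> = (\<Prod>i<n. 1 - x * q ^ i * (q ^ n) ^ k)"
        by (simp add: atLeast0LessThan power_add power_mult[symmetric] mult_ac)
      finally show "(\<Prod>j\<in>{k * n..<k * n + n}. 1 - x * q ^ j) = (\<Prod>i<n. 1 - x * q ^ i * (q ^ n) ^ k)" .
    qed
    finally show ?thesis by (simp add: prod.swap[of _ "{..<n}"])
  qed
  ultimately have "(\<lambda>N. \<Prod>k<N * n. 1 - x * q ^ k) \<longlonglongrightarrow> (\<Prod>i<n. qpoch (x * q ^ i) (q ^ n))" by simp
  moreover have "(\<lambda>N. \<Prod>k<N * n. 1 - x * q ^ k) \<longlonglongrightarrow> qpoch x q"
    using LIMSEQ_subseq_LIMSEQ[OF qpoch_LIMSEQ[OF q, of x], of "\<lambda>N. N * n"] n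
    by (simp add: o_def strict_mono_def)
  ultimately show ?thesis using LIMSEQ_unique by blast
qed

lemma prod_lessThan_5: "(\<Prod>i<5. f i) = f 0 * f 1 * f 2 * f 3 * f (4::nat)"
  by (simp add: eval_nat_numeral mult_ac)

text \<open>The cyclotomic relation is a form of primitivity that \<open>algebra\<close> can use
  directly. A locale permits instances at the conjugates \<open>z^2\<close>, \<open>z^3\<close>,
  \<open>z^4\<close>.\<close>

locale fifth_root =
  fixes z :: complex
  assumes z_sum: "1 + z + z ^ 2 + z ^ 3 + z ^ 4 = 0" and z_ne_1: "z \<noteq> 1"
begin

lemma z_pow_5: "z ^ 5 = 1"
  using z_sum by algebra

lemma z_nonzero: "z \<noteq> 0"
  using z_pow_5 by auto

lemma norm_z: "norm z = 1"
  using z_pow_5 by (metis norm_one norm_power power_eq_1_iff zero_neq_numeral norm_ge_zero)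

lemma prod_diff_fifth_root: "(\<Prod>j<5. A - z ^ j * B) = A ^ 5 - B ^ 5"
proof -
  have "(A - B) * (A - z * B) * (A - z ^ 2 * B) * (A - z ^ 3 * B) * (A - z ^ 4 * B) = A ^ 5 - B ^ 5"
    using z_sum by algebra
  then show ?thesis by (simp add: prod_lessThan_5)
qed

lemma prod_qpoch_fifth_root:
  assumes q: "norm q < 1"
  shows "(\<Prod>j<5. qpoch (z ^ j * x) q) = qpoch (x ^ 5) (q ^ 5)"
proof -
  have "(\<lambda>N. \<Prod>j<5. \<Prod>k<N. 1 - z ^ j * x * q ^ k) \<longlonglongrightarrow> (\<Prod>j<5. qpoch (z ^ j * x) q)"
    by (intro tendsto_prod qpoch_LIMSEQ q)
  also have "(\<lambda>N. \<Prod>j<5. \<Prod>k<N. 1 - z ^ j * x * q ^ k) = (\<lambda>N. \<Prod>k<N. 1 - x ^ 5 * (q ^ 5) ^ k)"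
  proof
    fix N
    have "(\<Prod>j<5. 1 - z ^ j * (x * q ^ k)) = 1 - x ^ 5 * (q ^ 5) ^ k" for k
      using prod_diff_fifth_root[of 1 "x * q ^ k"]
      by (simp add: power_mult_distrib power_mult[symmetric] mult.commute)
    then show "(\<Prod>j<5. \<Prod>k<N. 1 - z ^ j * x * q ^ k) = (\<Prod>k<N. 1 - x ^ 5 * (q ^ 5) ^ k)"
      by (subst prod.swap) (simp add: mult.assoc)
  qed
  finally show ?thesis
    using qpoch_LIMSEQ[OF norm_power_less_one[OF q, of 5], of "x ^ 5"] LIMSEQ_unique by fastforce
qed

text \<open>The series is split by the residue of the index modulo 5; the class of 3 contributes 0.\<close>

lemma theta_dissection:
  fixes Q :: complex
  assumes Q: "Q \<noteq> 0" "norm Q < 1"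
  defines "q \<equiv> Q ^ 5" and "p \<equiv> Q ^ 25"
  defines "G \<equiv> qpoch p p * qpoch q p * qpoch (q ^ 4) p"
    and "H \<equiv> qpoch p p * qpoch (q ^ 2) p * qpoch (q ^ 3) p"
  shows "qpoch Q Q * qpoch (z * Q) Q * qpoch (z ^ 4 * Q) Q = H + Q * (z ^ 2 + z ^ 3) * G"
proof -
  have p: "p \<noteq> 0" "norm p < 1" using Q norm_power_less_one[OF Q(2)] by (simp_all add: p_def)
  have q: "q \<noteq> 0" using Q by (simp add: q_def)
  have pq: "p = q ^ 5" by (simp add: p_def q_def flip: power_mult)
  define T where "T = (\<lambda>j::nat. qpoch p p * qpoch (q ^ j) p * qpoch (q ^ (5 - j)) p)"
  have T: "(theta_term p (q ^ j) has_sum T j) UNIV" if "j \<le> 5" for j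
  proof -
    have "p / q ^ j = q ^ (5 - j)" using that q by (simp add: pq power_diff)
    then show ?thesis
      using jacobi_triple_product[OF p, of "q ^ j"] q by (simp add: T_def)
  qed
  \<comment> \<open>The offset \<open>- 2\<close> is chosen so that class \<open>j\<close> becomes
    the theta series at exactly \<open>q^j\<close>: the mixed term of \<open>tri (5 m + r)\<close>
    is \<open>5 m (r + 2)\<close>.\<close>
  have cls: "theta_term Q z (5 * m + (int j - 2)) =
      ((-1) powi (int j - 2) * Q powi tri (int j - 2) * z powi (int j - 2)) * theta_term p (q ^ j) m" for m j
  proof -
    have "tri (5 * m + (int j - 2)) = 25 * tri m + 5 * int j * m + tri (int j - 2)"
      by (rule tri_eqI) (use two_tri[of m] two_tri[of "int j - 2"] in \<open>simp add: algebra_simps\<close>)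
    moreover have "Q powi (25 * tri m) = p powi tri m" "Q powi (5 * int j * m) = (q ^ j) powi m"
      unfolding p_def q_def power_int_mult power_int_numeral power_int_of_nat by (rule refl)+
    moreover have "(-1::complex) powi (5 * m + (int j - 2)) = (-1) powi m * (-1) powi (int j - 2)"
      using power_int_mult[of "-1::complex" 5 m] by (simp add: power_int_add)
    moreover have "z powi (5 * m + (int j - 2)) = z powi (int j - 2)"
      using z_nonzero z_pow_5 power_int_mult[of z 5 m] by (simp add: power_int_add)
    ultimately show ?thesis using Q by (simp add: theta_term_def power_int_add mult_ac)
  qed
  define C where "C = (\<lambda>j. (-1) powi (int j - 2) * Q powi tri (int j - 2) * z powi (int j - 2))"
  have "(theta_term Q z has_sum (\<Sum>j\<in>{1..5}. C j * T j)) (\<Union>j\<in>{1..5::nat}. range (\<lambda>m. 5 * m + (int j - 2)))"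
  proof (rule sum_has_sum)
    fix j :: nat assume j: "j \<in> {1..5}"
    have "((\<lambda>m. theta_term Q z (5 * m + (int j - 2))) has_sum C j * T j) UNIV"
      unfolding cls C_def using j by (intro has_sum_cmult_right T) auto
    then show "(theta_term Q z has_sum C j * T j) (range (\<lambda>m. 5 * m + (int j - 2)))"
      by (subst has_sum_reindex) (auto simp: inj_on_def o_def)
  qed (auto, presburger)
  also have "(\<Union>j\<in>{1..5::nat}. range (\<lambda>m. 5 * m + (int j - 2))) = UNIV"
  proof -
    have "n \<in> (\<Union>j\<in>{1..5::nat}. range (\<lambda>m. 5 * m + (int j - 2)))" for n
    proof -
      define r j where "r = (n + 1) mod 5" and "j = nat (r + 1)"
      have r: "0 \<le> r" "r < 5" "n + 1 = 5 * ((n + 1) div 5) + r" by (simp_all add: r_def)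
      then have "int j = r + 1" by (simp add: j_def)
      with r have "j \<in> {1..5}" "n = 5 * ((n + 1) div 5) + (int j - 2)" by auto
      then show ?thesis by blast
    qed
    then show ?thesis by auto
  qed
  finally have "(theta_term Q z has_sum (\<Sum>j\<in>{1..5}. C j * T j)) UNIV" .
  moreover have "(theta_term Q z has_sum qpoch Q Q * qpoch z Q * qpoch (Q / z) Q) UNIV"
    by (rule jacobi_triple_product[OF Q z_nonzero])
  ultimately have eq: "qpoch Q Q * qpoch z Q * qpoch (Q / z) Q = (\<Sum>j\<in>{1..5}. C j * T j)"
    using has_sum_unique by blast
  have tri: "tri (-1) = 1" "tri 0 = 0" "tri 1 = 0" "tri 2 = 1" "tri 3 = 3"
    by (simp_all add: tri_def)
  have z4: "inverse z = z ^ 4"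
    using z_pow_5 z_nonzero by (simp add: field_simps eval_nat_numeral)
  have C: "C 1 = - (Q * z ^ 4)" "C 2 = 1" "C 3 = - z" "C 4 = Q * z ^ 2"
    by (simp_all add: C_def tri z4)
  have T: "T 1 = G" "T 2 = H" "T 3 = H" "T 4 = G" "T 5 = 0"
    unfolding T_def G_def H_def using qpoch_eq_0_iff[OF p(2), of 1] by (simp_all, auto intro: exI[of _ 0])
  have "{1..5::nat} = {1, 2, 3, 4, 5}" by auto
  then have "(\<Sum>j\<in>{1..5}. C j * T j) = C 1 * T 1 + C 2 * T 2 + C 3 * T 3 + C 4 * T 4 + C 5 * T 5"
    by simp
  also have "\<dots> = (1 - z) * (H + Q * (z ^ 2 + z ^ 3) * G)"
    unfolding C T by (simp add: algebra_simps power2_eq_square power3_eq_cube power4_eq_xxxx)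
  finally have "(\<Sum>j\<in>{1..5}. C j * T j) = (1 - z) * (H + Q * (z ^ 2 + z ^ 3) * G)" .
  moreover have "qpoch z Q = (1 - z) * qpoch (z * Q) Q" by (rule qpoch_Suc[OF Q(2)])
  moreover have "Q / z = z ^ 4 * Q" by (simp add: z4[symmetric] divide_inverse mult.commute)
  ultimately have "(1 - z) * (qpoch Q Q * qpoch (z * Q) Q * qpoch (z ^ 4 * Q) Q) = (1 - z) * (H + Q * (z ^ 2 + z ^ 3) * G)"
    using eq by (simp add: mult_ac)
  then show ?thesis using z_ne_1 by simp
qed

lemma fifth_root_square: "fifth_root (z ^ 2)"
proof
  have "1 + z ^ 2 + z ^ 4 + z ^ 6 + z ^ 8 = 0" using z_sum by algebra
  then show "1 + z ^ 2 + (z ^ 2) ^ 2 + (z ^ 2) ^ 3 + (z ^ 2) ^ 4 = 0" by (simp flip: power_mult)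
  show "z ^ 2 \<noteq> 1"
  proof
    assume "z ^ 2 = 1"
    then have "z = 1" using z_pow_5 by algebra
    then show False using z_ne_1 by simp
  qed
qed

text \<open>The dissection at \<open>z\<close> contains the roots \<open>z\<close>,
  \<open>z^4\<close> and the one at \<open>z^2\<close> the other two. Multiplied, they complete the
  product over all fifth roots to \<open>qpoch q q\<close>, with one \<open>qpoch Q Q\<close> left
  over.\<close>

lemma rogers_ramanujan_quadratic:
  fixes Q :: complex
  assumes Q: "Q \<noteq> 0" "norm Q < 1"
  defines "q \<equiv> Q ^ 5" and "p \<equiv> Q ^ 25"
  defines "G \<equiv> qpoch p p * qpoch q p * qpoch (q ^ 4) p"
    and "H \<equiv> qpoch p p * qpoch (q ^ 2) p * qpoch (q ^ 3) p"
  shows "qpoch Q Q * qpoch q q = (H + Q * (z ^ 2 + z ^ 3) * G) * (H + Q * (z + z ^ 4) * G)"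
proof -
  interpret sq: fifth_root "z ^ 2" by (rule fifth_root_square)
  have z8: "(z ^ 2) ^ 4 = z ^ 3" "(z ^ 2) ^ 2 = z ^ 4" "(z ^ 2) ^ 3 = z"
  proof -
    have "(z ^ 2) ^ 4 = z ^ 5 * z ^ 3" "(z ^ 2) ^ 2 = z ^ 4" "(z ^ 2) ^ 3 = z ^ 5 * z"
      by (simp_all add: eval_nat_numeral mult_ac)
    then show "(z ^ 2) ^ 4 = z ^ 3" "(z ^ 2) ^ 2 = z ^ 4" "(z ^ 2) ^ 3 = z" by (simp_all only: z_pow_5 mult_1)
  qed
  note 1 = theta_dissection[OF Q, folded q_def p_def, folded G_def H_def]
  note 2 = sq.theta_dissection[OF Q, folded q_def p_def, folded G_def H_def, unfolded z8]
  have "qpoch q q = qpoch Q Q * qpoch (z * Q) Q * qpoch (z ^ 2 * Q) Q * qpoch (z ^ 3 * Q) Q * qpoch (z ^ 4 * Q) Q"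
    using prod_qpoch_fifth_root[OF Q(2), of Q] by (simp add: prod_lessThan_5 q_def)
  then show ?thesis unfolding 1[symmetric] using 2 by (simp add: mult_ac)
qed

text \<open>Split each factor by the residue of the exponent modulo 5. In a class prime to 5 the
  powers of \<open>z\<close> run through all fifth roots; the class of 0 does not see
  \<open>z\<close> and yields \<open>qpoch q q ^ 5\<close>. The extra factor
  \<open>qpoch (q ^ 5) (q ^ 5)\<close> supplies the missing class, and the classes recombine to a
  sixth \<open>qpoch q q\<close>.\<close>

lemma prod_qpoch_self_fifth_root:
  fixes Q :: complex
  assumes Q: "norm Q < 1"
  defines "q \<equiv> Q ^ 5"
  shows "(\<Prod>j<5. qpoch (z ^ j * Q) (z ^ j * Q)) * qpoch (q ^ 5) (q ^ 5) = qpoch q q ^ 6"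
proof -
  have q: "norm q < 1" using norm_power_less_one[OF Q, of 5] by (simp add: q_def)
  have zQ5: "(z ^ j * Q) ^ 5 = q" for j
  proof -
    have "(z ^ j) ^ 5 = (z ^ 5) ^ j" unfolding power_mult[symmetric] by (simp only: mult.commute)
    then show ?thesis by (simp add: q_def power_mult_distrib z_pow_5)
  qed
  have split: "qpoch (z ^ j * Q) (z ^ j * Q) = (\<Prod>i<5. qpoch (z ^ j * Q * (z ^ j * Q) ^ i) q)" for j
    using qpoch_multisection[of "z ^ j * Q" 5 "z ^ j * Q"] Q norm_z by (simp add: norm_mult norm_power zQ5)
  have inner: "(\<Prod>j<5. qpoch (z ^ j * Q * (z ^ j * Q) ^ i) q) = qpoch (q * q ^ i) (q ^ 5)" if "fifth_root (z ^ Suc i)" for i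
  proof -
    interpret r: fifth_root "z ^ Suc i" by (rule that)
    have "z ^ j * Q * (z ^ j * Q) ^ i = (z ^ Suc i) ^ j * Q ^ Suc i" for j
    proof -
      have "(z ^ j) ^ Suc i = (z ^ Suc i) ^ j" unfolding power_mult[symmetric] by (simp only: mult.commute)
      moreover have "z ^ j * Q * (z ^ j * Q) ^ i = (z ^ j) ^ Suc i * Q ^ Suc i"
        unfolding power_mult_distrib[symmetric] by (rule power_Suc[symmetric])
      ultimately show ?thesis by (simp only:)
    qed
    then have "(\<Prod>j<5. qpoch (z ^ j * Q * (z ^ j * Q) ^ i) q) = qpoch ((Q ^ Suc i) ^ 5) (q ^ 5)"
      using r.prod_qpoch_fifth_root[OF q, of "Q ^ Suc i"] by (simp only:)
    also have "(Q ^ Suc i) ^ 5 = q * q ^ i"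
      by (simp add: q_def power_mult_distrib power_mult[symmetric] mult.commute[of i])
    finally show ?thesis .
  qed
  have fr: "fifth_root (z ^ Suc 0)" "fifth_root (z ^ Suc 1)" "fifth_root (z ^ Suc 2)" "fifth_root (z ^ Suc 3)"
  proof -
    interpret sq: fifth_root "z ^ 2" by (rule fifth_root_square)
    show "fifth_root (z ^ Suc 0)" by (simp add: fifth_root_axioms)
    show "fifth_root (z ^ Suc 1)" using fifth_root_square by (simp add: numeral_2_eq_2)
    have four: "fifth_root (z ^ 4)" using sq.fifth_root_square by (simp flip: power_mult)
    then show "fifth_root (z ^ Suc 3)" by (simp add: numeral_eq_Suc)
    interpret fo: fifth_root "z ^ 4" by (rule four)
    have "(z ^ 4) ^ 2 = z ^ 3" using z_pow_5 by algebra
    moreover have "Suc 2 = 3" by simp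
    ultimately show "fifth_root (z ^ Suc 2)" using fo.fifth_root_square by (simp only:)
  qed
  have last: "(\<Prod>j<5. qpoch (z ^ j * Q * (z ^ j * Q) ^ 4) q) = qpoch q q ^ 5"
  proof -
    have "z ^ j * Q * (z ^ j * Q) ^ 4 = q" for j using zQ5[of j] by (simp add: eval_nat_numeral)
    then show ?thesis by simp
  qed
  have "(\<Prod>j<5. qpoch (z ^ j * Q) (z ^ j * Q)) = (\<Prod>i<5. \<Prod>j<5. qpoch (z ^ j * Q * (z ^ j * Q) ^ i) q)"
    unfolding split by (rule prod.swap)
  also have "\<dots> = qpoch q (q ^ 5) * qpoch (q * q) (q ^ 5) * qpoch (q * q ^ 2) (q ^ 5) * qpoch (q * q ^ 3) (q ^ 5) * qpoch q q ^ 5"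
    unfolding prod_lessThan_5[of "\<lambda>i. \<Prod>j<5. qpoch (z ^ j * Q * (z ^ j * Q) ^ i) q"]
      inner[OF fr(1)] inner[OF fr(2)] inner[OF fr(3)] inner[OF fr(4)] last by simp
  finally have "(\<Prod>j<5. qpoch (z ^ j * Q) (z ^ j * Q)) * qpoch (q ^ 5) (q ^ 5) =
     (qpoch q (q ^ 5) * qpoch (q * q) (q ^ 5) * qpoch (q * q ^ 2) (q ^ 5) * qpoch (q * q ^ 3) (q ^ 5) * qpoch (q * q ^ 4) (q ^ 5)) * qpoch q q ^ 5"
    by (simp add: eval_nat_numeral mult_ac)
  also have "qpoch q (q ^ 5) * qpoch (q * q) (q ^ 5) * qpoch (q * q ^ 2) (q ^ 5) * qpoch (q * q ^ 3) (q ^ 5) * qpoch (q * q ^ 4) (q ^ 5) = qpoch q q"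
    using qpoch_multisection[OF q, of 5 q] by (simp add: prod_lessThan_5)
  finally show ?thesis by (simp add: eval_nat_numeral)
qed

text \<open>The substitutions \<open>Q\<close> to \<open>z^j Q\<close> fix \<open>q\<close>,
  \<open>G\<close> and \<open>H\<close>, so multiplying the quadratic relation over them turns its
  two linear factors into differences of fifth powers. The numbers \<open>a\<close> and
  \<open>b\<close> are negated Gauss periods, the roots of \<open>x^2 = x + 1\<close>.\<close>

lemma rogers_ramanujan_eleven:
  fixes Q :: complex
  assumes Q: "Q \<noteq> 0" "norm Q < 1"
  defines "q \<equiv> Q ^ 5" and "p \<equiv> Q ^ 25"
  defines "G \<equiv> qpoch p p * qpoch q p * qpoch (q ^ 4) p"
    and "H \<equiv> qpoch p p * qpoch (q ^ 2) p * qpoch (q ^ 3) p"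
  shows "qpoch q q ^ 11 = qpoch p p * (H ^ 10 - 11 * q * G ^ 5 * H ^ 5 - q ^ 2 * G ^ 10)"
proof -
  define a b where "a = - (z ^ 2 + z ^ 3)" and "b = - (z + z ^ 4)"
  have ab: "a + b = 1" "a * b = - 1" unfolding a_def b_def using z_sum by algebra+
  have ab5: "a ^ 5 + b ^ 5 = 11" "a ^ 5 * b ^ 5 = - 1" using ab by algebra+
  have pq: "p = q ^ 5" by (simp add: p_def q_def flip: power_mult)
  have each: "qpoch (z ^ j * Q) (z ^ j * Q) * qpoch q q = (H - z ^ j * (a * Q * G)) * (H - z ^ j * (b * Q * G))" for j
  proof -
    have zQ: "z ^ j * Q \<noteq> 0" "norm (z ^ j * Q) < 1" using Q z_nonzero norm_z by (simp_all add: norm_mult norm_power)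
    have "(z ^ j) ^ 5 = 1" "(z ^ j) ^ 25 = 1"
    proof -
      have "(z ^ j) ^ 5 = (z ^ 5) ^ j"
        unfolding power_mult[symmetric] by (simp only: mult.commute)
      then show 1: "(z ^ j) ^ 5 = 1" by (simp add: z_pow_5)
      have "(z ^ j) ^ 25 = ((z ^ j) ^ 5) ^ 5" unfolding power_mult[symmetric] by (simp add: mult.commute)
      then show "(z ^ j) ^ 25 = 1" unfolding 1 by simp
    qed
    then have zQ5: "(z ^ j * Q) ^ 5 = q" "(z ^ j * Q) ^ 25 = p"
      by (simp_all add: q_def p_def power_mult_distrib)
    have "H - z ^ j * (a * Q * G) = H + z ^ j * Q * (z ^ 2 + z ^ 3) * G"
      "H - z ^ j * (b * Q * G) = H + z ^ j * Q * (z + z ^ 4) * G"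
      by (simp_all add: a_def b_def algebra_simps)
    then show ?thesis
      using rogers_ramanujan_quadratic[OF zQ, unfolded zQ5, folded G_def H_def] by (simp only:)
  qed
  have "(\<Prod>j<5. qpoch (z ^ j * Q) (z ^ j * Q)) * qpoch q q ^ 5 = (\<Prod>j<5. qpoch (z ^ j * Q) (z ^ j * Q) * qpoch q q)"
    by (simp add: prod.distrib)
  also have "\<dots> = (H ^ 5 - (a * Q * G) ^ 5) * (H ^ 5 - (b * Q * G) ^ 5)"
    unfolding each prod.distrib prod_diff_fifth_root ..
  also have "\<dots> = H ^ 10 - 11 * q * G ^ 5 * H ^ 5 - q ^ 2 * G ^ 10"
  proof -
    have "(H5 - A * X) * (H5 - B * X) = H5 ^ 2 - 11 * X * H5 - X ^ 2" if "A + B = 11" "A * B = - 1" for A B H5 X :: complex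
    proof -
      have "(H5 - A * X) * (H5 - B * X) = H5 ^ 2 - (A + B) * X * H5 + (A * B) * X ^ 2"
        by (simp add: algebra_simps power2_eq_square)
      then show ?thesis unfolding that by simp
    qed
    from this[OF ab5, of "H ^ 5" "q * G ^ 5"] show ?thesis
      by (simp add: q_def power_mult_distrib mult_ac flip: power_mult)
  qed
  finally have "(\<Prod>j<5. qpoch (z ^ j * Q) (z ^ j * Q)) * qpoch p p * qpoch q q ^ 5 =
     qpoch p p * (H ^ 10 - 11 * q * G ^ 5 * H ^ 5 - q ^ 2 * G ^ 10)" by simp
  then show ?thesis
    unfolding pq prod_qpoch_self_fifth_root[OF Q(2), folded q_def] by (simp flip: power_add)
qed

end

lemma exists_fifth_root: "\<exists>z. fifth_root z"
proof
  define z where "z = cis (2 * pi / 5)"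
  have z5: "z ^ 5 = 1" by (simp add: z_def Complex.DeMoivre)
  have z1: "z \<noteq> 1"
  proof
    assume "z = 1"
    then have "cos (2 * pi / 5) = 1" by (simp add: z_def complex_eq_iff)
    moreover have "cos (2 * pi / 5) < cos 0"
      by (rule cos_monotone_0_pi) (use pi_gt_zero in auto)
    ultimately show False by simp
  qed
  have "(z - 1) * (1 + z + z ^ 2 + z ^ 3 + z ^ 4) = z ^ 5 - 1"
    by (simp add: algebra_simps eval_nat_numeral)
  with z5 z1 have "1 + z + z ^ 2 + z ^ 3 + z ^ 4 = 0" by simp
  with z1 show "fifth_root z" by (simp add: fifth_root_def)
qed

section \<open>Elimination of the continued fraction\<close>

text \<open>Since \<open>G * H = P * K\<close>, the functions \<open>G\<close> and \<open>H\<close>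
  survive in the torsion formula only through \<open>h / (q g) - q g / h\<close> with
  \<open>g = G^5\<close>, \<open>h = H^5\<close>, and this is what
  \<open>rogers_ramanujan_eleven\<close> evaluates.\<close>

lemma lambert_three_eq_eta:
  fixes q :: complex
  assumes q: "q \<noteq> 0" "norm q < 1"
  defines "p \<equiv> q ^ 5"
  shows "lambert p 3 q + lambert p 3 (q ^ 4) + lambert p 3 (q ^ 2) + lambert p 3 (q ^ 3) =
    13 * (q\<^sup>2 * qpoch p p ^ 10 / qpoch q q ^ 2) + q * qpoch q q ^ 4 * qpoch p p ^ 4"
proof -
  define v where "v = Ln q"
  have v: "exp v = q" using q by (simp add: v_def)
  have "norm (exp v) < 1" using q v by simp
  then have Rv: "Re v < 0" by simp
  define Q where "Q = exp (v / 5)"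
  have Q5: "Q ^ 5 = q" by (simp add: Q_def v exp_of_nat_mult[symmetric])
  have Q25: "Q ^ 25 = p"
  proof -
    have "Q ^ 25 = (Q ^ 5) ^ 5" by (simp flip: power_mult)
    then show ?thesis by (simp add: Q5 p_def)
  qed
  have Q: "Q \<noteq> 0" "norm Q < 1" using Rv by (simp_all add: Q_def)
  obtain z where "fifth_root z" using exists_fifth_root by blast
  then interpret fifth_root z .
  define G H where "G = qpoch p p * qpoch q p * qpoch (q ^ 4) p" and "H = qpoch p p * qpoch (q ^ 2) p * qpoch (q ^ 3) p"
  have p: "norm p < 1" using norm_power_less_one[OF q(2)] by (simp add: p_def)
  define P K where "P = qpoch p p" and "K = qpoch q q"
  have nz: "P \<noteq> 0" "K \<noteq> 0" using qpoch_self_nonzero p q(2) by (auto simp: P_def K_def)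
  have L: "lambert p 3 q + lambert p 3 (q ^ 4) + lambert p 3 (q ^ 2) + lambert p 3 (q ^ 3) =
    q\<^sup>2 * P ^ 12 / (G * H)\<^sup>2 * (H ^ 5 / (q * G ^ 5) + 2 - q * G ^ 5 / H ^ 5)"
    and GH0: "G \<noteq> 0" "H \<noteq> 0"
    using lambert_three_torsion[OF Rv] unfolding v p_def[symmetric] G_def H_def P_def by simp_all
  have E: "K ^ 11 = P * (H ^ 10 - 11 * q * G ^ 5 * H ^ 5 - q ^ 2 * G ^ 10)"
    using rogers_ramanujan_eleven[OF Q] unfolding Q5 Q25 G_def H_def P_def K_def .
  have GH: "G * H = P * K"
    using qpoch_multisection[OF q(2), of 5 q]
    by (simp add: prod_lessThan_5 G_def H_def P_def K_def p_def mult_ac eval_nat_numeral)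
  \<comment> \<open>The term 2 of the torsion formula is written as \<open>- 11 + 13\<close>, to
    match the relation \<open>E\<close>.\<close>
  have "(G * H) ^ 5 * (H ^ 5 / (q * G ^ 5) + 2 - q * G ^ 5 / H ^ 5) * q * P =
     P * (H ^ 10 - 11 * q * G ^ 5 * H ^ 5 - q ^ 2 * G ^ 10) + 13 * q * P * (G * H) ^ 5"
  proof -
    define g h where "g = G ^ 5" and "h = H ^ 5"
    have "g \<noteq> 0" "h \<noteq> 0" using GH0 by (simp_all add: g_def h_def)
    then have "g * h * (h / (q * g) + 2 - q * g / h) * q * P = P * (h ^ 2 - 11 * q * g * h - q ^ 2 * g ^ 2) + 13 * q * P * (g * h)"
      using q by (simp add: field_simps power2_eq_square)
    then show ?thesis by (simp add: g_def h_def power_mult_distrib flip: power_mult)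
  qed
  then have "(P * K) ^ 5 * (H ^ 5 / (q * G ^ 5) + 2 - q * G ^ 5 / H ^ 5) * q * P = K ^ 11 + 13 * q * P * (P * K) ^ 5"
    unfolding E[symmetric] GH .
  then have "H ^ 5 / (q * G ^ 5) + 2 - q * G ^ 5 / H ^ 5 = K ^ 6 / (q * P ^ 6) + 13"
  proof -
    define X where "X = H ^ 5 / (q * G ^ 5) + 2 - q * G ^ 5 / H ^ 5"
    assume "(P * K) ^ 5 * (H ^ 5 / (q * G ^ 5) + 2 - q * G ^ 5 / H ^ 5) * q * P = K ^ 11 + 13 * q * P * (P * K) ^ 5"
    then have "(q * P ^ 6 * K ^ 5) * X = (q * P ^ 6 * K ^ 5) * (K ^ 6 / (q * P ^ 6) + 13)"
      using nz q unfolding X_def[symmetric] by (simp add: field_simps power_mult_distrib eval_nat_numeral)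
    then show ?thesis unfolding X_def[symmetric] using nz q by simp
  qed
  then have "q\<^sup>2 * P ^ 12 / (G * H)\<^sup>2 * (H ^ 5 / (q * G ^ 5) + 2 - q * G ^ 5 / H ^ 5) =
     q\<^sup>2 * P ^ 12 / (P * K)\<^sup>2 * (K ^ 6 / (q * P ^ 6) + 13)"
    unfolding GH by simp
  also have "\<dots> = 13 * (q\<^sup>2 * P ^ 10 / K ^ 2) + q * K ^ 4 * P ^ 4"
    using nz q by (simp add: field_simps power_mult_distrib eval_nat_numeral)
  finally show ?thesis unfolding L P_def K_def .
qed

subsection \<open>The divisor sum\<close>

text \<open>At \<open>x = q^m\<close> the four powers in the numerator come from the Lambert series
  at \<open>q\<close>, \<open>q^2\<close>, \<open>q^3\<close>, \<open>q^4\<close>.\<close>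

lemma has_sum_power_not_dvd_5:
  fixes x :: "'a :: {real_normed_field, banach}"
  assumes x: "norm x < 1"
  shows "((\<lambda>k. x ^ k) has_sum ((x + x ^ 2 + x ^ 3 + x ^ 4) / (1 - x ^ 5))) {k. \<not> 5 dvd k}"
proof -
  have geo: "((\<lambda>k. y ^ k) has_sum (1 / (1 - y))) UNIV" if "norm y < 1" for y :: 'a
  proof (rule norm_summable_imp_has_sum)
    show "summable (\<lambda>k. norm (y ^ k))" using that by (simp add: norm_power summable_geometric)
    show "(\<lambda>k. y ^ k) sums (1 / (1 - y))" by (rule geometric_sums[OF that])
  qed
  have x5: "norm (x ^ 5) < 1" using x power_less_one_iff[of "norm x" 5] by (simp add: norm_power)
  have "((\<lambda>k. x ^ k) \<circ> (\<lambda>k. 5 * k) has_sum (1 / (1 - x ^ 5))) UNIV"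
    using geo[OF x5] by (simp add: o_def power_mult)
  then have "((\<lambda>k. x ^ k) has_sum (1 / (1 - x ^ 5))) (range (\<lambda>k. 5 * k))"
    by (subst has_sum_reindex) (auto simp: inj_on_def)
  with geo[OF x] have "((\<lambda>k. x ^ k) has_sum (1 / (1 - x) - 1 / (1 - x ^ 5))) (UNIV - range (\<lambda>k. 5 * k))"
    by (rule has_sum_Diff) auto
  moreover have "UNIV - range (\<lambda>k. 5 * k) = {k::nat. \<not> 5 dvd k}" by (auto simp: dvd_def)
  moreover have "1 / (1 - x) - 1 / (1 - x ^ 5) = (x + x ^ 2 + x ^ 3 + x ^ 4) / (1 - x ^ 5)"
  proof -
    have "1 - x \<noteq> 0" "1 - x ^ 5 \<noteq> 0" using x x5 by auto
    then show ?thesis by (simp add: divide_simps) (simp add: algebra_simps eval_nat_numeral)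
  qed
  ultimately show ?thesis by simp
qed

text \<open>Multiplying \<open>d\<close> by the full power of 5 in \<open>n\<close> absorbs the
  factor \<open>5^(3 e)\<close> and moves the condition to the codivisor. In this form the sum is a
  Dirichlet convolution, suited to a Lambert series.\<close>

lemma sigma_sharp_eq:
  assumes n: "n > 0"
  shows "sigma_sharp_3_5 n = (\<Sum>d | d dvd n \<and> \<not> 5 dvd n div d. d ^ 3)"
proof -
  define e where "e = multiplicity 5 n"
  have prime: "prime (5::nat)" by simp
  have e: "5 ^ e dvd n" by (simp add: e_def multiplicity_dvd)
  have e': "\<not> 5 ^ Suc e dvd n"
    using n by (simp add: e_def power_dvd_iff_le_multiplicity del: power_Suc)
  have "(\<Sum>d | d dvd n \<and> \<not> 5 dvd d. 5 ^ (3 * e) * d ^ 3) = (\<Sum>d | d dvd n \<and> \<not> 5 dvd n div d. d ^ 3)"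
  proof (rule sum.reindex_bij_witness[of _ "\<lambda>d. d div 5 ^ e" "\<lambda>d. 5 ^ e * d"])
    fix d assume "d \<in> {d. d dvd n \<and> \<not> 5 dvd d}"
    then have d: "d dvd n" "\<not> 5 dvd d" by auto
    show "5 ^ e * d div 5 ^ e = d" by simp
    have "coprime (5 ^ e) d" using d prime by (simp add: prime_imp_coprime)
    then have dv: "5 ^ e * d dvd n" using e d by (simp add: divides_mult)
    moreover have "\<not> 5 dvd n div (5 ^ e * d)"
    proof
      assume "5 dvd n div (5 ^ e * d)"
      then have "(5 ^ e * d) * 5 dvd (5 ^ e * d) * (n div (5 ^ e * d))" by (rule mult_dvd_mono[OF dvd_refl])
      then have "(5 ^ e * d) * 5 dvd n" using dv by simp
      moreover have "5 ^ Suc e dvd (5 ^ e * d) * 5" by simp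
      ultimately show False using e' dvd_trans by blast
    qed
    ultimately show "5 ^ e * d \<in> {d. d dvd n \<and> \<not> 5 dvd n div d}" by simp
    show "(5 ^ e * d) ^ 3 = 5 ^ (3 * e) * d ^ 3" by (simp add: power_mult_distrib power_mult[symmetric] mult.commute)
  next
    fix d assume "d \<in> {d. d dvd n \<and> \<not> 5 dvd n div d}"
    then have d: "d dvd n" "\<not> 5 dvd n div d" by auto
    have "coprime (5 ^ e) (n div d)" using d prime by (simp add: prime_imp_coprime)
    moreover have "5 ^ e dvd d * (n div d)" using e d by simp
    ultimately have ed: "5 ^ e dvd d" by (simp add: coprime_dvd_mult_left_iff)
    then show "5 ^ e * (d div 5 ^ e) = d" by simp
    have "d div 5 ^ e dvd n" using ed d by (metis dvd_mult_div_cancel dvd_trans dvd_triv_right)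
    moreover have "\<not> 5 dvd d div 5 ^ e"
    proof
      assume "5 dvd d div 5 ^ e"
      then have "5 ^ e * 5 dvd 5 ^ e * (d div 5 ^ e)" by (rule mult_dvd_mono[OF dvd_refl])
      then have "5 ^ Suc e dvd d" using ed by (simp add: mult.commute)
      then show False using e' d dvd_trans by blast
    qed
    ultimately show "d div 5 ^ e \<in> {d. d dvd n \<and> \<not> 5 dvd d}" by simp
  qed
  then show ?thesis by (simp add: sigma_sharp_3_5_def e_def sum_distrib_left)
qed

lemma norm_lambert_coeff_of_real:
  fixes r :: real
  assumes "0 \<le> r" "r < 1" "m > 0"
  shows "norm (lambert_coeff (of_real r) k m) = of_nat m ^ k / (1 - r ^ m)"
proof -
  have "r ^ m \<le> r ^ 1" using assms by (intro power_decreasing) auto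
  then have "r ^ m < 1" using assms by simp
  have "lambert_coeff (of_real r) k m = of_real (of_nat m ^ k / (1 - r ^ m))"
    using assms by (simp add: lambert_coeff_def)
  then show ?thesis using \<open>r ^ m < 1\<close> by (simp only: norm_of_real) simp
qed

text \<open>The family \<open>m^3 q^(m k)\<close> over \<open>m > 0\<close> and \<open>k\<close>
  prime to 5 is summed twice: over \<open>k\<close> first, it gives Lambert coefficients; grouped by
  \<open>n = m k\<close>, it gives the divisor sums.\<close>

lemma sums_sigma_sharp:
  fixes q :: complex
  assumes q: "norm q < 1"
  defines "p \<equiv> q ^ 5"
  shows "(\<lambda>n. of_nat (sigma_sharp_3_5 (Suc n)) * q ^ Suc n) sums
    (lambert p 3 q + lambert p 3 (q ^ 4) + lambert p 3 (q ^ 2) + lambert p 3 (q ^ 3))"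
proof -
  define f where "f = (\<lambda>(m, k). of_nat m ^ 3 * (q ^ m) ^ k)"
  define A where "A = {m::nat. m > 0} \<times> {k::nat. \<not> 5 dvd k}"
  define r where "r = norm q"
  have r: "0 \<le> r" "r < 1" using q by (simp_all add: r_def)
  have rm: "r ^ m < 1" if "m > 0" for m using power_less_one_iff[of r m] r that by simp
  have "(\<lambda>(m, k). of_nat m ^ 3 * (r ^ m) ^ k) summable_on A"
    unfolding A_def
  proof (rule summable_on_SigmaI)
    fix m :: nat assume m: "m \<in> {m. m > 0}"
    have "((\<lambda>k. (r ^ m) ^ k) has_sum ((r ^ m + (r ^ m) ^ 2 + (r ^ m) ^ 3 + (r ^ m) ^ 4) / (1 - (r ^ m) ^ 5))) {k. \<not> 5 dvd k}"
      by (rule has_sum_power_not_dvd_5) (use rm[of m] m r in auto)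
    then show "((\<lambda>k. case (m, k) of (m, k) \<Rightarrow> of_nat m ^ 3 * (r ^ m) ^ k) has_sum
      of_nat m ^ 3 * ((r ^ m + (r ^ m) ^ 2 + (r ^ m) ^ 3 + (r ^ m) ^ 4) / (1 - (r ^ m) ^ 5))) {k. \<not> 5 dvd k}"
      unfolding prod.case by (rule has_sum_cmult_right)
  next
    define R where "R = complex_of_real r"
    have R: "norm R < 1" "norm (R ^ 5) < 1" using r power_less_one_iff[of r 5] by (simp_all add: R_def norm_power)
    have sm: "(\<lambda>m. norm (lambert_coeff (R ^ 5) 3 m * (R ^ i) ^ m)) summable_on {m. m > 0}" if "i > 0" for i
    proof -
      have i: "norm (R ^ i) < 1" using r rm[OF that] by (simp add: R_def norm_power)
      \<comment> \<open>Convergence at the larger radius \<open>t\<close> yields absolute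
        convergence at \<open>R ^ i\<close>.\<close>
      obtain t where t: "norm (R ^ i) < t" "t < 1" using dense i by blast
      then have t0: "0 < t" using norm_ge_zero order_le_less_trans by blast
      have "summable (\<lambda>m. lambert_coeff (R ^ 5) 3 m * (of_real t) ^ m)"
        by (rule summable_lambert[OF R(2)]) (use t t0 in auto)
      then have "summable (\<lambda>m. norm (lambert_coeff (R ^ 5) 3 m * (R ^ i) ^ m))"
        by (rule powser_insidea) (use t t0 in auto)
      then have "(\<lambda>m. norm (lambert_coeff (R ^ 5) 3 m * (R ^ i) ^ m)) summable_on UNIV"
        by (subst summable_on_UNIV_nonneg_real_iff) auto
      then show ?thesis by (rule summable_on_subset) auto
    qed
    have "(\<lambda>m. norm (lambert_coeff (R ^ 5) 3 m * (R ^ 1) ^ m) + norm (lambert_coeff (R ^ 5) 3 m * (R ^ 2) ^ m)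
       + norm (lambert_coeff (R ^ 5) 3 m * (R ^ 3) ^ m) + norm (lambert_coeff (R ^ 5) 3 m * (R ^ 4) ^ m)) summable_on {m. m > 0}"
      by (intro summable_on_add sm) auto
    moreover have "norm (lambert_coeff (R ^ 5) 3 m * (R ^ 1) ^ m) + norm (lambert_coeff (R ^ 5) 3 m * (R ^ 2) ^ m)
       + norm (lambert_coeff (R ^ 5) 3 m * (R ^ 3) ^ m) + norm (lambert_coeff (R ^ 5) 3 m * (R ^ 4) ^ m) =
      of_nat m ^ 3 * ((r ^ m + (r ^ m) ^ 2 + (r ^ m) ^ 3 + (r ^ m) ^ 4) / (1 - (r ^ m) ^ 5))" if m: "m \<in> {m. m > 0}" for m
    proof -
      have n: "norm (lambert_coeff (R ^ 5) 3 m) = of_nat m ^ 3 / (1 - (r ^ 5) ^ m)"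
        using norm_lambert_coeff_of_real[of "r ^ 5" m 3] r m rm[of 5] by (simp add: R_def)
      have pw: "norm ((R ^ i) ^ m) = (r ^ m) ^ i" for i
        using r by (simp add: R_def norm_power power_mult[symmetric] mult.commute)
      have "(r ^ 5) ^ m = (r ^ m) ^ 5" by (simp add: power_mult[symmetric] mult.commute)
      then show ?thesis unfolding norm_mult n pw by (simp add: add_divide_distrib algebra_simps)
    qed
    ultimately show "(\<lambda>m. of_nat m ^ 3 * ((r ^ m + (r ^ m) ^ 2 + (r ^ m) ^ 3 + (r ^ m) ^ 4) / (1 - (r ^ m) ^ 5))) summable_on {m::nat. m > 0}"
      by (rule summable_on_cong[THEN iffD1, rotated])
  qed (use r in auto)
  moreover have "norm (f x) = (case x of (m, k) \<Rightarrow> of_nat m ^ 3 * (r ^ m) ^ k)" for x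
    by (cases x) (simp add: f_def r_def norm_mult norm_power)
  ultimately have "(\<lambda>x. norm (f x)) summable_on A" by simp
  then have "f summable_on A" by (rule abs_summable_summable)
  then obtain S where S: "(f has_sum S) A" by (auto simp: summable_on_def)
  have p: "norm p < 1" using norm_power_less_one[OF q, of 5] by (simp add: p_def)
  have lam: "((\<lambda>m. lambert_coeff p 3 m * x ^ m) has_sum lambert p 3 x) {m. m > 0}" if x: "norm x < 1" for x
  proof -
    obtain t where t: "norm x < t" "t < 1" using dense x by blast
    then have t0: "0 < t" using norm_ge_zero order_le_less_trans by blast
    have "summable (\<lambda>m. lambert_coeff p 3 m * (of_real t) ^ m)"
      by (rule summable_lambert[OF p]) (use t t0 in auto)
    then have "summable (\<lambda>m. norm (lambert_coeff p 3 m * x ^ m))"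
      by (rule powser_insidea) (use t t0 in auto)
    then have "((\<lambda>m. lambert_coeff p 3 m * x ^ m) has_sum lambert p 3 x) UNIV"
      by (rule norm_summable_imp_has_sum) (use summable_lambert[OF p x] in \<open>simp add: lambert_def summable_sums\<close>)
    then show ?thesis
      by (rule has_sum_cong_neutral[THEN iffD1, rotated -1]) (auto simp: lambert_coeff_def)
  qed
  have "((\<lambda>m. lambert_coeff p 3 m * q ^ m + lambert_coeff p 3 m * (q ^ 4) ^ m + lambert_coeff p 3 m * (q ^ 2) ^ m
      + lambert_coeff p 3 m * (q ^ 3) ^ m) has_sum
      (lambert p 3 q + lambert p 3 (q ^ 4) + lambert p 3 (q ^ 2) + lambert p 3 (q ^ 3))) {m. m > 0}"
    by (intro has_sum_add lam q norm_power_less_one[OF q]) auto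
  moreover have "((\<lambda>m. lambert_coeff p 3 m * q ^ m + lambert_coeff p 3 m * (q ^ 4) ^ m + lambert_coeff p 3 m * (q ^ 2) ^ m
      + lambert_coeff p 3 m * (q ^ 3) ^ m) has_sum S) {m. m > 0}"
  proof (rule has_sum_SigmaD[OF S[unfolded A_def]])
    fix m :: nat assume m: "m \<in> {m. m > 0}"
    have "((\<lambda>k. (q ^ m) ^ k) has_sum ((q ^ m + (q ^ m) ^ 2 + (q ^ m) ^ 3 + (q ^ m) ^ 4) / (1 - (q ^ m) ^ 5))) {k. \<not> 5 dvd k}"
      by (rule has_sum_power_not_dvd_5) (use norm_power_less_one[OF q, of m] m in auto)
    then have "((\<lambda>k. f (m, k)) has_sum of_nat m ^ 3 * ((q ^ m + (q ^ m) ^ 2 + (q ^ m) ^ 3 + (q ^ m) ^ 4) / (1 - (q ^ m) ^ 5))) {k. \<not> 5 dvd k}"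
      unfolding f_def prod.case by (rule has_sum_cmult_right)
    moreover have "p ^ m = (q ^ m) ^ 5" "(q ^ i) ^ m = (q ^ m) ^ i" for i
      by (simp_all add: p_def power_mult[symmetric] mult.commute)
    ultimately show "((\<lambda>k. f (m, k)) has_sum lambert_coeff p 3 m * q ^ m + lambert_coeff p 3 m * (q ^ 4) ^ m
        + lambert_coeff p 3 m * (q ^ 2) ^ m + lambert_coeff p 3 m * (q ^ 3) ^ m) {k. \<not> 5 dvd k}"
      using m by (simp add: lambert_coeff_def add_divide_distrib algebra_simps)
  qed
  ultimately have S_eq: "S = lambert p 3 q + lambert p 3 (q ^ 4) + lambert p 3 (q ^ 2) + lambert p 3 (q ^ 3)"
    using has_sum_unique by blast
  define B where "B = (SIGMA n:{n::nat. n > 0}. {d. d dvd n \<and> \<not> 5 dvd n div d})"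
  have "(f has_sum S) A \<longleftrightarrow> ((\<lambda>(n, d). of_nat d ^ 3 * q ^ n) has_sum S) B"
  proof (rule has_sum_reindex_bij_witness[of _ "\<lambda>(n, d). (d, n div d)" "\<lambda>(m, k). (m * k, m)"])
    fix a assume "a \<in> A"
    then obtain m k where a: "a = (m, k)" "m > 0" "\<not> 5 dvd k" by (auto simp: A_def)
    have "k > 0" using a by (cases k) auto
    then show "(case a of (m, k) \<Rightarrow> (m * k, m)) \<in> B" using a by (auto simp: B_def)
    show "(case case a of (m, k) \<Rightarrow> (m * k, m) of (n, d) \<Rightarrow> (d, n div d)) = a" using a by simp
    show "(case case a of (m, k) \<Rightarrow> (m * k, m) of (n, d) \<Rightarrow> of_nat d ^ 3 * q ^ n) = f a"
      using a by (simp add: f_def power_mult)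
  next
    fix b assume "b \<in> B"
    then obtain n d where b: "b = (n, d)" "n > 0" "d dvd n" "\<not> 5 dvd n div d" by (auto simp: B_def)
    show "(case case b of (n, d) \<Rightarrow> (d, n div d) of (m, k) \<Rightarrow> (m * k, m)) = b" using b by simp
    show "(case b of (n, d) \<Rightarrow> (d, n div d)) \<in> A" using b by (auto simp: A_def intro: dvd_pos_nat)
  qed simp
  with S have "((\<lambda>(n, d). of_nat d ^ 3 * q ^ n) has_sum S) B" by simp
  then have "((\<lambda>n. of_nat (sigma_sharp_3_5 n) * q ^ n) has_sum S) {n. n > 0}"
    unfolding B_def
  proof (rule has_sum_SigmaD)
    fix n :: nat assume n: "n \<in> {n. n > 0}"
    then have "finite {d. d dvd n \<and> \<not> 5 dvd n div d}" by simp
    moreover have "of_nat (sigma_sharp_3_5 n) * q ^ n = (\<Sum>d | d dvd n \<and> \<not> 5 dvd n div d. of_nat d ^ 3 * q ^ n)"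
      using n by (simp add: sigma_sharp_eq sum_distrib_right)
    ultimately show "((\<lambda>d. case (n, d) of (n, d) \<Rightarrow> of_nat d ^ 3 * q ^ n) has_sum of_nat (sigma_sharp_3_5 n) * q ^ n)
        {d. d dvd n \<and> \<not> 5 dvd n div d}"
      by (intro has_sum_finiteI) auto
  qed
  also have "{n::nat. n > 0} = range Suc" by (auto simp: image_iff gr0_conv_Suc)
  finally have "((\<lambda>n. of_nat (sigma_sharp_3_5 (Suc n)) * q ^ Suc n) has_sum S) UNIV"
    by (subst (asm) has_sum_reindex) (auto simp: o_def)
  then show ?thesis unfolding S_eq by (rule has_sum_imp_sums)
qed

subsection \<open>Bead sets of partitions\<close>

definition part :: "nat list \<Rightarrow> nat \<Rightarrow> nat" where
  "part p i = (if i < length p then p ! i else 0)"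

definition conj_part :: "nat list \<Rightarrow> nat \<Rightarrow> nat" where
  "conj_part p j = card {i. j < part p i}"

text \<open>Beta-numbers with infinitely many trailing zero parts, so no number of parts has to be
  chosen. The empty partition has exactly the negative integers as beads.\<close>

definition bead :: "nat list \<Rightarrow> nat \<Rightarrow> int" where
  "bead p i = int (part p i) - int i - 1"

definition beads :: "nat list \<Rightarrow> int set" where
  "beads p = range (bead p)"

lemma part_antimono:
  assumes "is_partition p" "i \<le> j"
  shows "part p j \<le> part p i"
proof (cases "i = j")
  case False
  with assms(2) have "i < j" by simp
  with assms(1) show ?thesis
    by (auto simp: part_def is_partition_def sorted_wrt_iff_nth_less)
qed simp

lemma bead_strict_antimono:
  assumes "is_partition p" "i < j"
  shows "bead p j < bead p i"
  using part_antimono[OF assms(1), of i j] assms(2) by (simp add: bead_def)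

lemma less_part_iff:
  assumes p: "is_partition p"
  shows "j < part p i \<longleftrightarrow> i < conj_part p j"
proof -
  have "\<exists>n. {i. j < part p i} = {..<n}"
  proof -
    define n where "n = (LEAST i. \<not> j < part p i)"
    have "\<not> j < part p (length p)" by (simp add: part_def)
    then have n: "\<not> j < part p n" unfolding n_def by (rule LeastI)
    have "j < part p i" if "i < n" for i using not_less_Least that unfolding n_def by blast
    moreover have "i < n" if "j < part p i" for i
    proof (rule ccontr)
      assume "\<not> i < n"
      then have "part p i \<le> part p n" by (intro part_antimono p) simp
      with n that show False by simp
    qed
    ultimately show ?thesis by (intro exI[of _ n]) auto
  qed
  then obtain n where n: "{i. j < part p i} = {..<n}" by blast
  then have "conj_part p j = n" by (simp add: conj_part_def)
  with n show ?thesis by (metis lessThan_iff mem_Collect_eq)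
qed

text \<open>By \<open>less_part_iff\<close>, bead \<open>i\<close> lies strictly above this number
  if \<open>j < part p i\<close> and strictly below it otherwise. Together with
  \<open>notin_beads_imp_gap\<close>, these numbers are exactly the gaps: the beads of the conjugate
  partition, reflected.\<close>

lemma gap_notin_beads:
  assumes p: "is_partition p"
  shows "int j - int (conj_part p j) \<notin> beads p"
proof
  assume "int j - int (conj_part p j) \<in> beads p"
  then obtain i where i: "int j - int (conj_part p j) = int (part p i) - int i - 1"
    by (auto simp: beads_def bead_def)
  show False
    using i less_part_iff[OF p, of j i] by (cases "j < part p i") linarith+
qed

lemma notin_beads_imp_gap:
  assumes p: "is_partition p" and r: "r \<notin> beads p"
  shows "\<exists>j. r = int j - int (conj_part p j)"
proof -
  \<comment> \<open>\<open>i\<close> counts the beads above the gap \<open>r\<close>, which will be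
    the length of the column sought; hence \<open>j = r + i\<close>.\<close>
  define i where "i = (LEAST i. bead p i < r)"
  have "bead p (length p + nat \<bar>r\<bar>) < r" by (simp add: bead_def part_def)
  then have i: "bead p i < r" unfolding i_def by (rule LeastI)
  have before: "r < bead p k" if "k < i" for k
    using not_less_Least[OF that[unfolded i_def]] r by (force simp: beads_def)
  have nn: "0 \<le> r + int i" using i by (simp add: bead_def)
  define j where "j = nat (r + int i)"
  have j: "int j = r + int i" using nn by (simp add: j_def)
  have "\<not> j < part p i" using i j by (simp add: bead_def)
  then have 1: "conj_part p j \<le> i" using less_part_iff[OF p] by (simp add: not_less)
  have "i \<le> conj_part p j"
  proof (cases i)
    case (Suc k)
    then have "j < part p k" using before[of k] j by (simp add: bead_def)
    then show ?thesis using less_part_iff[OF p] Suc by simp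
  qed simp
  with 1 j show ?thesis by (intro exI[of _ j]) simp
qed

lemma mem_cells_iff: "(i, j) \<in> cells p \<longleftrightarrow> j < part p i"
  by (auto simp: cells_def part_def)

text \<open>Arm plus leg plus 1 is the distance from the bead of row \<open>i\<close> down to the
  gap of column \<open>j\<close>.\<close>

lemma hook_number_eq:
  assumes p: "is_partition p" and c: "(i, j) \<in> cells p"
  shows "int (hook_number p (i, j)) = bead p i - (int j - int (conj_part p j))"
proof -
  have ij: "j < part p i" "i < conj_part p j" using c less_part_iff[OF p] by (simp_all add: mem_cells_iff)
  have "{j'. j < j' \<and> (i, j') \<in> cells p} = {j<..<part p i}" by (auto simp: mem_cells_iff)
  then have arm: "arm p (i, j) = part p i - j - 1" by (simp add: arm_def)
  have "{i'. i < i' \<and> (i', j) \<in> cells p} = {i<..<conj_part p j}"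
    using less_part_iff[OF p] by (auto simp: mem_cells_iff)
  then have "leg p (i, j) = conj_part p j - i - 1" by (simp add: leg_def)
  with arm ij show ?thesis by (simp add: hook_number_def bead_def)
qed

text \<open>A bead with a gap \<open>t\<close> places below is a hook of length exactly
  \<open>t\<close>. Conversely, closure under one step of size \<open>t\<close> gives closure under
  \<open>m\<close> steps, which excludes all multiples.\<close>

lemma is_core_iff_beads:
  assumes p: "is_partition p" and t: "t > 0"
  shows "is_core t p \<longleftrightarrow> (\<forall>s\<in>beads p. s - int t \<in> beads p)"
proof
  assume core: "is_core t p"
  show "\<forall>s\<in>beads p. s - int t \<in> beads p"
  proof (intro ballI, rule ccontr)
    fix s assume "s \<in> beads p" "s - int t \<notin> beads p"
    moreover from this obtain j where "s - int t = int j - int (conj_part p j)"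
      using notin_beads_imp_gap[OF p] by blast
    ultimately obtain i j where ij: "s = bead p i" "s - int t = int j - int (conj_part p j)"
      by (auto simp: beads_def)
    have "j < part p i"
    proof (rule ccontr)
      assume "\<not> j < part p i"
      moreover from this have "conj_part p j \<le> i" using less_part_iff[OF p, of j i] by simp
      ultimately show False using ij t by (simp add: bead_def)
    qed
    then have c: "(i, j) \<in> cells p" by (simp add: mem_cells_iff)
    have "int (hook_number p (i, j)) = int t" using hook_number_eq[OF p c] ij by simp
    then have "hook_number p (i, j) = t" by simp
    with core c show False by (auto simp: is_core_def)
  qed
next
  assume closed: "\<forall>s\<in>beads p. s - int t \<in> beads p"
  have down: "s - int t * int m \<in> beads p" if "s \<in> beads p" for s m
  proof (induction m)
    case (Suc m)
    then have "s - int t * int m - int t \<in> beads p" using closed by blast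
    then show ?case by (simp add: algebra_simps)
  qed (use that in simp)
  show "is_core t p"
    unfolding is_core_def
  proof (intro ballI notI)
    fix c assume c: "c \<in> cells p" "t dvd hook_number p c"
    obtain i j where ij: "c = (i, j)" by (cases c)
    obtain m where m: "hook_number p (i, j) = t * m" using c ij by (auto elim: dvdE)
    have "bead p i - int t * int m = int j - int (conj_part p j)"
      using hook_number_eq[OF p, of i j] c ij m by simp
    moreover have "bead p i - int t * int m \<in> beads p" by (rule down) (simp add: beads_def)
    ultimately show False using gap_notin_beads[OF p] by simp
  qed
qed

text \<open>Two strictly decreasing enumerations of one set agree.\<close>

lemma bead_eqI:
  assumes p: "is_partition p" and p': "is_partition p'" and eq: "beads p = beads p'"
  shows "bead p i = bead p' i"
proof (induction i rule: less_induct)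
  case (less i)
  have le: "bead b i \<le> bead a i"
    if a: "is_partition a" and b: "is_partition b" and ab: "beads a = beads b" and IH: "\<And>k. k < i \<Longrightarrow> bead a k = bead b k" for a b
  proof -
    have "bead b i \<in> beads a" using ab by (simp add: beads_def)
    then obtain k where k: "bead b i = bead a k" by (auto simp: beads_def)
    have "\<not> k < i"
    proof
      assume "k < i"
      then have "bead a k = bead b k" by (rule IH)
      with k bead_strict_antimono[OF b \<open>k < i\<close>] show False by simp
    qed
    then show ?thesis using k bead_strict_antimono[OF a, of i k] by (cases "k = i") auto
  qed
  show ?case
    using le[OF p p' eq] le[OF p' p eq[symmetric]] less by (intro antisym) auto
qed

lemma beads_inj:
  assumes p: "is_partition p" and p': "is_partition p'" and eq: "beads p = beads p'"
  shows "p = p'"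
proof -
  have part: "part p i = part p' i" for i
    using bead_eqI[OF assms, of i] by (simp add: bead_def)
  have len: "length a \<le> length b"
    if "is_partition a" "\<And>i. part a i = part b i" for a b
  proof (rule ccontr)
    assume "\<not> length a \<le> length b"
    then have l: "length b < length a" by simp
    then have "part b (length b) = a ! length b" using that(2)[of "length b"] by (simp add: part_def)
    moreover have "0 < a ! length b" using that(1) l by (simp add: is_partition_def)
    ultimately show False by (simp add: part_def)
  qed
  have "length p = length p'" using len[OF p] len[OF p'] part by (simp add: antisym)
  then show ?thesis using part by (intro nth_equalityI) (auto simp: part_def split: if_splits, metis)
qed

text \<open>Having as many beads at or above \<open>- N\<close> as the empty partition is the
  balance condition that makes a set come from a partition. The part of row \<open>i\<close> is
  recovered from the \<open>i\<close>-th largest bead as \<open>l ! i + i + 1\<close>.\<close>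

lemma exists_partition_beads:
  assumes fin: "finite S" and card: "card S = N" and ge: "\<And>s. s \<in> S \<Longrightarrow> - int N \<le> s"
  shows "\<exists>p. is_partition p \<and> length p \<le> N \<and> beads p = S \<union> {s. s < - int N}"
proof -
  define l where "l = rev (sorted_list_of_set S)"
  have len: "length l = N" and set: "set l = S" using fin card by (simp_all add: l_def)
  have dec: "l ! j < l ! i" if "i < j" "j < N" for i j
  proof -
    have "sorted_wrt (<) (sorted_list_of_set S)" by simp
    then have "sorted_wrt (>) l" by (simp add: l_def sorted_wrt_rev)
    with that len show ?thesis by (simp add: sorted_wrt_iff_nth_less)
  qed
  \<comment> \<open>Descending from the last entry, this ensures that \<open>nat\<close> in the
    definition of \<open>g\<close> truncates nothing.\<close>
  have lower: "- int i - 1 \<le> l ! i" if "i < N" for i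
    using that
  proof (induction "N - 1 - i" arbitrary: i)
    case 0
    then have "i = N - 1" by simp
    moreover have "l ! i \<in> S" using 0 set len by auto
    ultimately show ?case using ge[of "l ! i"] 0 by simp
  next
    case (Suc k)
    then have "- int (Suc i) - 1 \<le> l ! Suc i" by (intro Suc(1)) auto
    moreover have "l ! Suc i < l ! i" using Suc by (intro dec) auto
    ultimately show ?case by simp
  qed
  define g where "g = (\<lambda>i. if i < N then nat (l ! i + int i + 1) else 0)"
  have g_int: "int (g i) = l ! i + int i + 1" if "i < N" for i
    using lower[OF that] that by (simp add: g_def)
  have g_anti: "g j \<le> g i" if "i \<le> j" for i j
  proof (cases "j < N")
    case True
    have "l ! j + int j \<le> l ! i + int i" using that True
    proof (induction j rule: dec_induct)
      case (step k)
      then show ?case using dec[of k "Suc k"] by simp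
    qed simp
    then show ?thesis using g_int[of i] g_int[of j] True that by simp
  qed (simp add: g_def)
  \<comment> \<open>Trailing zeros are cut off, since the parts of a partition are positive.\<close>
  define L where "L = (LEAST i. g i = 0)"
  have "g N = 0" by (simp add: g_def)
  then have L: "g L = 0" "L \<le> N" unfolding L_def by (rule LeastI, rule Least_le)
  have pos: "0 < g i" if "i < L" for i using not_less_Least[OF that[unfolded L_def]] by simp
  have zero: "g i = 0" if "L \<le> i" for i using g_anti[OF that] L by simp
  define p where "p = map g [0..<L]"
  have part: "part p i = g i" for i using zero by (simp add: part_def p_def)
  have p: "is_partition p"
    using pos g_anti by (auto simp: is_partition_def p_def sorted_wrt_map sorted_wrt_iff_nth_less)
  have "beads p = S \<union> {s. s < - int N}"
  proof (intro equalityI subsetI)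
    fix s assume "s \<in> beads p"
    then obtain i where i: "s = int (g i) - int i - 1" by (auto simp: beads_def bead_def part)
    show "s \<in> S \<union> {s. s < - int N}"
    proof (cases "i < N")
      case True
      then have "s = l ! i" using i g_int by simp
      then show ?thesis using True set len by auto
    qed (use i in \<open>simp add: g_def\<close>)
  next
    fix s assume "s \<in> S \<union> {s. s < - int N}"
    then consider "s \<in> S" | "s < - int N" by blast
    then show "s \<in> beads p"
    proof cases
      case 1
      then obtain i where "i < N" "s = l ! i" using set len by (metis in_set_conv_nth)
      then have "s = bead p i" using g_int by (simp add: bead_def part)
      then show ?thesis by (simp add: beads_def)
    next
      case 2
      then have "s = bead p (nat (- s - 1))" by (simp add: bead_def part g_def)
      then show ?thesis by (simp add: beads_def)
    qed
  qed
  with p L show ?thesis by (intro exI[of _ p]) (simp add: p_def)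
qed

section \<open>Cores as charge vectors on the abacus\<close>

definition charge_vectors :: "nat \<Rightarrow> (nat \<Rightarrow> int) set" where
  "charge_vectors t = {c \<in> {..<t} \<rightarrow>\<^sub>E UNIV. (\<Sum>i<t. c i) = 0}"

text \<open>The size of the core with charges \<open>c\<close>. On vectors of sum 0 it is the
  quadratic form \<open>t/2\<close> times the sum of \<open>c_i^2\<close>, plus the sum of
  \<open>i c_i\<close>.\<close>

definition charge_energy :: "nat \<Rightarrow> (nat \<Rightarrow> int) \<Rightarrow> int" where
  "charge_energy t c = (\<Sum>i<t. int t * tri (c i) + int i * c i)"

text \<open>On the abacus with \<open>t\<close> runners, runner \<open>i\<close> is filled exactly below position \<open>c i\<close>.\<close>

definition core_beads :: "nat \<Rightarrow> (nat \<Rightarrow> int) \<Rightarrow> int set" where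
  "core_beads t c = {s. s div int t < c (nat (s mod int t))}"

lemma runner_div_mod:
  assumes "i < t"
  shows "(int t * k + int i) div int t = k" "(int t * k + int i) mod int t = int i"
  using assms by (simp_all add: div_pos_pos_trivial)

lemma mem_core_beads:
  assumes "i < t"
  shows "int t * k + int i \<in> core_beads t c \<longleftrightarrow> k < c i"
  unfolding core_beads_def mem_Collect_eq runner_div_mod[OF assms] by simp

lemma core_beads_inj:
  assumes c: "c \<in> {..<t} \<rightarrow>\<^sub>E UNIV" and d: "d \<in> {..<t} \<rightarrow>\<^sub>E UNIV" and eq: "core_beads t c = core_beads t d"
  shows "c = d"
proof (rule PiE_ext[OF c d])
  fix i assume "i \<in> {..<t}"
  then have "k < c i \<longleftrightarrow> k < d i" for k
    using mem_core_beads[of i t k c] mem_core_beads[of i t k d] eq by simp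
  from this[of "c i"] this[of "d i"] show "c i = d i" by simp
qed

lemma sum_int_atLeastLessThan:
  fixes a b :: int
  assumes "a \<le> b"
  shows "(\<Sum>k\<in>{a..<b}. k) = tri b - tri a"
  using assms
proof (induction b rule: int_ge_induct)
  case (step b)
  then have "{a..<b + 1} = insert b {a..<b}" by auto
  then show ?case using step by (simp add: tri_add1)
qed simp

text \<open>Cutting at \<open>- t M\<close> cuts every runner at \<open>- M\<close>, leaving
  \<open>t\<close> intervals. Their cardinality measures the total charge and the sum of their beads
  the energy, up to terms in \<open>t\<close> and \<open>M\<close> alone.\<close>

lemma core_beads_truncate:
  assumes t: "t > 0" and M: "\<And>i. i < t \<Longrightarrow> - int M \<le> c i"
  defines "S \<equiv> {s \<in> core_beads t c. - int (t * M) \<le> s}"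
  shows "finite S"
    and "int (card S) = (\<Sum>i<t. c i) + int (t * M)"
    and "\<Sum>S = charge_energy t c + (\<Sum>i<t. int i * int M - int t * tri (- int M))"
proof -
  define f where "f = (\<lambda>(i, k). int t * k + int i)"
  define X where "X = (SIGMA i:{..<t}. {- int M..<c i})"
  have finX: "finite X" by (simp add: X_def)
  have inj: "inj_on f X"
  proof (rule inj_onI)
    fix x y assume xy: "x \<in> X" "y \<in> X" "f x = f y"
    obtain i k j l where ij: "x = (i, k)" "y = (j, l)" "i < t" "j < t"
      using xy(1,2) by (auto simp: X_def)
    have "int t * k + int i = int t * l + int j" using xy(3) ij by (simp add: f_def)
    then have "k = l" "int i = int j"
      using runner_div_mod[OF ij(3), of k] runner_div_mod[OF ij(4), of l] by metis+
    then show "x = y" using ij by simp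
  qed
  have img: "S = f ` X"
  proof (intro equalityI subsetI)
    fix s assume s: "s \<in> S"
    define i k where "i = nat (s mod int t)" and "k = s div int t"
    have i: "i < t" "int i = s mod int t" using t by (simp_all add: i_def nat_less_iff)
    have sk: "s = int t * k + int i" by (simp add: i k_def)
    have "k < c i" using s by (simp add: S_def core_beads_def i_def k_def)
    moreover have "- int M \<le> k"
    proof (rule ccontr)
      assume "\<not> - int M \<le> k"
      then have "k \<le> - int M - 1" by simp
      then have "int t * k \<le> int t * (- int M - 1)" using t by (intro mult_left_mono) auto
      then have "s < - int (t * M)" using sk i by (simp add: algebra_simps)
      then show False using s by (simp add: S_def)
    qed
    ultimately have "(i, k) \<in> X" using i by (simp add: X_def)
    moreover have "f (i, k) = s" by (simp add: f_def sk)
    ultimately show "s \<in> f ` X" by blast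
  next
    fix s assume "s \<in> f ` X"
    then obtain i k where s: "s = int t * k + int i" "i < t" "- int M \<le> k" "k < c i"
      by (auto simp: f_def X_def)
    have "int t * (- int M) \<le> int t * k" using s by (intro mult_left_mono) auto
    then show "s \<in> S" using s mem_core_beads[of i t k c] by (simp add: S_def)
  qed
  show "finite S" unfolding img using finX by simp
  have "card S = (\<Sum>i<t. card {- int M..<c i})"
    unfolding img card_image[OF inj] by (simp add: X_def)
  also have "int \<dots> = (\<Sum>i<t. c i + int M)"
    unfolding of_nat_sum
  proof (rule sum.cong[OF refl])
    fix i assume "i \<in> {..<t}"
    then have "- int M \<le> c i" using M by simp
    then show "int (card {- int M..<c i}) = c i + int M" by simp
  qed
  finally show "int (card S) = (\<Sum>i<t. c i) + int (t * M)" by (simp add: sum.distrib)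
  have "\<Sum>S = (\<Sum>x\<in>X. f x)" unfolding img by (simp add: sum.reindex[OF inj])
  also have "\<dots> = (\<Sum>i<t. \<Sum>k\<in>{- int M..<c i}. int t * k + int i)"
    unfolding X_def f_def by (subst sum.Sigma) auto
  also have "\<dots> = (\<Sum>i<t. (int t * tri (c i) + int i * c i) + (int i * int M - int t * tri (- int M)))"
  proof (rule sum.cong[OF refl])
    fix i assume i: "i \<in> {..<t}"
    then have "- int M \<le> c i" using M by simp
    moreover from this have "(\<Sum>k\<in>{- int M..<c i}. int t * k) = int t * (tri (c i) - tri (- int M))"
      by (simp only: sum_distrib_left[symmetric] sum_int_atLeastLessThan)
    ultimately show "(\<Sum>k\<in>{- int M..<c i}. int t * k + int i) =
      (int t * tri (c i) + int i * c i) + (int i * int M - int t * tri (- int M))"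
      by (simp add: sum.distrib algebra_simps)
  qed
  finally show "\<Sum>S = charge_energy t c + (\<Sum>i<t. int i * int M - int t * tri (- int M))"
    by (simp add: sum.distrib charge_energy_def)
qed

lemma sum_list_eq_part:
  assumes "length p \<le> N"
  shows "sum_list p = (\<Sum>i<N. part p i)"
proof -
  have "sum_list p = (\<Sum>i<length p. part p i)"
    by (simp add: sum_list_sum_nth part_def atLeast0LessThan)
  also have "\<dots> = (\<Sum>i<N. part p i)"
    using assms by (intro sum.mono_neutral_left) (auto simp: part_def)
  finally show ?thesis .
qed

lemma sum_lessThan_int: "(\<Sum>i<n. int i) = tri (int n)"
proof (induction n)
  case (Suc n)
  then show ?case using tri_add1[of "int n"] by (simp add: add.commute)
qed (simp add: tri_def)

text \<open>The beads at or above \<open>- N\<close> are counted and summed twice: as the first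
  \<open>N\<close> beads of \<open>p\<close>, and runner by runner. The counts give the sum of the
  charges, the sums give the size.\<close>

lemma core_size:
  assumes t: "t > 0" and p: "is_partition p" and eq: "beads p = core_beads t c"
  shows "(\<Sum>i<t. c i) = 0" and "int (sum_list p) = charge_energy t c"
proof -
  \<comment> \<open>Large enough that \<open>- M\<close> lies below every charge and
    \<open>N = t M\<close> is at least the number of parts.\<close>
  define M where "M = length p + nat (\<Sum>i<t. \<bar>c i\<bar>)"
  define N where "N = t * M"
  have M: "- int M \<le> c i" if "i < t" for i
  proof -
    have "\<bar>c i\<bar> \<le> (\<Sum>i<t. \<bar>c i\<bar>)" using that by (intro member_le_sum) auto
    then show ?thesis by (simp add: M_def)
  qed
  have "M \<le> N" using t by (simp add: N_def)
  then have N: "length p \<le> N" by (simp add: M_def)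
  define S where "S = {s \<in> core_beads t c. - int (t * M) \<le> s}"
  note S = core_beads_truncate[OF t, of M c, OF M, folded S_def]
  have inj: "inj_on (bead p) {..<N}"
    using bead_strict_antimono[OF p] by (intro inj_onI) (metis less_irrefl linorder_neqE_nat)
  have S_img: "S = bead p ` {..<N}"
  proof (intro equalityI subsetI)
    fix s assume "s \<in> S"
    then obtain i where i: "s = bead p i" "- int N \<le> s" by (auto simp: S_def eq[symmetric] beads_def N_def)
    then have "i < N" using N by (cases "i < N") (auto simp: bead_def part_def)
    then show "s \<in> bead p ` {..<N}" using i by simp
  next
    fix s assume "s \<in> bead p ` {..<N}"
    then obtain i where "i < N" "s = bead p i" by auto
    moreover from this have "- int N \<le> s" by (simp add: bead_def)
    ultimately show "s \<in> S" by (simp add: S_def eq[symmetric] beads_def N_def)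
  qed
  have "card S = N" unfolding S_img by (simp add: card_image[OF inj])
  then show "(\<Sum>i<t. c i) = 0" using S(2) by (simp add: N_def)
  have "\<Sum>S = (\<Sum>i<N. int (part p i) - int i - 1)"
    unfolding S_img sum.reindex[OF inj] by (simp add: bead_def)
  also have "\<dots> = int (sum_list p) - tri (int N) - int N"
    by (simp add: sum_list_eq_part[OF N] sum_subtractf sum_lessThan_int)
  finally have "int (sum_list p) - tri (int N) - int N =
     charge_energy t c + (\<Sum>i<t. int i * int M - int t * tri (- int M))"
    using S(3) by simp
  also have "(\<Sum>i<t. int i * int M - int t * tri (- int M)) = tri (int t) * int M - int t * int t * tri (- int M)"
    by (simp add: sum_subtractf sum_distrib_right[symmetric] sum_lessThan_int)
  \<comment> \<open>Both sides are the sum of \<open>- N, ..., - 1\<close>, the contribution of the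
    empty partition.\<close>
  also have "\<dots> = - tri (int N) - int N"
  proof -
    have "2 * (tri (int t) * int M - int t * int t * tri (- int M)) =
       (2 * tri (int t)) * int M - int t * int t * (2 * tri (- int M))" by (simp add: algebra_simps)
    also have "\<dots> = - (2 * tri (int N)) - 2 * int N"
      unfolding two_tri N_def by (simp add: algebra_simps)
    finally show ?thesis by simp
  qed
  finally show "int (sum_list p) = charge_energy t c" by simp
qed

lemma core_beads_closed:
  assumes "t > 0" "s \<in> core_beads t c"
  shows "s - int t \<in> core_beads t c"
proof -
  have "(s - int t) mod int t = s mod int t" "(s - int t) div int t = s div int t - 1"
    using assms(1) div_add_self2[of "int t" "s - int t"] by simp_all
  then show ?thesis using assms(2) by (simp add: core_beads_def)
qed

lemma exists_core:
  assumes t: "t > 0" and c: "c \<in> charge_vectors t"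
  shows "\<exists>p. is_partition p \<and> is_core t p \<and> beads p = core_beads t c"
proof -
  define M where "M = nat (\<Sum>i<t. \<bar>c i\<bar>)"
  have M: "- int M \<le> c i" if "i < t" for i
  proof -
    have "\<bar>c i\<bar> \<le> (\<Sum>i<t. \<bar>c i\<bar>)" using that by (intro member_le_sum) auto
    then show ?thesis by (simp add: M_def)
  qed
  define S where "S = {s \<in> core_beads t c. - int (t * M) \<le> s}"
  note S = core_beads_truncate[OF t, of M c, OF M, folded S_def]
  have "card S = t * M" using S(2) c by (simp add: charge_vectors_def flip: of_nat_mult)
  then obtain p where p: "is_partition p" "beads p = S \<union> {s. s < - int (t * M)}"
    using exists_partition_beads[OF S(1), of "t * M"] by (auto simp: S_def)
  have "s \<in> core_beads t c" if "s < - int (t * M)" for s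
  proof -
    define i where "i = nat (s mod int t)"
    have i: "i < t" using t by (simp add: i_def nat_less_iff)
    have "s div int t < - int M"
    proof (rule ccontr)
      assume "\<not> s div int t < - int M"
      then have "int t * (- int M) \<le> int t * (s div int t)" by (intro mult_left_mono) auto
      moreover have "int t * (s div int t) \<le> s" using t by (simp add: minus_mod_eq_mult_div[symmetric])
      ultimately show False using that by simp
    qed
    then show ?thesis using M[OF i] by (simp add: core_beads_def i_def)
  qed
  then have "beads p = core_beads t c" using p(2) by (auto simp: S_def)
  then show ?thesis
    using p(1) is_core_iff_beads[OF p(1) t] core_beads_closed[OF t] by auto
qed

lemma down_closed_int_set:
  fixes K :: "int set"
  assumes down: "\<And>k. k \<in> K \<Longrightarrow> k - 1 \<in> K" and mem: "k0 \<in> K" and ub: "\<And>k. k \<in> K \<Longrightarrow> k \<le> u"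
  shows "\<exists>c. \<forall>k. k \<in> K \<longleftrightarrow> k < c"
proof -
  define m where "m = Max (K \<inter> {k0..u})"
  have fin: "finite (K \<inter> {k0..u})" by simp
  have "k0 \<in> K \<inter> {k0..u}" using mem ub by auto
  then have m: "m \<in> K \<inter> {k0..u}" unfolding m_def using fin Max_in by blast
  have below: "k \<in> K" if "k \<le> m" for k
    using that
  proof (induction k rule: int_le_induct)
    case base
    show ?case using m by simp
  next
    case (step i)
    then show ?case using down by blast
  qed
  have above: "k \<le> m" if "k \<in> K" for k
  proof (cases "k0 \<le> k")
    case True
    then have "k \<in> K \<inter> {k0..u}" using that ub by simp
    then show ?thesis unfolding m_def using fin by simp
  qed (use m in auto)
  show ?thesis using below above by (intro exI[of _ "m + 1"]) auto
qed

text \<open>Closure under subtracting \<open>t\<close> makes each runner down-closed. All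
  sufficiently negative integers are beads and bead 0 is the largest, so each runner is a half-line
  with one charge.\<close>

lemma core_imp_core_beads:
  assumes t: "t > 0" and p: "is_partition p" and core: "is_core t p"
  shows "\<exists>c\<in>charge_vectors t. beads p = core_beads t c"
proof -
  have closed: "s - int t \<in> beads p" if "s \<in> beads p" for s
    using is_core_iff_beads[OF p t] core that by blast
  have "\<exists>c. \<forall>k. int t * k + int i \<in> beads p \<longleftrightarrow> k < c" if i: "i < t" for i
  proof -
    have "\<exists>c. \<forall>k. k \<in> {k. int t * k + int i \<in> beads p} \<longleftrightarrow> k < c"
    proof (rule down_closed_int_set)
      fix k assume "k \<in> {k. int t * k + int i \<in> beads p}"
      then show "k - 1 \<in> {k. int t * k + int i \<in> beads p}"
        using closed[of "int t * k + int i"] by (simp add: algebra_simps)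
    next
      define k0 where "k0 = - int (length p) - 2"
      have "int t * k0 + int i < int t * (k0 + 1)" using i by (simp add: algebra_simps)
      moreover have "int t * (k0 + 1) \<le> 1 * (k0 + 1)" using t by (intro mult_right_mono_neg) (auto simp: k0_def)
      ultimately have "int t * k0 + int i < 1 * (k0 + 1)" by (rule order_less_le_trans)
      then have "int t * k0 + int i < - int (length p)" by (simp add: k0_def)
      then have "int t * k0 + int i = bead p (nat (- (int t * k0 + int i) - 1))"
        by (simp add: bead_def part_def)
      then show "k0 \<in> {k. int t * k + int i \<in> beads p}" by (auto simp: beads_def)
    next
      fix k assume "k \<in> {k. int t * k + int i \<in> beads p}"
      then obtain j where j: "int t * k + int i = bead p j" by (auto simp: beads_def)
      have "bead p j \<le> bead p 0" using bead_strict_antimono[OF p, of 0 j] by (cases "j = 0") auto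
      then have le: "int t * k \<le> int (part p 0)" using j by (simp add: bead_def)
      show "k \<le> int (part p 0)"
      proof (cases "k \<ge> 0")
        case True
        then have "1 * k \<le> int t * k" using t by (intro mult_right_mono) auto
        with le show ?thesis by simp
      qed simp
    qed
    then show ?thesis by simp
  qed
  then obtain c0 where c0: "\<And>i k. i < t \<Longrightarrow> int t * k + int i \<in> beads p \<longleftrightarrow> k < c0 i" by metis
  define c where "c = restrict c0 {..<t}"
  have "s \<in> beads p \<longleftrightarrow> s \<in> core_beads t c" for s
  proof -
    define i k where "i = nat (s mod int t)" and "k = s div int t"
    have i: "i < t" "int i = s mod int t" using t by (simp_all add: i_def nat_less_iff)
    have "s = int t * k + int i" by (simp add: i k_def)
    then show ?thesis using c0[OF i(1), of k] mem_core_beads[OF i(1), of k c] i(1) by (simp add: c_def)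
  qed
  then have eq: "beads p = core_beads t c" by blast
  moreover have "c \<in> charge_vectors t"
    using core_size(1)[OF t p eq] by (simp add: charge_vectors_def c_def)
  ultimately show ?thesis by blast
qed

lemma has_sum_cores_iff:
  fixes q :: complex
  assumes t: "t > 0"
  shows "((\<lambda>p. q ^ sum_list p) has_sum S) {p. is_partition p \<and> is_core t p} \<longleftrightarrow>
    ((\<lambda>c. q powi charge_energy t c) has_sum S) (charge_vectors t)"
proof -
  define \<phi> where "\<phi> = (\<lambda>c. SOME p. is_partition p \<and> is_core t p \<and> beads p = core_beads t c)"
  have \<phi>: "is_partition (\<phi> c)" "is_core t (\<phi> c)" "beads (\<phi> c) = core_beads t c" if "c \<in> charge_vectors t" for c
    using someI_ex[OF exists_core[OF t that]] by (simp_all add: \<phi>_def)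
  have "bij_betw \<phi> (charge_vectors t) {p. is_partition p \<and> is_core t p}"
    unfolding bij_betw_def
  proof (intro conjI inj_onI equalityI subsetI)
    fix c d assume cd: "c \<in> charge_vectors t" "d \<in> charge_vectors t" "\<phi> c = \<phi> d"
    then have "core_beads t c = core_beads t d" using \<phi>(3) by metis
    then show "c = d" using cd core_beads_inj by (auto simp: charge_vectors_def)
  next
    fix p assume "p \<in> \<phi> ` charge_vectors t"
    then show "p \<in> {p. is_partition p \<and> is_core t p}" using \<phi> by auto
  next
    fix p assume "p \<in> {p. is_partition p \<and> is_core t p}"
    then have p: "is_partition p" "is_core t p" by auto
    obtain c where c: "c \<in> charge_vectors t" "beads p = core_beads t c"
      using core_imp_core_beads[OF t p] by blast
    then have "\<phi> c = p" using beads_inj[OF \<phi>(1) p(1)] \<phi>(3) by metis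
    then show "p \<in> \<phi> ` charge_vectors t" using c by blast
  qed
  from has_sum_reindex_bij_betw[OF this, of "\<lambda>p. q ^ sum_list p" S]
  have "((\<lambda>p. q ^ sum_list p) has_sum S) {p. is_partition p \<and> is_core t p} \<longleftrightarrow>
     ((\<lambda>c. q ^ sum_list (\<phi> c)) has_sum S) (charge_vectors t)" by simp
  also have "\<dots> \<longleftrightarrow> ((\<lambda>c. q powi charge_energy t c) has_sum S) (charge_vectors t)"
  proof (rule has_sum_cong)
    fix c assume c: "c \<in> charge_vectors t"
    have "int (sum_list (\<phi> c)) = charge_energy t c" by (rule core_size(2)[OF t \<phi>(1,3)[OF c]])
    then show "q ^ sum_list (\<phi> c) = q powi charge_energy t c" by (simp flip: power_int_of_nat)
  qed
  finally show ?thesis .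
qed

subsection \<open>The generating function of cores\<close>

lemma sum_powers_root_of_unity:
  fixes k :: int
  assumes N: "N > 0"
  shows "(\<Sum>j<N. (cis (2 * pi / real N) ^ j) powi k) = (if int N dvd k then of_nat N else 0)"
proof -
  define w where "w = cis (2 * pi / real N) powi k"
  have w: "w = cis (of_int k * (2 * pi / real N))" by (simp add: w_def cis_power_int)
  have eq: "(cis (2 * pi / real N) ^ j) powi k = w ^ j" for j
    by (simp add: w_def power_int_power power_int_power' mult.commute)
  have wN: "w ^ N = 1"
  proof -
    have "w ^ N = cis (2 * pi * of_int k)" using N by (simp add: w Complex.DeMoivre field_simps)
    then show ?thesis by (simp add: cis_multiple_2pi)
  qed
  show ?thesis
  proof (cases "int N dvd k")
    case True
    then obtain m where m: "k = int N * m" by (auto elim: dvdE)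
    have "w = cis (2 * pi * of_int m)" using N by (simp add: w m field_simps)
    then have "w = 1" by (simp add: cis_multiple_2pi)
    then show ?thesis using True by (simp add: eq)
  next
    case False
    have "w \<noteq> 1"
    proof
      assume "w = 1"
      then have "cos (of_int k * (2 * pi / real N)) = 1" by (simp add: w complex_eq_iff)
      then obtain m :: int where "of_int k * (2 * pi / real N) = of_int m * 2 * pi"
        using cos_one_2pi_int by auto
      then have "real_of_int k = real_of_int (m * int N)" using N by (simp add: field_simps)
      then have "k = m * int N" by (simp only: of_int_eq_iff)
      then show False using False by simp
    qed
    moreover have "(w - 1) * (\<Sum>j<N. w ^ j) = w ^ N - 1" by (rule power_diff_1_eq[symmetric])
    ultimately show ?thesis using wN False by (simp add: eq)
  qed
qed

lemma has_sum_finite_sum: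
  fixes f :: "'i \<Rightarrow> 'a \<Rightarrow> complex"
  assumes "finite I" "\<And>i. i \<in> I \<Longrightarrow> (f i has_sum s i) A"
  shows "((\<lambda>x. \<Sum>i\<in>I. f i x) has_sum (\<Sum>i\<in>I. s i)) A"
  using assms by (induction I rule: finite_induct) (auto intro!: has_sum_add)

text \<open>Averaging over the \<open>N\<close>-th roots of unity leaves only the coefficients at multiples of \<open>N\<close>.\<close>

lemma laurent_coeff_0_eq_0:
  fixes h :: "int \<Rightarrow> complex"
  assumes h: "\<And>u. norm u = 1 \<Longrightarrow> ((\<lambda>k. h k * u powi k) has_sum 0) UNIV"
  shows "h 0 = 0"
proof -
  have "h summable_on UNIV" using has_sum_imp_summable[OF h[of 1]] by simp
  then have abs: "(\<lambda>k. norm (h k)) summable_on UNIV"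
    by (simp add: summable_on_iff_abs_summable_on_complex)
  have bound: "norm (h 0) \<le> e" if e: "e > 0" for e
  proof -
    obtain F where F: "finite F" "norm (sum (\<lambda>k. norm (h k)) F - infsum (\<lambda>k. norm (h k)) UNIV) \<le> e"
      using infsum_finite_approximation[OF abs e] by (auto simp: dist_norm)
    \<comment> \<open>\<open>N\<close> exceeds every index in \<open>F\<close>, so the nonzero
      multiples of \<open>N\<close> avoid \<open>F\<close> and lie in the small tail.\<close>
    define N where "N = Suc (nat (\<Sum>k\<in>F. \<bar>k\<bar>))"
    have N: "\<bar>k\<bar> < int N" if "k \<in> F" for k
    proof -
      have "\<bar>k\<bar> \<le> (\<Sum>k\<in>F. \<bar>k\<bar>)" using that F(1) by (intro member_le_sum) auto
      then show ?thesis by (simp add: N_def)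
    qed
    have N0: "N > 0" by (simp add: N_def)
    define D where "D = {k. int N dvd k \<and> k \<noteq> 0}"
    have "((\<lambda>k. \<Sum>j<N. h k * (cis (2 * pi / real N) ^ j) powi k) has_sum (\<Sum>j<N. 0)) UNIV"
      by (intro has_sum_finite_sum h) (simp_all add: norm_power)
    then have "((\<lambda>k. h k * (if int N dvd k then of_nat N else 0)) has_sum 0) UNIV"
      by (simp only: sum_distrib_left[symmetric] sum_powers_root_of_unity[OF N0] sum.neutral_const)
    then have "((\<lambda>k. inverse (of_nat N) * (h k * (if int N dvd k then of_nat N else 0))) has_sum inverse (of_nat N) * 0) UNIV"
      by (rule has_sum_cmult_right)
    then have "((\<lambda>k. inverse (of_nat N) * (h k * (if int N dvd k then of_nat N else 0))) has_sum 0) UNIV"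
      by simp
    also have "?this \<longleftrightarrow> (h has_sum 0) (insert 0 D)"
      using N0 by (intro has_sum_cong_neutral) (auto simp: D_def)
    finally have all: "(h has_sum 0) (insert 0 D)" .
    have "h summable_on D" using \<open>h summable_on UNIV\<close> by (rule summable_on_subset_banach) auto
    then have "infsum h (insert 0 D) = h 0 + infsum h D" by (intro infsum_insert) (auto simp: D_def)
    then have "h 0 = - infsum h D" using all by (simp add: infsumI eq_neg_iff_add_eq_0)
    moreover have absD: "(\<lambda>k. norm (h k)) summable_on A" for A
      using abs by (rule summable_on_subset_banach) auto
    ultimately have "norm (h 0) \<le> (\<Sum>\<^sub>\<infinity>k\<in>D. norm (h k))" by (simp add: norm_infsum_bound)
    also have "\<dots> \<le> (\<Sum>\<^sub>\<infinity>k\<in>UNIV - F. norm (h k))"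
    proof (rule infsum_mono_neutral[OF absD absD])
      fix x assume "x \<in> D - (UNIV - F)"
      then have "int N dvd x" "x \<noteq> 0" "\<bar>x\<bar> < int N" using N by (auto simp: D_def)
      then show "norm (h x) \<le> 0" using zdvd_not_zless[of "\<bar>x\<bar>" "int N"] by auto
    qed auto
    also have "\<dots> = infsum (\<lambda>k. norm (h k)) UNIV - sum (\<lambda>k. norm (h k)) F"
      using infsum_Diff[OF abs absD, of F] F(1) by simp
    also have "\<dots> \<le> e" using F(2) by (simp add: abs_le_iff)
    finally show ?thesis .
  qed
  show ?thesis
  proof (rule ccontr)
    assume "h 0 \<noteq> 0"
    then show False using bound[of "norm (h 0) / 2"] by simp
  qed
qed

lemma has_sum_prod_PiE:
  fixes f :: "'a \<Rightarrow> 'b \<Rightarrow> complex"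
  assumes "finite A" "\<And>x. x \<in> A \<Longrightarrow> (f x has_sum s x) (B x)"
  shows "((\<lambda>g. \<Prod>x\<in>A. f x (g x)) has_sum (\<Prod>x\<in>A. s x)) (PiE A B)"
  using assms
proof (induction A rule: finite_induct)
  case empty
  then show ?case by (simp add: has_sum_finite_iff)
next
  case (insert x A)
  have bij: "bij_betw (\<lambda>(y, g). g(x := y)) (B x \<times> PiE A B) (PiE (insert x A) B)"
    unfolding bij_betw_def using insert.hyps by (auto simp: inj_combinator PiE_insert_eq)
  have "((\<lambda>(y, g). f x y * (\<Prod>x\<in>A. f x (g x))) has_sum s x * (\<Prod>x\<in>A. s x)) (B x \<times> PiE A B)"
    by (rule has_sum_product_complex) (use insert in auto)
  also have "?this \<longleftrightarrow> ((\<lambda>yg. \<Prod>z\<in>insert x A. f z ((case yg of (y, g) \<Rightarrow> g(x := y)) z)) has_sum s x * (\<Prod>x\<in>A. s x)) (B x \<times> PiE A B)"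
  proof (rule has_sum_cong)
    fix yg assume "yg \<in> B x \<times> PiE A B"
    have "(\<Prod>z\<in>A. f z ((g(x := y)) z)) = (\<Prod>z\<in>A. f z (g z))" for y g
      using insert.hyps by (intro prod.cong) auto
    then show "(case yg of (y, g) \<Rightarrow> f x y * (\<Prod>x\<in>A. f x (g x))) =
      (\<Prod>z\<in>insert x A. f z ((case yg of (y, g) \<Rightarrow> g(x := y)) z))"
      using insert.hyps by (cases yg) simp
  qed
  also have "\<dots> \<longleftrightarrow> ((\<lambda>g. \<Prod>z\<in>insert x A. f z (g z)) has_sum s x * (\<Prod>x\<in>A. s x)) (PiE (insert x A) B)"
    by (rule has_sum_reindex_bij_betw[OF bij])
  finally show ?case using insert.hyps by simp
qed

text \<open>The arguments \<open>u * q ^ i\<close> are the residue classes modulo \<open>t\<close>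
  of the product \<open>qpoch u q\<close>. The reciprocal arguments run through the classes of
  \<open>qpoch (q / u) q\<close> in reverse order.\<close>

lemma prod_theta_runners:
  fixes q u :: complex
  assumes q: "q \<noteq> 0" "norm q < 1" and u: "u \<noteq> 0" and t: "t > 0"
  shows "(\<Prod>i<t. qpoch (q ^ t) (q ^ t) * qpoch (u * q ^ i) (q ^ t) * qpoch (q ^ t / (u * q ^ i)) (q ^ t))
    = qpoch (q ^ t) (q ^ t) ^ t * qpoch u q * qpoch (q / u) q"
proof -
  have "(\<Prod>i<t. qpoch (q ^ t / (u * q ^ i)) (q ^ t)) = (\<Prod>i<t. qpoch (q / u * q ^ (t - Suc i)) (q ^ t))"
  proof (rule prod.cong[OF refl])
    fix i assume "i \<in> {..<t}"
    then have "q ^ t = q ^ Suc (t - Suc i) * q ^ i" unfolding power_add[symmetric] by simp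
    then have "q ^ t / (u * q ^ i) = q / u * q ^ (t - Suc i)" using q u by (simp add: field_simps)
    then show "qpoch (q ^ t / (u * q ^ i)) (q ^ t) = qpoch (q / u * q ^ (t - Suc i)) (q ^ t)" by simp
  qed
  also have "\<dots> = (\<Prod>i<t. qpoch (q / u * q ^ i) (q ^ t))"
    by (rule prod.nat_diff_reindex)
  also have "\<dots> = qpoch (q / u) q" by (rule qpoch_multisection[OF q(2) t, symmetric])
  finally show ?thesis
    using qpoch_multisection[OF q(2) t, of u] by (simp add: prod.distrib)
qed

text \<open>The constant term in \<open>u\<close> of the product of \<open>t\<close> theta series is the sum over charge vectors.\<close>

lemma has_sum_charge_vectors:
  fixes q :: complex
  assumes q: "q \<noteq> 0" "norm q < 1" and t: "t > 0"
  shows "((\<lambda>c. q powi charge_energy t c) has_sum qpoch (q ^ t) (q ^ t) ^ t / qpoch q q) (charge_vectors t)"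
proof -
  define V where "V = ({..<t} \<rightarrow>\<^sub>E UNIV :: (nat \<Rightarrow> int) set)"
  define C where "C = qpoch (q ^ t) (q ^ t) ^ t / qpoch q q"
  define g where "g = (\<lambda>k. \<Sum>\<^sub>\<infinity>c\<in>{c \<in> V. (\<Sum>i<t. c i) = k}. (-1) powi k * q powi charge_energy t c)"
  have qt: "q ^ t \<noteq> 0" "norm (q ^ t) < 1" using q norm_power_less_one[OF q(2) t] by simp_all
  have qq: "qpoch q q \<noteq> 0" by (rule qpoch_self_nonzero[OF q(2)])
  have term_prod: "(\<Prod>i<t. theta_term (q ^ t) (u * q ^ i) (c i)) =
      (-1) powi (\<Sum>i<t. c i) * u powi (\<Sum>i<t. c i) * q powi charge_energy t c" if u: "u \<noteq> 0" for u c
  proof -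
    have "theta_term (q ^ t) (u * q ^ i) k = (-1) powi k * u powi k * q powi (int t * tri k + int i * k)" for i k
      using q u by (simp add: theta_term_def power_int_mult_distrib power_int_add power_int_power)
    moreover have "(\<Prod>i<n. (-1) powi c i * u powi c i * q powi (e i)) =
        (-1) powi (\<Sum>i<n. c i) * u powi (\<Sum>i<n. c i) * q powi (\<Sum>i<n. e i)" for n and e :: "nat \<Rightarrow> int"
      using q u by (induction n) (simp_all add: power_int_add mult_ac)
    ultimately show ?thesis by (simp add: charge_energy_def)
  qed
  have main: "((\<lambda>c. (-1) powi (\<Sum>i<t. c i) * u powi (\<Sum>i<t. c i) * q powi charge_energy t c) has_sum
      C * (qpoch q q * qpoch u q * qpoch (q / u) q)) V" if u: "u \<noteq> 0" for u
  proof -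
    have "((\<lambda>c. \<Prod>i<t. theta_term (q ^ t) (u * q ^ i) (c i)) has_sum
       (\<Prod>i<t. qpoch (q ^ t) (q ^ t) * qpoch (u * q ^ i) (q ^ t) * qpoch (q ^ t / (u * q ^ i)) (q ^ t))) V"
      unfolding V_def by (intro has_sum_prod_PiE jacobi_triple_product) (use q qt u in auto)
    then show ?thesis
      unfolding term_prod[OF u] prod_theta_runners[OF q u t] using qq by (simp add: C_def mult_ac)
  qed
  have summable_V: "(\<lambda>c. (-1) powi (\<Sum>i<t. c i) * q powi charge_energy t c) summable_on V"
    using has_sum_imp_summable[OF main[of 1]] by simp
  have gk: "((\<lambda>c. (-1) powi k * q powi charge_energy t c) has_sum g k) {c \<in> V. (\<Sum>i<t. c i) = k}" for k
  proof -
    have "(\<lambda>c. (-1) powi (\<Sum>i<t. c i) * q powi charge_energy t c) summable_on {c \<in> V. (\<Sum>i<t. c i) = k}"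
      by (rule summable_on_subset_banach[OF summable_V]) auto
    then have "(\<lambda>c. (-1) powi k * q powi charge_energy t c) summable_on {c \<in> V. (\<Sum>i<t. c i) = k}"
      by (rule summable_on_cong[THEN iffD1, rotated]) auto
    then show ?thesis unfolding g_def by (rule has_sum_infsum)
  qed
  \<comment> \<open>By \<open>prod_theta_runners\<close> the product of the \<open>t\<close> theta
    series is \<open>C\<close> times a single theta series of nome \<open>q\<close>. Both are
    Laurent series in \<open>u\<close>, and the single theta series has constant coefficient
    1.\<close>
  have "((\<lambda>k. (g k - C * ((-1) powi k * q powi tri k)) * u powi k) has_sum 0) UNIV" if "norm u = 1" for u
  proof -
    have u: "u \<noteq> 0" using that by auto
    have "((\<lambda>c. (-1) powi (\<Sum>i<t. c i) * u powi (\<Sum>i<t. c i) * q powi charge_energy t c) has_sum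
       C * (qpoch q q * qpoch u q * qpoch (q / u) q)) V \<longleftrightarrow>
      ((\<lambda>(k, c). u powi k * ((-1) powi k * q powi charge_energy t c)) has_sum
       C * (qpoch q q * qpoch u q * qpoch (q / u) q)) (SIGMA k:UNIV. {c \<in> V. (\<Sum>i<t. c i) = k})"
      by (rule has_sum_reindex_bij_witness[of _ snd "\<lambda>c. (\<Sum>i<t. c i, c)"]) auto
    with main[OF u] have "((\<lambda>(k, c). u powi k * ((-1) powi k * q powi charge_energy t c)) has_sum
       C * (qpoch q q * qpoch u q * qpoch (q / u) q)) (SIGMA k:UNIV. {c \<in> V. (\<Sum>i<t. c i) = k})" by simp
    then have 1: "((\<lambda>k. u powi k * g k) has_sum C * (qpoch q q * qpoch u q * qpoch (q / u) q)) UNIV"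
      by (rule has_sum_SigmaD) (use gk in \<open>auto intro: has_sum_cmult_right\<close>)
    have 2: "((\<lambda>k. C * theta_term q u k) has_sum C * (qpoch q q * qpoch u q * qpoch (q / u) q)) UNIV"
      by (intro has_sum_cmult_right jacobi_triple_product q u)
    have "((\<lambda>k. u powi k * g k - C * theta_term q u k) has_sum 0) UNIV"
      using has_sum_add[OF 1 has_sum_uminusI[OF 2]] by simp
    then show ?thesis by (simp add: theta_term_def algebra_simps)
  qed
  then have "g 0 - C * ((-1) powi 0 * q powi tri 0) = 0"
    by (rule laurent_coeff_0_eq_0)
  then have "g 0 = C" by (simp add: tri_def)
  then show ?thesis using gk[of 0] by (simp add: C_def V_def charge_vectors_def)
qed

theorem has_sum_cores:
  fixes q :: complex
  assumes q: "q \<noteq> 0" "norm q < 1" and t: "t > 0"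
  shows "((\<lambda>p. q ^ sum_list p) has_sum qpoch (q ^ t) (q ^ t) ^ t / qpoch q q) {p. is_partition p \<and> is_core t p}"
  using has_sum_charge_vectors[OF q t] has_sum_cores_iff[OF t] by blast

text \<open>A nonzero constant is summable only over a finite set. Finiteness matters because
  \<open>card\<close> is 0 on infinite sets.\<close>

lemma finite_fibers_if_summable:
  fixes q :: complex
  assumes "q \<noteq> 0" and "(\<lambda>p. q ^ w p) summable_on A"
  shows "finite {p \<in> A. w p = n}"
proof -
  have "(\<lambda>p. q ^ w p) summable_on {p \<in> A. w p = n}"
    using assms(2) by (rule summable_on_subset_banach) auto
  then have "(\<lambda>p. norm (q ^ w p)) summable_on {p \<in> A. w p = n}"
    by (simp only: summable_on_iff_abs_summable_on_complex)
  then have "(\<lambda>p. norm (q ^ n)) summable_on {p \<in> A. w p = n}"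
    by (rule summable_on_cong[THEN iffD1, rotated]) auto
  then show ?thesis using infsum_diverge_constant[of "{p \<in> A. w p = n}" "norm (q ^ n)"] assms(1)
    by auto
qed

lemma sums_core_pairs:
  fixes q :: complex
  assumes q: "q \<noteq> 0" "norm q < 1" and t: "t > 0"
  shows "(\<lambda>n. of_nat (core_tuple_count t 2 n) * q ^ n) sums (qpoch (q ^ t) (q ^ t) ^ t / qpoch q q)\<^sup>2"
proof -
  define A where "A = {p. is_partition p \<and> is_core t p}"
  define w where "w = (\<lambda>ps. \<Sum>p\<leftarrow>ps. sum_list p :: nat)"
  define T where "T = {ps. length ps = 2 \<and> set ps \<subseteq> A}"
  define S where "S = (qpoch (q ^ t) (q ^ t) ^ t / qpoch q q)\<^sup>2"
  note cores = has_sum_cores[OF q t, folded A_def]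
  have "((\<lambda>(p, p'). q ^ sum_list p * q ^ sum_list p') has_sum S) (A \<times> A)"
    unfolding S_def power2_eq_square by (intro has_sum_product_complex cores)
  also have "?this \<longleftrightarrow> ((\<lambda>ps. q ^ w ps) has_sum S) T"
  proof (rule has_sum_reindex_bij_witness[of _ "\<lambda>ps. (ps ! 0, ps ! 1)" "\<lambda>(p, p'). [p, p']"])
    fix ps assume "ps \<in> T"
    then obtain p p' where "ps = [p, p']" "p \<in> A" "p' \<in> A"
      by (auto simp: T_def length_Suc_conv numeral_2_eq_2)
    then show "(case (ps ! 0, ps ! 1) of (p, p') \<Rightarrow> [p, p']) = ps" "(ps ! 0, ps ! 1) \<in> A \<times> A" by simp_all
  qed (auto simp: T_def w_def power_add)
  finally have T: "((\<lambda>ps. q ^ w ps) has_sum S) T" .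
  have fib: "finite {ps \<in> T. w ps = n}" for n
    using q(1) has_sum_imp_summable[OF T] by (rule finite_fibers_if_summable)
  have count: "core_tuple_count t 2 n = card {ps \<in> T. w ps = n}" for n
    unfolding core_tuple_count_def is_partition_tuple_def T_def w_def A_def
    by (rule arg_cong[of _ _ card]) auto
  have "((\<lambda>ps. q ^ w ps) has_sum S) T \<longleftrightarrow> ((\<lambda>(n, ps). q ^ n) has_sum S) (SIGMA n:UNIV. {ps \<in> T. w ps = n})"
    by (rule has_sum_reindex_bij_witness[of _ snd "\<lambda>ps. (w ps, ps)"]) auto
  with T have "((\<lambda>(n, ps). q ^ n) has_sum S) (SIGMA n:UNIV. {ps \<in> T. w ps = n})" by simp
  then have "((\<lambda>n. of_nat (core_tuple_count t 2 n) * q ^ n) has_sum S) UNIV"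
  proof (rule has_sum_SigmaD)
    show "((\<lambda>ps. case (n, ps) of (n, ps) \<Rightarrow> q ^ n) has_sum of_nat (core_tuple_count t 2 n) * q ^ n) {ps \<in> T. w ps = n}" for n
      using fib[of n] by (intro has_sum_finiteI) (auto simp: count)
  qed
  then show ?thesis unfolding S_def by (rule has_sum_imp_sums)
qed

section \<open>The eta product and comparison of coefficients\<close>

lemma dedekind_eta_eq_qpoch:
  "dedekind_eta \<tau> = exp (2 * of_real pi * \<i> * \<tau> / 24) * qpoch (nome \<tau>) (nome \<tau>)"
  by (simp add: dedekind_eta_def qpoch_def)

text \<open>The prefactors combine to exactly one \<open>nome \<tau>\<close> because
  \<open>4/24 + 20/24 = 1\<close>.\<close>

lemma dedekind_eta_product:
  "dedekind_eta \<tau> ^ 4 * dedekind_eta (5 * \<tau>) ^ 4 =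
    nome \<tau> * qpoch (nome \<tau>) (nome \<tau>) ^ 4 * qpoch (nome \<tau> ^ 5) (nome \<tau> ^ 5) ^ 4"
proof -
  have n5: "nome (5 * \<tau>) = nome \<tau> ^ 5"
    unfolding nome_def exp_of_nat_mult[symmetric] by (simp add: mult_ac)
  have e: "exp (2 * of_real pi * \<i> * \<tau> / 24) ^ 4 * exp (2 * of_real pi * \<i> * (5 * \<tau>) / 24) ^ 4 = nome \<tau>"
    unfolding nome_def exp_of_nat_mult[symmetric] exp_add[symmetric]
    by (rule arg_cong[of _ _ exp]) simp
  have "(x * y) ^ 4 * (x' * y') ^ 4 = (x ^ 4 * x' ^ 4) * y ^ 4 * y' ^ 4" for x y x' y' :: complex
    by (simp only: power_mult_distrib mult_ac)
  then show ?thesis unfolding dedekind_eta_eq_qpoch n5 e[symmetric] .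
qed

text \<open>Carries the Fourier expansion from the upper half plane to the whole punctured
  disc.\<close>

lemma exists_nome:
  assumes q: "q \<noteq> 0" "norm q < 1"
  shows "\<exists>\<tau>. Im \<tau> > 0 \<and> nome \<tau> = q"
proof (intro exI conjI)
  define \<tau> where "\<tau> = Ln q / (2 * of_real pi * \<i>)"
  have e: "2 * of_real pi * \<i> * \<tau> = Ln q" by (simp add: \<tau>_def)
  then show "nome \<tau> = q" using q by (simp add: nome_def)
  have "Re (2 * of_real pi * \<i> * \<tau>) = - 2 * pi * Im \<tau>" by simp
  moreover have "Re (Ln q) < 0" using q by (simp add: Re_Ln)
  ultimately have "0 < pi * Im \<tau>" unfolding e by simp
  then show "Im \<tau> > 0" by (simp add: zero_less_mult_iff)
qed

lemma powser_coeffs_eq_0: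
  fixes d :: "nat \<Rightarrow> complex"
  assumes d: "\<And>q. q \<noteq> 0 \<Longrightarrow> norm q < 1 \<Longrightarrow> (\<lambda>n. d n * q ^ Suc n) sums 0"
  shows "d n = 0"
proof (rule ccontr)
  assume nz: "d n \<noteq> 0"
  \<comment> \<open>Prepending a zero constant term turns the series into an ordinary power series,
    which converges to 0 at \<open>q = 0\<close> as well.\<close>
  define e where "e = (\<lambda>n. case n of 0 \<Rightarrow> 0 | Suc m \<Rightarrow> d m)"
  have "(\<lambda>n. e n * (q - 0) ^ n) sums 0" if "norm (q - 0) < 1" for q
  proof (cases "q = 0")
    case True
    then have "e n * (q - 0) ^ n = 0" for n by (cases n) (simp_all add: e_def)
    then show ?thesis by (simp only: sums_zero)
  next
    case False
    then have "(\<lambda>n. e (Suc n) * q ^ Suc n) sums 0" using d[of q] that by (simp add: e_def)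
    then show ?thesis by (subst (asm) sums_Suc_iff) (simp add: e_def)
  qed
  then obtain s where s: "0 < s" "\<And>z. z \<in> cball (0::complex) s - {0} \<Longrightarrow> (0::complex) \<noteq> 0"
    using powser_0_nonzero[of 1 0 e "\<lambda>_. 0" "Suc n"] nz by (auto simp: e_def)
  have "of_real s \<in> cball (0::complex) s - {0}" using s(1) by auto
  then show False using s(2) by blast
qed

theorem theorem5p3:
  fixes a :: "nat \<Rightarrow> complex" and n :: nat
  assumes fourier: "\<And>\<tau>. Im \<tau> > 0 \<Longrightarrow>
    (\<lambda>m. a (Suc m) * nome \<tau> ^ Suc m) sums (dedekind_eta \<tau> ^ 4 * dedekind_eta (5 * \<tau>) ^ 4)"
  shows "of_nat (core_tuple_count 5 2 n) =
    (1 / 13) * (of_nat (sigma_sharp_3_5 (n + 2)) - a (n + 2))"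
proof -
  \<comment> \<open>The core series carries a factor \<open>q^2\<close> but the other two start at
    \<open>q\<close>, so its coefficients are shifted by one; the claim is then read off at index
    \<open>Suc n\<close>.\<close>
  define b :: "nat \<Rightarrow> complex" where "b = (\<lambda>m. case m of 0 \<Rightarrow> 0 | Suc k \<Rightarrow> of_nat (core_tuple_count 5 2 k))"
  define d where "d = (\<lambda>m. of_nat (sigma_sharp_3_5 (Suc m)) - a (Suc m) - 13 * b m)"
  have "(\<lambda>m. d m * q ^ Suc m) sums 0" if q: "q \<noteq> 0" "norm q < 1" for q
  proof -
    define P K where "P = qpoch (q ^ 5) (q ^ 5)" and "K = qpoch q q"
    obtain \<tau> where \<tau>: "Im \<tau> > 0" "nome \<tau> = q" using exists_nome[OF q] by blast
    have 1: "(\<lambda>m. of_nat (sigma_sharp_3_5 (Suc m)) * q ^ Suc m) sums (13 * (q\<^sup>2 * P ^ 10 / K ^ 2) + q * K ^ 4 * P ^ 4)"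
      using sums_sigma_sharp[OF q(2)] unfolding lambert_three_eq_eta[OF q] P_def K_def .
    have 2: "(\<lambda>m. a (Suc m) * q ^ Suc m) sums (q * K ^ 4 * P ^ 4)"
      using fourier[OF \<tau>(1)] unfolding dedekind_eta_product \<tau>(2) P_def K_def .
    have "(\<lambda>m. of_nat (core_tuple_count 5 2 m) * q ^ m) sums (P ^ 5 / K)\<^sup>2"
      unfolding P_def K_def by (rule sums_core_pairs[OF q]) simp
    then have "(\<lambda>m. q\<^sup>2 * (of_nat (core_tuple_count 5 2 m) * q ^ m)) sums (q\<^sup>2 * (P ^ 5 / K)\<^sup>2)"
      by (rule sums_mult)
    then have "(\<lambda>m. b (Suc m) * q ^ Suc (Suc m)) sums (q\<^sup>2 * (P ^ 5 / K)\<^sup>2)"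
      by (simp add: b_def power2_eq_square mult_ac)
    then have "(\<lambda>m. b m * q ^ Suc m) sums (q\<^sup>2 * (P ^ 5 / K)\<^sup>2)"
      by (subst (asm) sums_Suc_iff) (simp add: b_def)
    then have 3: "(\<lambda>m. 13 * (b m * q ^ Suc m)) sums (13 * (q\<^sup>2 * P ^ 10 / K ^ 2))"
      by (simp only: sums_mult power_divide power_mult[symmetric] times_divide_eq_right) (use sums_mult in fastforce)
    from sums_diff[OF sums_diff[OF 1 2] 3] show ?thesis
      by (simp add: d_def algebra_simps)
  qed
  then have "d (Suc n) = 0" by (rule powser_coeffs_eq_0)
  then show ?thesis by (simp add: d_def b_def)
qed

end
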